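(* Suppose that: (i) $F$ is twice continuously differentiable and, for constants $0<\mu\le L<\infty$, $\|\nabla F(\theta)-\nabla F(\theta')\|_2\le L\|\theta-\theta'\|_2$ and $\langle \nabla F(\theta)-\nabla F(\theta'),\theta-\theta'\rangle\ge \mu\|\theta-\theta'\|_2^2$ for all $\theta,\theta'\in\mathbb{R}^d$; (ii) at the minimizer $\theta^*$ of $F$, $\Sigma^*=\mathbb{E}[\nabla f(\theta^*;\xi)\nabla f(\theta^*;\xi)^\top]$ is positive definite with finite trace $\sigma_*^2=\mathbb{E}\|\nabla f(\theta^*;\xi)\|_2^2$; (iii) for a constant $\ell_\Xi>0$, $\mathbb{E}\|\varepsilon(\theta;\xi)-\varepsilon(\theta';\xi)\|_2^2\le \ell_\Xi^2\|\theta-\theta'\|_2^2$ for all $\theta,\theta'\in\mathbb{R}^d$; (iv) $\nabla^2F$ is continuous at $\theta^*$, i.e. $\lim_{\theta\to\theta^*}\|\nabla^2F(\theta)-\nabla^2F(\theta^* )\|_{\mathrm{op}}=0$. Fix $\theta_0\in\mathbb{R}^d$, and for a step-size $\eta>0$ and sample size $n$ let $\theta_n^{\mathrm{final},(\eta)}$ be the output of multi-epoch ROOT-SGD from $\theta_0$ with step-size $\eta$, burn-in time $T_0=\lceil\frac{24}{\eta\mu}\rceil$, short epoch length $T^\flat=\lceil\frac{7340}{\eta\mu}\rceil$ and number of short epochs $B=\left\lceil\frac12\log\left(\frac{e\|\nabla F(\theta_0)\|_2^2}{\eta\mu\sigma_*^2}\right)\right\rceil$. Then as $n\to\infty$ and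 $\eta\to0$ (along any sequence of pairs $(n,\eta)$) in such a way that $\eta(n-T^\flat B)\to\infty$ and $T^\flat B/n\to0$, $$\sqrt n\left(\theta_n^{\mathrm{final},(\eta)}-\theta^*\right)\xrightarrow{d}\mathcal N\left(0,[\nabla^2F(\theta^* )]^{-1}\Sigma^*[\nabla^2F(\theta^* )]^{-1}\right).$$
   Context: Let $\xi$ be a random element of a measurable space $\mathcal{X}$ with distribution $\mathbb{P}$, let $f:\mathbb{R}^d\times\mathcal{X}\to\mathbb{R}$ be differentiable in its first argument, and let $F(\theta)=\mathbb{E}[f(\theta;\xi)]$, with $\nabla F(\theta)=\mathbb{E}[\nabla f(\theta;\xi)]$ for all $\theta$. The noise is $\varepsilon(\theta;\xi)=\nabla f(\theta;\xi)-\nabla F(\theta)$. Samples $\xi_1,\xi_2,\ldots$ are i.i.d. from $\mathbb{P}$. The function $F$, the distribution $\mathbb{P}$ and $\theta_0$ do not vary with $n,\eta$. Single-epoch ROOT-SGD with initialization $\theta_0$, step-size $\eta>0$ and burn-in period $T_0\ge1$: set $\theta_t=\theta_0$ for $1\le t\le T_0-1$; $v_t=\frac1t\sum_{s=1}^t\nabla f(\theta_0;\xi_s)$ for $1\le t\le T_0$; $v_t=\nabla f(\theta_{t-1};\xi_t)+\frac{t-1}{t}\big(v_{t-1}-\nabla f(\theta_{t-2};\xi_t)\big)$ for $t\ge T_0+1$; and $\theta_t=\theta_{t-1}-\eta v_t$ for $t\ge T_0$. Multi-epoch ROOT-SGD with total sample size $n$, deterministic initialization $\theta_0$, step-size $\eta$,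 burn-in $T_0$, short epoch length $T^\flat\ge T_0$ and number of short epochs $B$: set $\theta_0^{(1)}=\theta_0$; for $b=1,\ldots,B$ run single-epoch ROOT-SGD for $T^\flat$ iterations on fresh samples with burn-in $T_0$, initialized at $\theta_0^{(b)}$, and set $\theta_0^{(b+1)}$ to be its last iterate; finally run single-epoch ROOT-SGD on fresh samples with burn-in $T_0$, initialized at $\theta_0^{(B+1)}$, for $T=n-T^\flat B$ iterations, and output its last iterate. If the formula for $B$ gives a nonpositive value, or $\nabla F(\theta_0)=0$, then $B=0$ (no short epochs). *)

theory Defs
  imports "HOL-Probability.Probability"
begin

text \<open>Unspecified where \<open>h\<close> is not differentiable.\<close>

definition gradient :: "('a::real_inner \<Rightarrow> real) \<Rightarrow> 'a \<Rightarrow> 'a" where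
  "gradient h x = (THE D. GDERIV h x :> D)"

definition hessian :: "(real^'d \<Rightarrow> real) \<Rightarrow> real^'d \<Rightarrow> real^'d^'d" where
  "hessian h x = jacobian (gradient h) (at x)"

definition twice_cont_differentiable :: "(real^'d \<Rightarrow> real) \<Rightarrow> bool" where
  "twice_cont_differentiable h \<longleftrightarrow>
     (\<forall>x. h differentiable (at x)) \<and>
     (\<forall>x. gradient h differentiable (at x)) \<and>
     continuous_on UNIV (hessian h)"

definition op_norm :: "real^'n^'m \<Rightarrow> real" where
  "op_norm A = onorm (\<lambda>v. A *v v)"

definition pos_definite :: "real^'d^'d \<Rightarrow> bool" where
  "pos_definite A \<longleftrightarrow> transpose A = A \<and> (\<forall>v. v \<noteq> 0 \<longrightarrow> v \<bullet> (A *v v) > 0)"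

definition stoch_grad :: "('a::real_inner \<Rightarrow> 'x \<Rightarrow> real) \<Rightarrow> 'a \<Rightarrow> 'x \<Rightarrow> 'a" where
  "stoch_grad f \<theta> x = gradient (\<lambda>\<theta>'. f \<theta>' x) \<theta>"

definition grad_noise :: "('a::real_inner \<Rightarrow> 'x \<Rightarrow> real) \<Rightarrow> ('a \<Rightarrow> real) \<Rightarrow> 'a \<Rightarrow> 'x \<Rightarrow> 'a" where
  "grad_noise f F \<theta> x = stoch_grad f \<theta> x - gradient F \<theta>"

text \<open>Uncentred moments; they are the covariance and its trace where the mean gradient vanishes.\<close>

definition grad_second_moment ::
  "'x measure \<Rightarrow> (real^'d \<Rightarrow> 'x \<Rightarrow> real) \<Rightarrow> real^'d \<Rightarrow> real^'d^'d" where
  "grad_second_moment P f \<theta> =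
     (\<chi> i j. \<integral>x. stoch_grad f \<theta> x $ i * stoch_grad f \<theta> x $ j \<partial>P)"

definition grad_mean_square ::
  "'x measure \<Rightarrow> ('a::real_inner \<Rightarrow> 'x \<Rightarrow> real) \<Rightarrow> 'a \<Rightarrow> real" where
  "grad_mean_square P f \<theta> = (\<integral>x. (norm (stoch_grad f \<theta> x))\<^sup>2 \<partial>P)"

text \<open>The normal distribution on \<open>\<real>\<^sup>d\<close> through its Lebesgue density; intended for positive definite
  covariance \<open>S\<close> only (no degenerate Gaussians).\<close>

definition multi_normal :: "real^'d \<Rightarrow> real^'d^'d \<Rightarrow> (real^'d) measure" where
  "multi_normal m S = density lborel (\<lambda>x. ennreal (
     exp (- ((x - m) \<bullet> (matrix_inv S *v (x - m))) / 2) / sqrt ((2 * pi) ^ CARD('d) * det S)))"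

text \<open>The library's \<open>weak_conv_m\<close> covers measures on the real line only.\<close>

definition weak_convergence ::
  "(nat \<Rightarrow> 'a::topological_space measure) \<Rightarrow> 'a measure \<Rightarrow> bool" where
  "weak_convergence \<mu> \<nu> \<longleftrightarrow>
     (\<forall>h :: 'a \<Rightarrow> real. continuous_on UNIV h \<longrightarrow> bounded (range h) \<longrightarrow>
        (\<lambda>k. \<integral>x. h x \<partial>(\<mu> k)) \<longlonglongrightarrow> (\<integral>x. h x \<partial>\<nu>))"

text \<open>Single-epoch ROOT-SGD with gradient oracle \<open>g\<close>, run on the samples \<open>xs 1, xs 2, \<dots>\<close>
  (\<open>xs 0\<close> is never used). The estimator \<open>v\<^sub>t\<close> is meaningful for \<open>t \<ge> 1\<close>, and \<open>T0 \<ge> 1\<close> is intended.\<close>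

function
  root_sgd_v :: "('a::real_vector \<Rightarrow> 'x \<Rightarrow> 'a) \<Rightarrow> real \<Rightarrow> nat \<Rightarrow> 'a \<Rightarrow> (nat \<Rightarrow> 'x) \<Rightarrow> nat \<Rightarrow> 'a" and
  root_sgd :: "('a::real_vector \<Rightarrow> 'x \<Rightarrow> 'a) \<Rightarrow> real \<Rightarrow> nat \<Rightarrow> 'a \<Rightarrow> (nat \<Rightarrow> 'x) \<Rightarrow> nat \<Rightarrow> 'a"
where
  "root_sgd_v g \<eta> T0 \<theta>0 xs t =
     (if t \<le> T0 then (1 / real t) *\<^sub>R (\<Sum>s = 1..t. g \<theta>0 (xs s))
      else g (root_sgd g \<eta> T0 \<theta>0 xs (t - 1)) (xs t)
           + ((real t - 1) / real t) *\<^sub>R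
               (root_sgd_v g \<eta> T0 \<theta>0 xs (t - 1) - g (root_sgd g \<eta> T0 \<theta>0 xs (t - 2)) (xs t)))"
| "root_sgd g \<eta> T0 \<theta>0 xs t =
     (if t = 0 \<or> t < T0 then \<theta>0
      else root_sgd g \<eta> T0 \<theta>0 xs (t - 1) - \<eta> *\<^sub>R root_sgd_v g \<eta> T0 \<theta>0 xs t)"
  by pat_completeness auto
termination
  by (relation "Wellfounded.measure (\<lambda>p. case p of
        Inl (g, \<eta>, T0, \<theta>0, xs, t) \<Rightarrow> 2 * t | Inr (g, \<eta>, T0, \<theta>0, xs, t) \<Rightarrow> 2 * t + 1)") auto

declare root_sgd_v.simps [simp del] root_sgd.simps [simp del]

text \<open>\<open>epoch_init \<dots> b\<close> is the initial point of epoch \<open>b + 1\<close>. Epoch \<open>b + 1\<close> runs on the block of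
  samples with indices \<open>b * Tb + 1, \<dots>, b * Tb + Tb\<close>, so every sample is used in one epoch only.\<close>

primrec epoch_init ::
  "('a::real_vector \<Rightarrow> 'x \<Rightarrow> 'a) \<Rightarrow> real \<Rightarrow> nat \<Rightarrow> nat \<Rightarrow> 'a \<Rightarrow> (nat \<Rightarrow> 'x) \<Rightarrow> nat \<Rightarrow> 'a" where
  "epoch_init g \<eta> T0 Tb \<theta>0 xs 0 = \<theta>0"
| "epoch_init g \<eta> T0 Tb \<theta>0 xs (Suc b) =
     root_sgd g \<eta> T0 (epoch_init g \<eta> T0 Tb \<theta>0 xs b) (\<lambda>t. xs (b * Tb + t)) Tb"

text \<open>The last epoch has length \<open>n - Tb * B\<close> (truncated subtraction; meant for \<open>Tb * B \<le> n\<close>).\<close>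

definition multi_root_sgd ::
  "('a::real_vector \<Rightarrow> 'x \<Rightarrow> 'a) \<Rightarrow> real \<Rightarrow> nat \<Rightarrow> nat \<Rightarrow> nat \<Rightarrow> 'a \<Rightarrow> (nat \<Rightarrow> 'x) \<Rightarrow> nat \<Rightarrow> 'a" where
  "multi_root_sgd g \<eta> T0 Tb B \<theta>0 xs n =
     root_sgd g \<eta> T0 (epoch_init g \<eta> T0 Tb \<theta>0 xs B) (\<lambda>t. xs (B * Tb + t)) (n - Tb * B)"

end

theory Submission
  imports Defs
begin

text \<open>Write \<open>G\<close> for the gradient of \<open>F\<close> and \<open>z\<^sub>t = v\<^sub>t - G (\<theta>\<^sub>t\<^sub>-\<^sub>1)\<close>. Then \<open>t z\<^sub>t\<close> is a martingale from \<open>t = 0\<close> on (burn-in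
  included), and \<open>t v\<^sub>t\<close> is obtained from its predecessor by a gradient step, which contracts, plus
  the same martingale increments. A joint induction bounds \<open>E|t z\<^sub>t|\<^sup>2\<close> by \<open>O(t)\<close> and \<open>E|t v\<^sub>t|\<^sup>2\<close> by
  \<open>O(1 / \<eta>)\<close> once the squared gradient at the initial point is \<open>O(\<eta>)\<close>, and shows that a short epoch
  reduces the mean squared gradient by a factor 10 up to \<open>O(\<eta>)\<close>, so that the short epochs reach this
  order. In the last epoch, with \<open>N\<close> one more than its length, \<open>sqrt N G (\<theta>)\<close> at the final iterate
  differs from \<open>- N\<^sup>-\<^sup>1\<^sup>/\<^sup>2 \<Sum> \<nabla>f (\<theta>\<^sup>*; \<xi>\<^sub>i)\<close> by \<open>O(1 / (\<eta> N) + \<eta>)\<close> in mean square. The limit law then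
  follows from linearising \<open>G\<close> at \<open>\<theta>\<^sup>*\<close>, the one-dimensional central limit theorem applied to
  projections, and a Levy continuity theorem on Euclidean space, which is proved by Gaussian smoothing.\<close>

section \<open>Gaussian measures and characteristic functions\<close>

text \<open>The noise of the gradients is not bounded: it grows with the distance to the root, and
  the recursive estimator weights its change along a step by \<open>t\<close>. The bounds on
  \<open>m\<close> and \<open>u\<close> therefore feed each other and neither can be had alone. The
  circle closes because a step has length of order \<open>\<eta> / t\<close> times \<open>u\<close>,
  so that the weight cancels, and because \<eta> is eventually small. The burn-in of length
  \<open>24 / (\<eta> * \<mu>)\<close> keeps the growth \<open>1 + 1 / t\<close> of the weights
  below the gain of a gradient step. The factor 1 / 10 of a short epoch has to beat
  \<open>exp (- 2)\<close>, the rate to which the number of epochs is calibrated. The last block of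
  samples starts at an index that moves with \<open>k\<close>, so its sums are not partial sums of
  one sequence; the limit is taken on characteristic functions, where a block counts only through
  its length. The length is increased by one because the estimator at time \<open>t + 1\<close> is
  the one that estimates the gradient at iterate \<open>t\<close>.\<close>

definition std_gauss :: "'a::euclidean_space \<Rightarrow> real" where
  "std_gauss x = (\<Prod>b\<in>Basis. std_normal_density (x \<bullet> b))"

lemma std_gauss_pos: "std_gauss x > 0"
  unfolding std_gauss_def by (intro prod_pos) (auto intro: normal_density_pos)

lemma std_gauss_measurable[measurable]: "std_gauss \<in> borel_measurable borel"
  unfolding std_gauss_def by measurable

lemma sum_Basis_sq: "(\<Sum>b\<in>Basis. (x \<bullet> b)\<^sup>2) = (norm (x::'a::euclidean_space))\<^sup>2"
  unfolding power2_norm_eq_inner by (subst euclidean_inner[of x x]) (simp add: power2_eq_square)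

lemma std_gauss_eq:
  "std_gauss (x::'a::euclidean_space) = (1 / sqrt (2 * pi)) ^ DIM('a) * exp (- (norm x)\<^sup>2 / 2)"
proof -
  have "(\<Prod>b\<in>(Basis::'a set). exp (- (x \<bullet> b)\<^sup>2 / 2)) = exp (\<Sum>b\<in>(Basis::'a set). - (x \<bullet> b)\<^sup>2 / 2)"
    by (simp add: exp_sum)
  also have "\<dots> = exp (- (norm x)\<^sup>2 / 2)"
    by (simp add: sum_Basis_sq[symmetric] sum_divide_distrib[symmetric] sum_negf)
  finally show ?thesis
    unfolding std_gauss_def std_normal_density_def prod.distrib by (simp add: power_one_over)
qed

lemma lborel_prod_integral:
  fixes f :: "'a::euclidean_space \<Rightarrow> real \<Rightarrow> 'b::{real_normed_field,banach,second_countable_topology}"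
  assumes "\<And>b. b \<in> Basis \<Longrightarrow> integrable lborel (f b)"
  shows "integrable lborel (\<lambda>x. \<Prod>b\<in>Basis. f b (x \<bullet> b))"
    and "(\<integral>x. (\<Prod>b\<in>Basis. f b (x \<bullet> b)) \<partial>lborel) = (\<Prod>b\<in>Basis. \<integral>t. f b t \<partial>lborel)"
proof -
  interpret product_sigma_finite "\<lambda>_::'a. lborel::real measure" ..
  have [measurable]: "b \<in> Basis \<Longrightarrow> f b \<in> borel_measurable borel" for b
    using borel_measurable_integrable[OF assms] by simp
  have eq: "(\<Prod>b\<in>Basis. f b ((\<Sum>c\<in>Basis. g c *\<^sub>R c) \<bullet> b)) = (\<Prod>b\<in>Basis. f b (g b))" for g :: "'a \<Rightarrow> real"
    by (intro prod.cong refl) (simp add: inner_sum_left inner_Basis if_distrib cong: if_cong)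
  show "integrable lborel (\<lambda>x. \<Prod>b\<in>Basis. f b (x \<bullet> b))"
    by (subst lborel_eq, subst integrable_distr_eq) (auto simp: eq intro!: product_integrable_prod assms)
  show "(\<integral>x. (\<Prod>b\<in>Basis. f b (x \<bullet> b)) \<partial>lborel) = (\<Prod>b\<in>Basis. \<integral>t. f b t \<partial>lborel)"
    by (subst (1) lborel_eq, subst integral_distr) (auto simp: eq product_integral_prod assms)
qed

lemma std_gauss_integrable: "integrable lborel (std_gauss :: 'a::euclidean_space \<Rightarrow> real)"
  unfolding std_gauss_def by (intro lborel_prod_integral) simp

lemma std_gauss_integral: "(\<integral>x. std_gauss (x::'a::euclidean_space) \<partial>lborel) = 1"
  unfolding std_gauss_def by (subst lborel_prod_integral) simp_all

abbreviation gauss :: "'a::euclidean_space measure" where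
  "gauss \<equiv> density lborel (\<lambda>x. ennreal (std_gauss x))"

lemma prob_space_gauss: "prob_space (gauss :: 'a::euclidean_space measure)"
proof (rule prob_spaceI)
  have "emeasure (gauss::'a measure) (space gauss) = (\<integral>\<^sup>+x. ennreal (std_gauss (x::'a)) \<partial>lborel)"
    by (subst emeasure_density) (auto simp: space_density)
  also have "\<dots> = 1"
    by (subst nn_integral_eq_integral[OF std_gauss_integrable])
       (auto simp: std_gauss_integral less_imp_le std_gauss_pos)
  finally show "emeasure (gauss::'a measure) (space gauss) = 1" .
qed

lemma iexp_sum: "finite A \<Longrightarrow> iexp (sum f A) = (\<Prod>a\<in>A. iexp (f a))"
  by (simp add: sum_distrib_left exp_sum)

lemma gauss_charfun:
  "(\<integral>x. iexp (t \<bullet> x) \<partial>(gauss :: 'a::euclidean_space measure)) = exp (- (norm t)\<^sup>2 / 2)"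
proof -
  have 1: "integrable lborel (\<lambda>x. iexp (s * x) * complex_of_real (std_normal_density x))" for s
    by (rule Bochner_Integration.integrable_bound[of _ "std_normal_density"])
       (auto simp: norm_mult)
  have 2: "(\<integral>x. iexp (s * x) * complex_of_real (std_normal_density x) \<partial>lborel) = exp (- s\<^sup>2 / 2)" for s
    using fun_cong[OF char_std_normal_distribution, of s]
    unfolding char_def by (subst (asm) integral_density) (auto simp: scaleR_conv_of_real ac_simps)
  have eq: "iexp (t \<bullet> x) * complex_of_real (std_gauss x)
      = (\<Prod>b\<in>Basis. iexp ((t \<bullet> b) * (x \<bullet> b)) * complex_of_real (std_normal_density (x \<bullet> b)))" for x :: 'a
  proof -
    have "iexp (t \<bullet> x) = (\<Prod>b\<in>Basis. iexp ((t \<bullet> b) * (x \<bullet> b)))"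
      by (subst euclidean_inner) (rule iexp_sum, simp)
    then show ?thesis by (simp add: std_gauss_def prod.distrib)
  qed
  have "(\<integral>x. iexp (t \<bullet> x) \<partial>(gauss :: 'a measure))
      = (\<integral>x. iexp (t \<bullet> x) * complex_of_real (std_gauss x) \<partial>lborel)"
    by (subst integral_density) (auto simp: scaleR_conv_of_real ac_simps less_imp_le std_gauss_pos)
  also have "\<dots> = (\<integral>x. (\<Prod>b\<in>Basis. iexp ((t \<bullet> b) * (x \<bullet> b)) * complex_of_real (std_normal_density (x \<bullet> b))) \<partial>(lborel::'a measure))"
    by (simp only: eq)
  also have "\<dots> = (\<Prod>b\<in>(Basis::'a set). complex_of_real (exp (- (t \<bullet> b)\<^sup>2 / 2)))"
    by (subst lborel_prod_integral(2)[OF 1]) (simp only: 2)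
  also have "\<dots> = complex_of_real (\<Prod>b\<in>(Basis::'a set). exp (- (t \<bullet> b)\<^sup>2 / 2))" by simp
  also have "(\<Prod>b\<in>(Basis::'a set). exp (- (t \<bullet> b)\<^sup>2 / 2)) = exp (- (norm t)\<^sup>2 / 2)"
    by (simp add: exp_sum[symmetric] sum_Basis_sq[symmetric] sum_divide_distrib[symmetric] sum_negf)
  finally show ?thesis by simp
qed

text \<open>Up to its constant the Gaussian is its own Fourier transform. This replaces a Gaussian
  kernel by an average of exponentials, which is where characteristic functions come in.\<close>

lemma std_gauss_fourier:
  "complex_of_real (std_gauss (z::'a::euclidean_space))
    = (1 / sqrt (2 * pi)) ^ DIM('a) * (\<integral>t. iexp (t \<bullet> z) \<partial>gauss)"
  by (subst inner_commute, subst gauss_charfun) (simp add: std_gauss_eq)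

section \<open>Gaussian smoothing and Levy's continuity theorem\<close>

lemma iexp_inner_measurable[measurable]:
  "f \<in> borel_measurable M \<Longrightarrow> (\<lambda>x. iexp (f x)) \<in> borel_measurable M"
  by measurable

abbreviation charfun :: "'a::euclidean_space measure \<Rightarrow> 'a \<Rightarrow> complex" where
  "charfun \<mu> t \<equiv> \<integral>x. iexp (t \<bullet> x) \<partial>\<mu>"

abbreviation gauss_smooth :: "real \<Rightarrow> ('a::euclidean_space \<Rightarrow> real) \<Rightarrow> 'a \<Rightarrow> real" where
  "gauss_smooth d h x \<equiv> \<integral>z. h (x + d *\<^sub>R z) \<partial>gauss"

text \<open>Substituting \<open>y = x + d *\<^sub>R z\<close> moves \<open>x\<close> out of
  \<open>h\<close> and into the kernel, to which the Fourier formula applies; the power of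
  \<open>1 / d\<close> is the Jacobian.\<close>

lemma std_gauss_scaled_fourier:
  fixes h :: "'a::euclidean_space \<Rightarrow> real" and x :: 'a
  assumes [measurable]: "h \<in> borel_measurable borel" and d: "d > 0"
  shows "gauss_smooth d h x
    = (1 / d) ^ DIM('a) * (\<integral>y. h y * std_gauss ((1 / d) *\<^sub>R (y - x)) \<partial>lborel)"
proof -
  have "(\<integral>y. h y * std_gauss ((1 / d) *\<^sub>R (y - x)) \<partial>lborel)
     = (\<integral>y. h y * std_gauss ((1 / d) *\<^sub>R (y - x)) \<partial>(density (distr lborel borel (\<lambda>z. x + d *\<^sub>R z)) (\<lambda>_. \<bar>d\<bar>^DIM('a))))"
    by (subst (1) lborel_affine[of d x]) (use d in auto)
  also have "\<dots> = d ^ DIM('a) * (\<integral>z. h (x + d *\<^sub>R z) * std_gauss z \<partial>lborel)"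
    using d by (subst integral_density) (auto simp: integral_distr)
  also have "(\<integral>z. h (x + d *\<^sub>R z) * std_gauss z \<partial>lborel) = gauss_smooth d h x"
    by (subst integral_density) (auto simp: less_imp_le std_gauss_pos mult.commute)
  finally show ?thesis using d by (simp add: power_one_over)
qed

text \<open>After the kernel is expanded into exponentials, one exchange of integrals moves the
  integral over \<open>y\<close> inside and a second one the integral over \<mu>, so that \<mu> is
  seen only through its characteristic function. Lebesgue integrability of \<open>h\<close> licenses
  the first exchange and bounds \<open>?H\<close> for the second.\<close>

lemma gauss_smoothing_charfun:
  fixes h :: "'a::euclidean_space \<Rightarrow> real"
  assumes \<mu>: "prob_space \<mu>" "sets \<mu> = sets borel" and h: "integrable lborel h" and d: "d > 0"
  shows "complex_of_real (\<integral>x. gauss_smooth d h x \<partial> \<mu>)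
    = (1 / (d * sqrt (2 * pi))) ^ DIM('a) *
      (\<integral>t. (\<integral>y. complex_of_real (h y) * iexp (((1 / d) *\<^sub>R t) \<bullet> y) \<partial>lborel)
         * charfun \<mu> (- (1 / d) *\<^sub>R t) \<partial>gauss)"
proof -
  interpret \<mu>: prob_space \<mu> by fact
  interpret G: prob_space "gauss::'a measure" by (rule prob_space_gauss)
  interpret LG: pair_sigma_finite "lborel::'a measure" "gauss::'a measure" ..
  interpret GM: pair_sigma_finite "gauss::'a measure" \<mu> ..
  note [measurable_cong] = \<mu>(2)
  have [measurable]: "h \<in> borel_measurable borel" using h by auto
  define c where "c = complex_of_real (1 / (d * sqrt (2 * pi))) ^ DIM('a)"
  let ?H = "\<lambda>t. (\<integral>y. complex_of_real (h y) * iexp (((1 / d) *\<^sub>R t) \<bullet> y) \<partial>lborel)"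
  have H_bound: "norm (?H t) \<le> (\<integral>y. \<bar>h y\<bar> \<partial>lborel)" for t
    by (rule order_trans[OF integral_norm_bound]) (simp add: norm_mult)
  have inner_eq: "complex_of_real (gauss_smooth d h x)
    = c * (\<integral>t. ?H t * iexp ((- (1 / d) *\<^sub>R t) \<bullet> x) \<partial>gauss)" for x
  proof -
    have int: "integrable (lborel \<Otimes>\<^sub>M gauss) (\<lambda>(y, t). complex_of_real (h y) * iexp (t \<bullet> ((1 / d) *\<^sub>R (y - x))))"
    proof (rule LG.Fubini_integrable)
      show "(\<lambda>(y, t). complex_of_real (h y) * iexp (t \<bullet> ((1 / d) *\<^sub>R (y - x)))) \<in> borel_measurable (lborel \<Otimes>\<^sub>M gauss)"
        by measurable
      show "integrable lborel (\<lambda>y. \<integral>t. norm (case (y, t) of (y, t) \<Rightarrow> complex_of_real (h y) * iexp (t \<bullet> ((1 / d) *\<^sub>R (y - x)))) \<partial>(gauss::'a measure))"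
        using h by (simp add: norm_mult G.prob_space[simplified])
      show "AE y in lborel. integrable gauss (\<lambda>t. case (y, t) of (y, t) \<Rightarrow> complex_of_real (h y) * iexp (t \<bullet> ((1 / d) *\<^sub>R (y - x))))"
        by (intro AE_I2) (auto intro!: G.integrable_const_bound[of _ "\<bar>h y\<bar>" for y] simp: norm_mult)
    qed
    have "complex_of_real (gauss_smooth d h x)
      = (1 / d) ^ DIM('a) * (\<integral>y. complex_of_real (h y) * complex_of_real (std_gauss ((1 / d) *\<^sub>R (y - x))) \<partial>lborel)"
    proof -
      have "(\<integral>y. complex_of_real (h y) * complex_of_real (std_gauss ((1 / d) *\<^sub>R (y - x))) \<partial>lborel)
        = complex_of_real (\<integral>y. h y * std_gauss ((1 / d) *\<^sub>R (y - x)) \<partial>lborel)"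
        by (simp flip: of_real_mult)
      then show ?thesis by (subst std_gauss_scaled_fourier[OF _ d]) simp_all
    qed
    also have "\<dots> = (1 / d) ^ DIM('a) * (\<integral>y. (1 / sqrt (2 * pi)) ^ DIM('a) *
        (\<integral>t. complex_of_real (h y) * iexp (t \<bullet> ((1 / d) *\<^sub>R (y - x))) \<partial>gauss) \<partial>lborel)"
      unfolding std_gauss_fourier by (simp add: ac_simps)
    also have "\<dots> = c * (\<integral>y. (\<integral>t. complex_of_real (h y) * iexp (t \<bullet> ((1 / d) *\<^sub>R (y - x))) \<partial>gauss) \<partial>lborel)"
      by (simp add: c_def power_mult_distrib power_divide)
    also have "(\<integral>y. (\<integral>t. complex_of_real (h y) * iexp (t \<bullet> ((1 / d) *\<^sub>R (y - x))) \<partial>gauss) \<partial>lborel)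
      = (\<integral>t. (\<integral>y. complex_of_real (h y) * iexp (t \<bullet> ((1 / d) *\<^sub>R (y - x))) \<partial>lborel) \<partial>gauss)"
      by (rule LG.Fubini_integral[symmetric, OF int])
    also have "\<dots> = (\<integral>t. ?H t * iexp ((- (1 / d) *\<^sub>R t) \<bullet> x) \<partial>gauss)"
    proof (rule Bochner_Integration.integral_cong[OF refl])
      fix t :: 'a
      have "complex_of_real (h y) * iexp (t \<bullet> ((1 / d) *\<^sub>R (y - x)))
        = iexp ((- (1 / d) *\<^sub>R t) \<bullet> x) * (complex_of_real (h y) * iexp (((1 / d) *\<^sub>R t) \<bullet> y))" for y
      proof -
        have "iexp (t \<bullet> ((1 / d) *\<^sub>R (y - x))) = iexp ((- (1 / d) *\<^sub>R t) \<bullet> x) * iexp (((1 / d) *\<^sub>R t) \<bullet> y)"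
          by (simp add: exp_add[symmetric] inner_diff_right diff_divide_distrib right_diff_distrib)
        then show ?thesis by (simp only: mult.left_commute)
      qed
      then show "(\<integral>y. complex_of_real (h y) * iexp (t \<bullet> ((1 / d) *\<^sub>R (y - x))) \<partial>lborel)
        = ?H t * iexp ((- (1 / d) *\<^sub>R t) \<bullet> x)"
        by (subst mult.commute, subst integral_mult_right_zero[symmetric]) (simp only:)
    qed
    finally show ?thesis .
  qed
  have [measurable]: "?H \<in> borel_measurable borel"
    by measurable
  have int2: "integrable (gauss \<Otimes>\<^sub>M \<mu>) (\<lambda>(t, x). ?H t * iexp ((- (1 / d) *\<^sub>R t) \<bullet> x))"
  proof -
    interpret P: pair_prob_space "gauss::'a measure" \<mu> ..
    show ?thesis
    proof (rule P.integrable_const_bound[where B="\<integral>y. \<bar>h y\<bar> \<partial>lborel"], rule AE_I2)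
      fix z :: "'a \<times> 'a"
      show "norm (case z of (t, x) \<Rightarrow> ?H t * iexp ((- (1 / d) *\<^sub>R t) \<bullet> x)) \<le> (\<integral>y. \<bar>h y\<bar> \<partial>lborel)"
        by (cases z) (simp only: prod.case norm_mult norm_exp_i_times mult_1_right H_bound)
    qed measurable
  qed
  have "complex_of_real (\<integral>x. gauss_smooth d h x \<partial> \<mu>)
    = (\<integral>x. complex_of_real (gauss_smooth d h x) \<partial>\<mu>)" by simp
  also have "\<dots> = c * (\<integral>x. (\<integral>t. ?H t * iexp ((- (1 / d) *\<^sub>R t) \<bullet> x) \<partial>gauss) \<partial>\<mu>)"
    unfolding inner_eq by simp
  also have "(\<integral>x. (\<integral>t. ?H t * iexp ((- (1 / d) *\<^sub>R t) \<bullet> x) \<partial>gauss) \<partial>\<mu>)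
    = (\<integral>t. (\<integral>x. ?H t * iexp ((- (1 / d) *\<^sub>R t) \<bullet> x) \<partial>\<mu>) \<partial>gauss)"
    by (rule GM.Fubini_integral[OF int2])
  finally show ?thesis by (simp add: c_def)
qed

text \<open>In \<open>gauss_smoothing_charfun\<close> the only factor that varies with
  \<open>k\<close> is a characteristic function, bounded by 1, and the outer integral is over a
  probability measure; a constant can serve as dominating function.\<close>

lemma gauss_smoothing_converges:
  fixes h :: "'a::euclidean_space \<Rightarrow> real"
  assumes \<mu>: "\<And>k. prob_space (\<mu> k)" "\<And>k. sets (\<mu> k) = sets borel"
    and \<nu>: "prob_space \<nu>" "sets \<nu> = sets borel"
    and char: "\<And>t. (\<lambda>k. charfun (\<mu> k) t) \<longlonglongrightarrow> charfun \<nu> t"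
    and h: "integrable lborel h" and d: "d > 0"
  shows "(\<lambda>k. \<integral>x. gauss_smooth d h x \<partial> \<mu> k)
    \<longlonglongrightarrow> (\<integral>x. gauss_smooth d h x \<partial> \<nu>)"
proof -
  interpret G: prob_space "gauss::'a measure" by (rule prob_space_gauss)
  have [measurable]: "h \<in> borel_measurable borel" using h by auto
  let ?H = "\<lambda>t. (\<integral>y. complex_of_real (h y) * iexp (((1 / d) *\<^sub>R t) \<bullet> y) \<partial>lborel)"
  have H_bound: "norm (?H t) \<le> (\<integral>y. \<bar>h y\<bar> \<partial>lborel)" for t
    by (rule order_trans[OF integral_norm_bound]) (simp add: norm_mult)
  have [measurable]: "?H \<in> borel_measurable borel"
    by measurable
  have char_bound: "norm (charfun \<rho> t) \<le> 1" if "prob_space \<rho>" for t and \<rho> :: "'a measure"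
  proof -
    interpret prob_space \<rho> by fact
    show ?thesis by (rule order_trans[OF integral_norm_bound]) (simp add: prob_space)
  qed
  have meas: "(\<lambda>t. \<integral>x. iexp ((- (1 / d) *\<^sub>R t) \<bullet> x) \<partial>\<rho>) \<in> borel_measurable borel"
    if "prob_space \<rho>" "sets \<rho> = sets borel" for \<rho> :: "'a measure"
  proof -
    interpret prob_space \<rho> by fact
    note [measurable_cong] = that(2)
    show ?thesis by measurable
  qed
  have "(\<lambda>k. complex_of_real (\<integral>x. gauss_smooth d h x \<partial> \<mu> k))
    \<longlonglongrightarrow> complex_of_real (\<integral>x. gauss_smooth d h x \<partial> \<nu>)"
    unfolding gauss_smoothing_charfun[OF \<mu> h d] gauss_smoothing_charfun[OF \<nu> h d]
  proof (rule tendsto_mult[OF tendsto_const], rule integral_dominated_convergence[where w="\<lambda>_. \<integral>y. \<bar>h y\<bar> \<partial>lborel"], goal_cases)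
    \<comment> \<open>Goals 4 and 5 are the pointwise limit and the dominating bound; the other
      three are measurability and integrability.\<close>
    case 4
    show ?case
    proof (rule AE_I2)
    fix t :: 'a
    show "(\<lambda>k. ?H t * charfun (\<mu> k) (- (1 / d) *\<^sub>R t))
      \<longlonglongrightarrow> ?H t * charfun \<nu> (- (1 / d) *\<^sub>R t)"
      by (intro tendsto_mult tendsto_const char)
    qed
  next
    case (5 k)
    show ?case
    proof (rule AE_I2)
    fix t :: 'a
    have "norm (?H t) * norm (charfun (\<mu> k) (- (1 / d) *\<^sub>R t)) \<le> (\<integral>y. \<bar>h y\<bar> \<partial>lborel) * 1"
      by (intro mult_mono H_bound char_bound \<mu>) auto
    then show "norm (?H t * charfun (\<mu> k) (- (1 / d) *\<^sub>R t)) \<le> (\<integral>y. \<bar>h y\<bar> \<partial>lborel)"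
      by (simp add: norm_mult)
    qed
  qed (use meas \<mu> \<nu> in \<open>auto intro!: borel_measurable_times\<close>)
  then show ?thesis by (simp only: tendsto_of_real_iff)
qed

lemma compact_support_uniform:
  fixes h :: "'a::euclidean_space \<Rightarrow> real"
  assumes "continuous_on UNIV h" "\<And>x. norm x > R \<Longrightarrow> h x = 0" "e > 0"
  obtains r where "r > 0" "\<And>x w. norm w < r \<Longrightarrow> \<bar>h (x + w) - h x\<bar> \<le> e"
proof -
  have "uniformly_continuous_on (cball 0 (R + 1)) h"
    using assms(1) by (intro compact_uniformly_continuous) (auto intro: continuous_on_subset)
  then obtain r where r: "r > 0" "\<And>x y. x \<in> cball 0 (R + 1) \<Longrightarrow> y \<in> cball 0 (R + 1) \<Longrightarrow> dist y x < r \<Longrightarrow> dist (h y) (h x) < e"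
    unfolding uniformly_continuous_on_def using assms(3) by metis
  \<comment> \<open>For displacements shorter than 1, either both points lie in the ball of radius
    \<open>R + 1\<close> or both lie outside the support.\<close>
  have "\<bar>h (x + w) - h x\<bar> \<le> e" if w: "norm w < min r 1" for x w
  proof (cases "norm x \<le> R + 1 \<and> norm (x + w) \<le> R + 1")
    case True
    then have "dist (h (x + w)) (h x) < e" using w by (intro r(2)) (simp_all only: mem_cball_0, auto simp: dist_norm)
    then show ?thesis by (simp add: dist_real_def)
  next
    case False
    have "norm (x + w) \<le> norm x + norm w" "norm x \<le> norm (x + w) + norm w"
      using norm_triangle_ineq[of x w] norm_triangle_ineq4[of "x + w" w] by auto
    then have "norm x > R" "norm (x + w) > R" using False w by auto
    then show ?thesis using assms by simp
  qed
  then show thesis using that[of "min r 1"] r(1) by auto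
qed

lemma compact_support_integrable:
  fixes h :: "'a::euclidean_space \<Rightarrow> real"
  assumes "continuous_on UNIV h" "\<And>x. norm x > R \<Longrightarrow> h x = 0"
  shows "integrable lborel h"
proof -
  have "integrable lborel (\<lambda>x. indicator (cball 0 R) x *\<^sub>R h x)"
    using borel_integrable_compact[of "cball 0 R" h] assms(1)
    by (auto intro: continuous_on_subset)
  moreover have "(\<lambda>x. indicator (cball 0 R) x *\<^sub>R h x) = h"
    using assms(2) by (auto simp: indicator_def not_le fun_eq_iff)
  ultimately show ?thesis by simp
qed

lemma compact_support_bounded:
  fixes h :: "'a::euclidean_space \<Rightarrow> real"
  assumes h: "continuous_on UNIV h" "\<And>x. norm x > R \<Longrightarrow> h x = 0"
  obtains C where "C \<ge> 0" "\<And>x. \<bar>h x\<bar> \<le> C"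
proof -
  have "bounded (h ` cball 0 R)"
    by (intro compact_imp_bounded compact_continuous_image continuous_on_subset[OF h(1)]) auto
  then obtain K where K: "\<forall>x\<in>cball 0 R. \<bar>h x\<bar> \<le> K"
    unfolding bounded_iff by auto
  have "\<bar>h x\<bar> \<le> max K 0" for x
    using bspec[OF K, of x] h(2)[of x] by (cases "norm x \<le> R") (auto simp: le_max_iff_disj)
  then show thesis using that[of "max K 0"] by auto
qed

text \<open>The estimate is uniform in \<open>x\<close> because the modulus of continuity of
  \<open>h\<close> is. Displacements of length at least \<open>r\<close> are charged to
  \<open>min 1 (norm w / r)\<close>, whose Gaussian mean tends to 0 under shrinking by dominated
  convergence.\<close>

lemma gauss_smoothing_approx:
  fixes h :: "'a::euclidean_space \<Rightarrow> real"
  assumes h: "continuous_on UNIV h" "\<And>x. norm x > R \<Longrightarrow> h x = 0" and e: "e > 0"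
  obtains d where "d > 0" "\<And>x. \<bar>gauss_smooth d h x - h x\<bar> \<le> e"
proof -
  interpret G: prob_space "gauss::'a measure" by (rule prob_space_gauss)
  have [measurable]: "h \<in> borel_measurable borel" using h(1) by (rule borel_measurable_continuous_onI)
  obtain C where C: "C \<ge> 0" "\<And>x. \<bar>h x\<bar> \<le> C" using compact_support_bounded[OF h] by metis
  obtain r where r: "r > 0" "\<And>x w. norm w < r \<Longrightarrow> \<bar>h (x + w) - h x\<bar> \<le> e / 2"
    using compact_support_uniform[where h=h and R=R and e="e / 2"] h e by auto
  have osc: "\<bar>h (x + w) - h x\<bar> \<le> e / 2 + 2 * C * min 1 (norm w / r)" for x w
  proof (cases "norm w < r")
    case True
    then show ?thesis using r(2)[OF True, of x] C(1) r(1) by (smt (verit) divide_nonneg_pos mult_nonneg_nonneg norm_ge_zero)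
  next
    case False
    then have "min 1 (norm w / r) = 1" using r(1) by (simp add: min_def field_simps)
    then show ?thesis using C(2)[of x] C(2)[of "x + w"] e by simp
  qed
  have "(\<lambda>j. \<integral>z. min 1 (norm ((1 / Suc j) *\<^sub>R z) / r) \<partial>(gauss::'a measure)) \<longlonglongrightarrow> (\<integral>z. 0 \<partial>(gauss::'a measure))"
  proof (rule integral_dominated_convergence[where w="\<lambda>_. 1"])
    show "AE z in (gauss::'a measure). (\<lambda>j. min 1 (norm ((1 / Suc j) *\<^sub>R z) / r)) \<longlonglongrightarrow> 0"
    proof (rule AE_I2)
      fix z :: 'a
      have "(\<lambda>j. min 1 (norm ((1 / Suc j) *\<^sub>R z) / r)) \<longlonglongrightarrow> min 1 (norm (0 *\<^sub>R z) / r)"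
        by (intro tendsto_intros) (use r(1) LIMSEQ_inverse_real_of_nat in \<open>auto simp: inverse_eq_divide\<close>)
      then show "(\<lambda>j. min 1 (norm ((1 / Suc j) *\<^sub>R z) / r)) \<longlonglongrightarrow> 0" by simp
    qed
  qed (use r(1) in auto)
  \<comment> \<open>This target makes the far part, which carries the factor \<open>2 * C\<close>,
    at most \<open>e / 2\<close>, also when \<open>C\<close> is 0.\<close>
  moreover have "e / (4 * C + 1) > 0" using e C(1) by auto
  ultimately have "\<forall>\<^sub>F j in sequentially. (\<integral>z. min 1 (norm ((1 / Suc j) *\<^sub>R z) / r) \<partial>(gauss::'a measure)) < e / (4 * C + 1)"
    by (auto intro: order_tendstoD)
  then obtain j where j: "(\<integral>z. min 1 (norm ((1 / Suc j) *\<^sub>R z) / r) \<partial>(gauss::'a measure)) < e / (4 * C + 1)"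
    by (auto simp: eventually_sequentially)
  define d where "d = 1 / real (Suc j)"
  have d: "d > 0" by (simp add: d_def)
  have int_h: "integrable gauss (\<lambda>z. h (x + d *\<^sub>R z))" for x
    by (rule G.integrable_const_bound[where B=C]) (auto simp: C)
  have int_m: "integrable gauss (\<lambda>z. min 1 (norm (d *\<^sub>R (z::'a)) / r))"
    by (rule G.integrable_const_bound[where B=1]) (use r(1) in auto)
  have "\<bar>gauss_smooth d h x - h x\<bar> \<le> e" for x
  proof -
    have "gauss_smooth d h x - h x = (\<integral>z. h (x + d *\<^sub>R z) - h x \<partial>gauss)"
      using int_h by (simp add: G.prob_space[simplified])
    also have "\<bar>\<dots>\<bar> \<le> (\<integral>z. \<bar>h (x + d *\<^sub>R z) - h x\<bar> \<partial>gauss)"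
      by (rule integral_abs_bound)
    also have "\<dots> \<le> (\<integral>z. e / 2 + 2 * C * min 1 (norm (d *\<^sub>R z) / r) \<partial>(gauss::'a measure))"
      by (rule integral_mono, use int_h int_m in simp, use int_m in simp, rule osc)
    also have "\<dots> = e / 2 + 2 * C * (\<integral>z. min 1 (norm (d *\<^sub>R z) / r) \<partial>(gauss::'a measure))"
      using int_m by (simp add: G.prob_space[simplified])
    also have "\<dots> \<le> e / 2 + 2 * C * (e / (4 * C + 1))"
      using j C(1) unfolding d_def by (intro add_left_mono mult_left_mono) auto
    also have "\<dots> \<le> e" using e C(1) by (simp add: field_simps)
    finally show ?thesis .
  qed
  then show thesis using that d by blast
qed

text \<open>Smoothing alters the integral of \<open>h\<close> by at most \<open>e / 3\<close> under
  every probability measure, hence uniformly in \<open>k\<close>, and the smoothed integrals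
  converge.\<close>

lemma levy_compact_support:
  fixes h :: "'a::euclidean_space \<Rightarrow> real"
  assumes \<mu>: "\<And>k. prob_space (\<mu> k)" "\<And>k. sets (\<mu> k) = sets borel"
    and \<nu>: "prob_space \<nu>" "sets \<nu> = sets borel"
    and char: "\<And>t. (\<lambda>k. charfun (\<mu> k) t) \<longlonglongrightarrow> charfun \<nu> t"
    and h: "continuous_on UNIV h" "\<And>x. norm x > R \<Longrightarrow> h x = 0"
  shows "(\<lambda>k. \<integral>x. h x \<partial>\<mu> k) \<longlonglongrightarrow> (\<integral>x. h x \<partial>\<nu>)"
proof (rule LIMSEQ_I)
  fix e :: real assume e: "e > 0"
  interpret G: prob_space "gauss::'a measure" by (rule prob_space_gauss)
  have [measurable]: "h \<in> borel_measurable borel" using h(1) by (rule borel_measurable_continuous_onI)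
  obtain C where C: "C \<ge> 0" "\<And>x. \<bar>h x\<bar> \<le> C" using compact_support_bounded[OF h] by metis
  obtain d where d: "d > 0" "\<And>x. \<bar>gauss_smooth d h x - h x\<bar> \<le> e / 3"
    using gauss_smoothing_approx[where h=h and R=R and e="e / 3"] h e by auto
  have close: "\<bar>(\<integral>x. gauss_smooth d h x \<partial> \<rho>) - (\<integral>x. h x \<partial>\<rho>)\<bar> \<le> e / 3"
    if "prob_space \<rho>" "sets \<rho> = sets borel" for \<rho>
  proof -
    interpret prob_space \<rho> by fact
    note [measurable_cong] = that(2)
    have 1: "integrable \<rho> h" by (rule integrable_const_bound[where B=C]) (auto simp: C)
    have 2: "integrable \<rho> (\<lambda>x. \<integral>z. h (x + d *\<^sub>R z) \<partial>gauss)"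
    proof (rule integrable_const_bound[where B="C + e / 3"], rule AE_I2)
      show "norm (gauss_smooth d h x) \<le> C + e / 3" for x
        using C(2)[of x] d(2)[of x] unfolding real_norm_def by linarith
    qed measurable
    have "(\<integral>x. gauss_smooth d h x \<partial> \<rho>) - (\<integral>x. h x \<partial>\<rho>)
      = (\<integral>x. gauss_smooth d h x - h x \<partial>\<rho>)" using 1 2 by simp
    also have "\<bar>\<dots>\<bar> \<le> (\<integral>x. \<bar>gauss_smooth d h x - h x\<bar> \<partial>\<rho>)"
      by (rule integral_abs_bound)
    also have "\<dots> \<le> (\<integral>x. e / 3 \<partial>\<rho>)"
      by (rule integral_mono) (use 1 2 d in auto)
    finally show ?thesis by (simp add: prob_space)
  qed
  have "(\<lambda>k. \<integral>x. gauss_smooth d h x \<partial> \<mu> k)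
    \<longlonglongrightarrow> (\<integral>x. gauss_smooth d h x \<partial> \<nu>)"
    by (rule gauss_smoothing_converges[OF \<mu> \<nu> char compact_support_integrable[OF h] d(1)])
  from LIMSEQ_D[OF this, of "e / 3"] e obtain k0 where k0:
    "\<And>k. k \<ge> k0 \<Longrightarrow> \<bar>(\<integral>x. gauss_smooth d h x \<partial> \<mu> k) - (\<integral>x. gauss_smooth d h x \<partial> \<nu>)\<bar> < e / 3"
    by auto
  show "\<exists>k0. \<forall>k\<ge>k0. norm ((\<integral>x. h x \<partial>\<mu> k) - (\<integral>x. h x \<partial>\<nu>)) < e"
  proof (intro exI[of _ k0] allI impI)
    fix k assume "k \<ge> k0"
    from k0[OF this] close[OF \<mu>(1)[of k] \<mu>(2)[of k]] close[OF \<nu>]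
    show "norm ((\<integral>x. h x \<partial>\<mu> k) - (\<integral>x. h x \<partial>\<nu>)) < e" by (simp add: abs_real_def split: if_splits)
  qed
qed

text \<open>The cutoff \<open>c\<close> turns \<open>h\<close> into a compactly supported function; the mass lost under \<open>\<mu> k\<close> is
  controlled because \<open>1 - c\<close> is itself a constant minus a compactly supported function.\<close>

theorem levy_continuity_euclidean:
  fixes \<mu> :: "nat \<Rightarrow> 'a::euclidean_space measure"
  assumes \<mu>: "\<And>k. prob_space (\<mu> k)" "\<And>k. sets (\<mu> k) = sets borel"
    and \<nu>: "prob_space \<nu>" "sets \<nu> = sets borel"
    and char: "\<And>t. (\<lambda>k. charfun (\<mu> k) t) \<longlonglongrightarrow> charfun \<nu> t"
  shows "weak_convergence \<mu> \<nu>"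
  unfolding weak_convergence_def
proof (intro allI impI, rule LIMSEQ_I)
  fix h :: "'a \<Rightarrow> real" and e :: real
  assume h: "continuous_on UNIV h" "bounded (range h)" and e: "e > 0"
  interpret N: prob_space \<nu> by fact
  note [measurable_cong] = \<nu>(2)
  have [measurable]: "h \<in> borel_measurable borel" using h(1) by (rule borel_measurable_continuous_onI)
  obtain C where C: "C > 0" "\<And>x. \<bar>h x\<bar> \<le> C" using h(2) unfolding bounded_pos by auto
  define c :: "nat \<Rightarrow> 'a \<Rightarrow> real" where "c R x = max 0 (min 1 (real R + 1 - norm x))" for R x
  have c_cont: "continuous_on UNIV (c R)" for R
    unfolding c_def by (intro continuous_intros)
  have [measurable]: "c R \<in> borel_measurable borel" for R
    by (rule borel_measurable_continuous_onI[OF c_cont])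
  have c_bounds: "0 \<le> c R x" "c R x \<le> 1" for R x by (auto simp: c_def)
  have c_supp: "c R x = 0" if "norm x > real R + 1" for R x using that by (simp add: c_def)
  have "(\<lambda>R. \<integral>x. c R x \<partial>\<nu>) \<longlonglongrightarrow> (\<integral>x. 1 \<partial>\<nu>)"
  proof (rule integral_dominated_convergence[where w="\<lambda>_. 1"])
    show "AE x in \<nu>. (\<lambda>R. c R x) \<longlonglongrightarrow> 1"
    proof (rule AE_I2, rule tendsto_eventually)
      fix x
      show "\<forall>\<^sub>F R in sequentially. c R x = 1"
        using eventually_ge_at_top[of "nat \<lceil>norm x\<rceil>"]
      proof eventually_elim
        case (elim R)
        then have "norm x \<le> real R" by linarith
        then show ?case by (simp add: c_def)
      qed
    qed
  qed (auto simp: c_bounds)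
  \<comment> \<open>The margin \<open>e / (4 * C)\<close> makes each of the two cutoff errors, under
    \<nu> and under \<open>\<mu> k\<close>, at most \<open>e / 4\<close>.\<close>
  then have "\<forall>\<^sub>F R in sequentially. (\<integral>x. c R x \<partial>\<nu>) > 1 - e / (4 * C)"
    using e C(1) by (intro order_tendstoD(1)) (auto simp: N.prob_space)
  then obtain R where R: "(\<integral>x. c R x \<partial>\<nu>) > 1 - e / (4 * C)" by (auto simp: eventually_sequentially)
  have lim1: "(\<lambda>k. \<integral>x. c R x \<partial>\<mu> k) \<longlonglongrightarrow> (\<integral>x. c R x \<partial>\<nu>)"
    by (rule levy_compact_support[OF \<mu> \<nu> char c_cont c_supp])
  have lim2: "(\<lambda>k. \<integral>x. h x * c R x \<partial>\<mu> k) \<longlonglongrightarrow> (\<integral>x. h x * c R x \<partial>\<nu>)"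
    by (rule levy_compact_support[OF \<mu> \<nu> char, where R="real R + 1"])
       (auto intro!: continuous_intros h(1) c_cont simp: c_supp)
  have cut: "\<bar>(\<integral>x. h x \<partial>\<rho>) - (\<integral>x. h x * c R x \<partial>\<rho>)\<bar> \<le> C * (1 - (\<integral>x. c R x \<partial>\<rho>))"
    if "prob_space \<rho>" "sets \<rho> = sets borel" for \<rho>
  proof -
    interpret prob_space \<rho> by fact
    note [measurable_cong] = that(2)
    have 1: "integrable \<rho> h" by (rule integrable_const_bound[where B=C]) (auto simp: C)
    have 2: "integrable \<rho> (c R)" by (rule integrable_const_bound[where B=1]) (auto simp: c_bounds)
    have 3: "integrable \<rho> (\<lambda>x. h x * c R x)"
    proof (rule integrable_const_bound[where B=C])
      have "\<bar>h x\<bar> * \<bar>c R x\<bar> \<le> C * 1" for x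
        by (intro mult_mono C less_imp_le[OF C(1)]) (auto simp: c_bounds)
      then show "AE x in \<rho>. norm (h x * c R x) \<le> C" by (simp add: abs_mult)
    qed auto
    have "(\<integral>x. h x \<partial>\<rho>) - (\<integral>x. h x * c R x \<partial>\<rho>) = (\<integral>x. h x - h x * c R x \<partial>\<rho>)"
      using 1 3 by simp
    also have "\<bar>\<dots>\<bar> \<le> (\<integral>x. \<bar>h x - h x * c R x\<bar> \<partial>\<rho>)"
      by (rule integral_abs_bound)
    also have "\<dots> \<le> (\<integral>x. C * (1 - c R x) \<partial>\<rho>)"
    proof (rule integral_mono)
      fix x
      have "\<bar>h x - h x * c R x\<bar> = \<bar>h x\<bar> * (1 - c R x)"
        using c_bounds[of R x] by (simp add: abs_mult right_diff_distrib[symmetric, of "h x" 1, simplified])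
      also have "\<dots> \<le> C * (1 - c R x)"
        using c_bounds[of R x] by (intro mult_right_mono C) auto
      finally show "\<bar>h x - h x * c R x\<bar> \<le> C * (1 - c R x)" .
    qed (use 1 2 3 in auto)
    also have "\<dots> = C * (1 - (\<integral>x. c R x \<partial>\<rho>))" using 2 by (simp add: prob_space)
    finally show ?thesis .
  qed
  have "\<forall>\<^sub>F k in sequentially. \<bar>(\<integral>x. h x * c R x \<partial>\<mu> k) - (\<integral>x. h x * c R x \<partial>\<nu>)\<bar> < e / 4"
    using tendstoD[OF lim2, of "e / 4"] e by (simp add: dist_real_def)
  moreover have "\<forall>\<^sub>F k in sequentially. (\<integral>x. c R x \<partial>\<mu> k) > 1 - e / (4 * C)"
    by (rule order_tendstoD(1)[OF lim1 R])
  ultimately have "\<forall>\<^sub>F k in sequentially. norm ((\<integral>x. h x \<partial>\<mu> k) - (\<integral>x. h x \<partial>\<nu>)) < e"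
  proof eventually_elim
    case (elim k)
    have small: "C * (1 - a) \<le> e / 4" if "a > 1 - e / (4 * C)" for a
    proof -
      have "C * (1 - a) \<le> C * (e / (4 * C))" using that C(1) by (intro mult_left_mono) auto
      then show ?thesis using C(1) by simp
    qed
    show ?case
      using cut[OF \<mu>(1)[of k] \<mu>(2)[of k]] cut[OF \<nu>] small[OF R] small[OF elim(2)] elim(1) e
      unfolding real_norm_def by linarith
  qed
  then show "\<exists>k0. \<forall>k\<ge>k0. norm ((\<integral>x. h x \<partial>\<mu> k) - (\<integral>x. h x \<partial>\<nu>)) < e"
    by (simp add: eventually_sequentially)
qed

section \<open>Lebesgue measure under linear maps\<close>

lemma lborel_shear:
  fixes m n :: "'n::finite"
  assumes mn: "m \<noteq> n"
  defines "h \<equiv> (\<lambda>x::real^'n. \<chi> i. if i = m then x $ m + x $ n else x $ i)"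
  shows "lborel = distr lborel borel h"
proof -
  define k where "k = (\<lambda>x::real^'n. \<chi> i. if i = m then x $ m - x $ n else x $ i)"
  have hk: "h (k x) = x" and kh: "k (h x) = x" for x
    using mn by (auto simp: h_def k_def vec_eq_iff)
  have lin: "linear h"
    by (rule linearI) (auto simp: h_def vec_eq_iff algebra_simps)
  have link: "linear k"
    by (rule linearI) (auto simp: k_def vec_eq_iff algebra_simps)
  have [measurable]: "h \<in> borel_measurable borel" "k \<in> borel_measurable borel"
    using lin link by (auto intro!: borel_measurable_continuous_onI linear_continuous_on simp: linear_conv_bounded_linear)
  have cb: "measure lebesgue (h ` cbox a b) = 1 * measure lebesgue (cbox a b)" for a b
  proof (cases "cbox a b = {}")
    case False
    \<comment> \<open>The volume formula for a sheared box asks for a lower corner that is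
      nonnegative in coordinate \<open>n\<close>, so the box is moved to the origin first.\<close>
    then have ne: "cbox 0 (b - a) \<noteq> {}" by (simp add: box_ne_empty inner_diff_left)
    have "h ` cbox a b = (+) (h a) ` h ` cbox 0 (b - a)"
      using cbox_translation[of a 0 "b - a"] by (auto simp: image_image linear_add[OF lin])
    then have "measure lebesgue (h ` cbox a b) = measure lebesgue (h ` cbox 0 (b - a))"
      by (simp add: measure_translation)
    also have "\<dots> = measure lebesgue (cbox 0 (b - a))"
      unfolding h_def by (rule measure_shear_interval[OF mn ne]) (simp only: zero_index order_refl)
    also have "\<dots> = measure lebesgue ((+) a ` cbox 0 (b - a))" by (simp add: measure_translation)
    also have "(+) a ` cbox 0 (b - a) = cbox a b" using cbox_translation[of a 0 "b - a"] by simp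
    finally show ?thesis by simp
  qed simp
  \<comment> \<open>The inverse shear comes first: its preimage of a box is the image of the box
    under \<open>h\<close>, and \<open>cb\<close> controls volumes of images. Pushing forward along
    \<open>h\<close> then gives the claim.\<close>
  have "lborel = distr lborel borel k"
  proof (rule lborel_eqI)
    fix l u :: "real^'n"
    assume le: "\<And>b. b \<in> Basis \<Longrightarrow> l \<bullet> b \<le> u \<bullet> b"
    have eq: "k -` box l u = h ` box l u"
      by (auto simp: kh) (metis hk image_eqI)
    have suff: "h ` box l u \<in> lmeasurable \<and> 1 * measure lebesgue (box l u) = measure lebesgue (h ` box l u)"
      by (rule measure_linear_sufficient[OF lin _ cb]) simp
    have meas: "h ` box l u \<in> sets lborel"
      unfolding eq[symmetric] using measurable_sets[of k borel borel "box l u"] by simp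
    have "emeasure (distr lborel borel k) (box l u) = emeasure lborel (h ` box l u)"
      by (simp add: emeasure_distr eq)
    also have "\<dots> = emeasure lebesgue (h ` box l u)" using meas by simp
    also have "\<dots> = ennreal (measure lebesgue (box l u))"
      using suff by (simp add: emeasure_eq_measure2)
    also have "\<dots> = (\<Prod>b\<in>Basis. (u - l) \<bullet> b)"
      using le by (simp add: measure_lborel_box_eq)
    finally show "emeasure (distr lborel borel k) (box l u) = (\<Prod>b\<in>Basis. (u - l) \<bullet> b)" .
  qed simp
  then have "distr lborel borel h = distr (distr lborel borel k) borel h" by simp
  also have "\<dots> = distr lborel borel (h \<circ> k)" by (rule distr_distr) auto
  also have "h \<circ> k = (\<lambda>x. x)" by (simp add: fun_eq_iff hk)
  finally show ?thesis by (simp add: distr_id2)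
qed

lemma prod_Basis_cart: "(\<Prod>b\<in>Basis. g b) = (\<Prod>i\<in>UNIV. g (axis i 1))" for g :: "real^'n \<Rightarrow> real"
  by (simp add: Basis_vec_def UNION_singleton_eq_range prod.reindex inj_on_def axis_eq_axis o_def)

text \<open>The library's linear change of variables needs a linearly ordered index type, which is only used
  there to compute the determinant of a shear.\<close>

lemma lborel_linear:
  fixes f :: "real^'n \<Rightarrow> real^'n"
  assumes lin: "linear f" and inj: "inj f"
  shows "lborel = density (distr lborel borel f) (\<lambda>_. ennreal \<bar>det (matrix f)\<bar>)"
proof -
  let ?P = "\<lambda>f :: real^'n \<Rightarrow> real^'n. inj f \<longrightarrow> lborel = density (distr lborel borel f) (\<lambda>_. ennreal \<bar>det (matrix f)\<bar>)"
  have meas: "f \<in> borel_measurable borel" if "linear f" for f :: "real^'n \<Rightarrow> real^'n"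
    using that by (auto intro!: borel_measurable_continuous_onI linear_continuous_on simp: linear_conv_bounded_linear)
  have "?P f"
  proof (rule induct_linear_elementary[OF lin])
    fix f g :: "real^'n \<Rightarrow> real^'n"
    assume f: "linear f" and g: "linear g" and P: "?P f" "?P g"
    note [measurable] = meas[OF f] meas[OF g]
    show "?P (f \<circ> g)"
    proof
      assume "inj (f \<circ> g)"
      then have g': "inj g" by (rule inj_on_imageI2)
      then have "surj g" using linear_injective_imp_surjective[OF g] by simp
      then have f': "inj f" using \<open>inj (f \<circ> g)\<close> by (metis comp_apply inj_def surj_def)
      have "lborel = density (distr (density (distr lborel borel g) (\<lambda>_. ennreal \<bar>det (matrix g)\<bar>)) borel f) (\<lambda>_. ennreal \<bar>det (matrix f)\<bar>)"
        using P f' g' by simp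
      also have "\<dots> = density (density (distr (distr lborel borel g) borel f) (\<lambda>_. ennreal \<bar>det (matrix g)\<bar>)) (\<lambda>_. ennreal \<bar>det (matrix f)\<bar>)"
        by (subst density_distr[symmetric]) auto
      also have "\<dots> = density (distr lborel borel (f \<circ> g)) (\<lambda>_. ennreal \<bar>det (matrix (f \<circ> g))\<bar>)"
        by (simp add: density_density_eq distr_distr matrix_compose[OF g f] det_mul abs_mult ennreal_mult mult.commute)
      finally show "lborel = density (distr lborel borel (f \<circ> g)) (\<lambda>_. ennreal \<bar>det (matrix (f \<circ> g))\<bar>)" .
    qed
  next
    fix f :: "real^'n \<Rightarrow> real^'n" and i
    assume f: "linear f" and z: "\<And>x. f x $ i = 0"
    \<comment> \<open>A map with a vanishing coordinate is not onto, hence not injective, and the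
      claim is vacuous.\<close>
    have "\<not> surj f"
    proof
      assume "surj f"
      then obtain x where "f x = axis i 1" by (metis surjD)
      then show False using z[of x] by (simp add: axis_def)
    qed
    then show "?P f" using linear_injective_imp_surjective[OF f] by blast
  next
    fix c :: "'n \<Rightarrow> real"
    let ?f = "\<lambda>x::real^'n. \<chi> i. c i * x $ i"
    show "?P ?f"
    proof
      assume inj: "inj ?f"
      have c: "c i \<noteq> 0" for i
      proof
        assume "c i = 0"
        then have "?f (axis i 1) = ?f 0" by (auto simp: vec_eq_iff axis_def)
        then have "axis i 1 = (0::real^'n)" by (rule injD[OF inj])
        then show False by (simp add: axis_eq_0_iff)
      qed
      \<comment> \<open>The affine change of variables takes its scale factors indexed by basis
        vectors, so those indexed by coordinates are transferred.\<close>
      define c' where "c' = (\<lambda>b::real^'n. c (SOME i. b = axis i 1))"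
      have c': "c' (axis i 1) = c i" for i
        unfolding c'_def by (simp add: axis_eq_axis)
      have B: "b \<in> Basis \<Longrightarrow> c' b \<noteq> 0" for b using c by (auto simp: c'_def)
      have sumB: "(\<Sum>b\<in>Basis. g b) = (\<Sum>i\<in>UNIV. g (axis i 1))" for g :: "real^'n \<Rightarrow> real^'n"
        by (simp add: Basis_vec_def sum.UNION_disjoint UNION_singleton_eq_range sum.reindex inj_on_def axis_eq_axis o_def)
      have "0 + (\<Sum>b\<in>Basis. (c' b * (x \<bullet> b)) *\<^sub>R b) = ?f x" for x :: "real^'n"
        unfolding sumB c' by (simp add: vec_eq_iff inner_axis) (simp add: axis_def if_distrib cong: if_cong)
      moreover have "(\<Prod>b\<in>Basis. \<bar>c' b\<bar>) = \<bar>det (matrix ?f)\<bar>"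
        unfolding prod_Basis_cart c' by (subst det_diagonal) (auto simp: matrix_def axis_def abs_prod)
      ultimately show "lborel = density (distr lborel borel ?f) (\<lambda>_. ennreal \<bar>det (matrix ?f)\<bar>)"
        using lborel_affine_euclidean[of c' 0] B by simp
    qed
  next
    fix m n :: 'n assume mn: "m \<noteq> n"
    let ?p = "Transposition.transpose m n"
    let ?f = "\<lambda>x::real^'n. \<chi> i. x $ ?p i"
    have lin: "linear ?f" by (rule linearI) (auto simp: vec_eq_iff)
    note [measurable] = meas[OF lin]
    have "matrix ?f = (\<chi> i. (mat 1 :: real^'n^'n) $ ?p i)"
      by (simp add: matrix_def mat_def axis_def vec_eq_iff eq_commute)
    then have "\<bar>det (matrix ?f)\<bar> = 1"
      by (simp add: det_permute_rows permutes_swap_id sign_swap_id mn abs_mult)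
    moreover have "lborel = distr lborel borel ?f"
    proof (rule lborel_eqI)
      fix l u :: "real^'n"
      assume le: "\<And>b. b \<in> Basis \<Longrightarrow> l \<bullet> b \<le> u \<bullet> b"
      then have le': "l $ i \<le> u $ i" for i
        by (metis axis_in_Basis_iff inner_axis real_inner_1_right Basis_real_def insertI1)
      have "?f -` box l u = box (?f l) (?f u)"
        by (auto simp: mem_box_cart) (metis transpose_involutory)+
      then have "emeasure (distr lborel borel ?f) (box l u) = emeasure lborel (box (?f l) (?f u))"
        by (simp add: emeasure_distr)
      also have "\<dots> = ennreal (\<Prod>b\<in>Basis. (?f u - ?f l) \<bullet> b)"
        by (intro emeasure_lborel_box) (auto simp: Basis_vec_def inner_axis le')
      also have "(\<Prod>b\<in>Basis. (?f u - ?f l) \<bullet> b) = (\<Prod>i\<in>UNIV. (u - l) $ ?p i)"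
        by (simp add: prod_Basis_cart inner_axis)
      also have "\<dots> = (\<Prod>i\<in>UNIV. (u - l) $ i)"
        using prod.permute[OF permutes_swap_id[of m UNIV n], of "\<lambda>i. (u - l) $ i"] by (simp add: o_def)
      also have "\<dots> = (\<Prod>b\<in>Basis. (u - l) \<bullet> b)"
        by (simp add: prod_Basis_cart inner_axis)
      finally show "emeasure (distr lborel borel ?f) (box l u) = (\<Prod>b\<in>Basis. (u - l) \<bullet> b)" .
    qed simp
    ultimately show "?P ?f" by (simp add: density_1)
  next
    fix m n :: 'n assume mn: "m \<noteq> n"
    let ?f = "\<lambda>x::real^'n. \<chi> i. if i = m then x $ m + x $ n else x $ i"
    have "matrix ?f = (\<chi> i. if i = m then row m (mat 1 :: real^'n^'n) + 1 *s row n (mat 1) else row i (mat 1))"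
      by (auto simp: matrix_def mat_def axis_def vec_eq_iff row_def)
    then have "det (matrix ?f) = 1" using det_row_operation[OF mn, where c=1 and A="mat 1 :: real^'n^'n"] by simp
    then show "?P ?f" using lborel_shear[OF mn] by (simp add: density_1)
  qed
  with inj show ?thesis by blast
qed

text \<open>Gram--Schmidt for the inner product \<open>x, y \<mapsto> x \<bullet> (Q *v y)\<close>.\<close>

lemma pos_definite_orthonormal_family:
  fixes Q :: "real^'n^'n"
  assumes Q: "pos_definite Q"
  shows "\<exists>b :: 'n \<Rightarrow> real^'n. \<forall>i\<in>I. \<forall>j\<in>I. b i \<bullet> (Q *v b j) = (if i = j then 1 else 0)"
proof -
  have sym: "x \<bullet> (Q *v y) = y \<bullet> (Q *v x)" for x y
    using Q by (metis dot_lmul_matrix inner_commute pos_definite_def transpose_matrix_vector)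
  have "finite I" by simp
  then show ?thesis
  proof (induction I rule: finite_induct)
    case (insert k I)
    then obtain b :: "'n \<Rightarrow> real^'n" where b: "\<And>i j. i \<in> I \<Longrightarrow> j \<in> I \<Longrightarrow> b i \<bullet> (Q *v b j) = (if i = j then 1 else 0)"
      by auto
    \<comment> \<open>So few vectors cannot span the space, hence some nonzero \<open>w\<close> is
      orthogonal to every \<open>Q *v b i\<close>; this is orthogonality to the \<open>b i\<close>
      in the inner product of \<open>Q\<close>.\<close>
    let ?S = "(\<lambda>i. Q *v b i) ` I"
    have "card I < CARD('n)" using insert by (intro psubset_card_mono) auto
    then have "dim ?S < DIM(real^'n)"
      using dim_le_card'[of ?S] card_image_le[of I "\<lambda>i. Q *v b i"] insert by simp
    then obtain w where w: "w \<noteq> 0" "\<And>y. y \<in> span ?S \<Longrightarrow> orthogonal w y"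
      using orthogonal_to_subspace_exists by metis
    have pos: "w \<bullet> (Q *v w) > 0" using Q w by (auto simp: pos_definite_def)
    define c where "c = w /\<^sub>R sqrt (w \<bullet> (Q *v w))"
    have cc: "c \<bullet> (Q *v c) = 1" using pos
      by (simp add: c_def matrix_vector_mult_scaleR real_sqrt_mult_self[symmetric] field_simps flip: real_sqrt_mult power2_eq_square)
    have cb: "c \<bullet> (Q *v b i) = 0" if "i \<in> I" for i
      using w(2)[of "Q *v b i"] that by (auto simp: c_def orthogonal_def intro: span_base)
    show ?case
    proof (intro exI[of _ "b(k := c)"] ballI)
      fix i j assume "i \<in> insert k I" "j \<in> insert k I"
      then show "(b(k := c)) i \<bullet> (Q *v (b(k := c)) j) = (if i = j then 1 else 0)"
        using insert.hyps cc cb b sym[of "b i" c] by (auto simp: fun_upd_def)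
    qed
  qed auto
qed

text \<open>The columns of \<open>A\<close> are a basis that is orthonormal for \<open>Q\<close>.
  \<open>A\<close> takes the place of an inverse square root of \<open>Q\<close>; only the
  congruence matters, not symmetry.\<close>

lemma pos_definite_factor:
  fixes Q :: "real^'n^'n"
  assumes Q: "pos_definite Q"
  obtains A :: "real^'n^'n" where "transpose A ** Q ** A = mat 1"
proof -
  obtain b :: "'n \<Rightarrow> real^'n" where b: "\<And>i j. b i \<bullet> (Q *v b j) = (if i = j then 1 else 0)"
    using pos_definite_orthonormal_family[OF Q, of UNIV] by auto
  define A where "A = transpose (\<chi> i. b i)"
  have "(transpose A ** Q ** A) $ i $ j = b i \<bullet> (Q *v b j)" for i j
    by (simp add: A_def matrix_matrix_mult_def transpose_def matrix_vector_mult_def inner_vec_def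
        sum_distrib_left sum_distrib_right ac_simps) (subst sum.swap, simp add: ac_simps)
  then have "transpose A ** Q ** A = mat 1" by (simp add: vec_eq_iff b mat_def)
  then show thesis by (rule that)
qed

section \<open>Inverses of positive definite matrices and the multivariate normal law\<close>

lemma matrix_inv_both:
  fixes S :: "real^'n^'n"
  assumes "invertible S"
  shows "S ** matrix_inv S = mat 1" "matrix_inv S ** S = mat 1"
  using someI_ex[OF assms[unfolded invertible_def]] unfolding matrix_inv_def by auto

lemma matrix_inv_eqI:
  fixes S T :: "real^'n^'n"
  assumes "S ** T = mat 1"
  shows "matrix_inv S = T"
proof -
  have "invertible S"
    using assms matrix_left_right_inverse by (auto simp: invertible_def)
  then have "matrix_inv S = matrix_inv S ** (S ** T)" by (simp add: assms)
  also have "\<dots> = T" by (simp add: matrix_mul_assoc matrix_inv_both[OF \<open>invertible S\<close>])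
  finally show ?thesis .
qed

lemma pos_definite_invertible:
  assumes "pos_definite (S :: real^'n^'n)"
  shows "invertible S"
proof -
  have "x = 0" if "S *v x = 0" for x
    using assms that by (metis inner_zero_right less_irrefl pos_definite_def)
  then show ?thesis
    using invertible_left_inverse matrix_left_invertible_ker by blast
qed

lemma pos_definite_congruence:
  fixes S A :: "real^'n^'n"
  assumes S: "pos_definite S" and A: "invertible A"
  shows "pos_definite (transpose A ** S ** A)"
  unfolding pos_definite_def
proof (intro conjI allI impI)
  show "transpose (transpose A ** S ** A) = transpose A ** S ** A"
    using S by (simp add: matrix_transpose_mul matrix_mul_assoc pos_definite_def)
next
  fix v :: "real^'n" assume "v \<noteq> 0"
  then have "A *v v \<noteq> 0"
    using A invertible_left_inverse matrix_left_invertible_ker by blast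
  then have "(A *v v) \<bullet> (S *v (A *v v)) > 0" using S by (simp add: pos_definite_def)
  then show "v \<bullet> ((transpose A ** S ** A) *v v) > 0"
    by (metis dot_lmul_matrix matrix_vector_mul_assoc transpose_matrix_vector inner_commute)
qed

lemma pos_definite_matrix_inv:
  assumes S: "pos_definite (S :: real^'n^'n)"
  shows "pos_definite (matrix_inv S)"
proof -
  let ?T = "matrix_inv S"
  note inv = matrix_inv_both[OF pos_definite_invertible[OF S]]
  have "S ** transpose ?T = transpose (?T ** S)"
    using S by (simp add: matrix_transpose_mul pos_definite_def)
  then have sym: "transpose ?T = ?T"
    using matrix_inv_eqI[of S "transpose ?T"] inv by (simp add: transpose_mat)
  have "invertible ?T" using inv by (auto simp: invertible_def)
  from pos_definite_congruence[OF S this] show ?thesis by (simp add: sym inv)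
qed

text \<open>Under \<open>x = A *v y\<close> the quadratic form of the inverse of \<open>S\<close>
  becomes \<open>(norm y)\<^sup>2\<close>, and the normalising determinant cancels against the
  Jacobian because \<open>det S = (det A)\<^sup>2\<close>.\<close>

lemma multi_normal_eq_distr:
  fixes S A :: "real^'n^'n"
  assumes S: "pos_definite S" and A: "transpose A ** matrix_inv S ** A = mat 1"
  shows "multi_normal 0 S = distr gauss borel ((*v) A)" and "A ** transpose A = S"
proof -
  let ?Q = "matrix_inv S"
  note inv = matrix_inv_both[OF pos_definite_invertible[OF S]]
  have "A ** (transpose A ** ?Q) = mat 1"
    using A matrix_left_right_inverse by blast
  then have "(A ** transpose A) ** (?Q ** S) = S"
    by (simp add: matrix_mul_assoc)
  then show AAT: "A ** transpose A = S" by (simp add: inv)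
  have inj: "inj ((*v) A)"
    using A matrix_left_invertible_injective[of A] by (auto simp: inj_def)
  have [measurable]: "(*v) A \<in> borel_measurable borel"
    by (intro borel_measurable_continuous_onI) (simp add: linear_continuous_on)
  let ?q = "\<lambda>x. exp (- (x \<bullet> (?Q *v x)) / 2) / sqrt ((2 * pi) ^ CARD('n) * det S)"
  have [measurable]: "(\<lambda>x. x \<bullet> (?Q *v x)) \<in> borel_measurable borel"
    by (intro borel_measurable_continuous_onI continuous_intros)
  have [measurable]: "?q \<in> borel_measurable borel"
    by measurable
  have "det A \<noteq> 0" using A by (metis det_I det_mul mult_zero_right zero_neq_one)
  have detS: "det S = (det A)\<^sup>2"
    using AAT by (metis det_mul det_transpose power2_eq_square)
  have q: "\<bar>det A\<bar> * ?q (A *v y) = std_gauss y" for y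
  proof -
    have "(A *v y) \<bullet> (?Q *v (A *v y)) = y \<bullet> ((transpose A ** ?Q ** A) *v y)"
      by (metis dot_lmul_matrix matrix_vector_mul_assoc transpose_matrix_vector inner_commute)
    also have "\<dots> = (norm y)\<^sup>2" by (simp add: A power2_norm_eq_inner)
    finally have "(A *v y) \<bullet> (?Q *v (A *v y)) = (norm y)\<^sup>2" .
    moreover have "sqrt ((2 * pi) ^ CARD('n) * (det A)\<^sup>2) = sqrt (2 * pi) ^ CARD('n) * \<bar>det A\<bar>"
      by (simp only: real_sqrt_mult real_sqrt_power[of "2 * pi"] real_sqrt_abs)
    ultimately have "?q (A *v y) = exp (- (norm y)\<^sup>2 / 2) / (sqrt (2 * pi) ^ CARD('n) * \<bar>det A\<bar>)"
      by (simp only: detS minus_divide_left)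
    then show ?thesis using \<open>det A \<noteq> 0\<close> by (simp add: std_gauss_eq power_one_over)
  qed
  have "multi_normal 0 S = density (density (distr lborel borel ((*v) A)) (\<lambda>_. ennreal \<bar>det A\<bar>)) (\<lambda>x. ennreal (?q x))"
    unfolding multi_normal_def using lborel_linear[OF matrix_vector_mul_linear inj] by simp
  also have "\<dots> = density (distr lborel borel ((*v) A)) (\<lambda>x. ennreal (\<bar>det A\<bar> * ?q x))"
    by (subst density_density_eq) (simp_all only: ennreal_mult'[OF abs_ge_zero], measurable)
  also have "\<dots> = distr (density lborel (\<lambda>y. ennreal (\<bar>det A\<bar> * ?q (A *v y)))) borel ((*v) A)"
    by (rule density_distr) auto
  finally show "multi_normal 0 S = distr gauss borel ((*v) A)" unfolding q .
qed

lemma multi_normal_charfun: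
  fixes S :: "real^'n^'n"
  assumes S: "pos_definite S"
  shows "prob_space (multi_normal 0 S)" "sets (multi_normal 0 S) = sets borel"
    "(\<integral>x. iexp (t \<bullet> x) \<partial>multi_normal 0 S) = exp (- (t \<bullet> (S *v t)) / 2)"
proof -
  obtain A :: "real^'n^'n" where A: "transpose A ** matrix_inv S ** A = mat 1"
    using pos_definite_factor[OF pos_definite_matrix_inv[OF S]] by metis
  note eq = multi_normal_eq_distr[OF S A]
  have [measurable]: "(*v) A \<in> borel_measurable borel"
    by (intro borel_measurable_continuous_onI) (simp add: linear_continuous_on)
  show "prob_space (multi_normal 0 S)"
    unfolding eq(1) by (rule prob_space.prob_space_distr[OF prob_space_gauss]) simp
  show "sets (multi_normal 0 S) = sets borel" by (simp add: multi_normal_def)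
  have "(\<integral>x. iexp (t \<bullet> x) \<partial>multi_normal 0 S) = (\<integral>x. iexp (t \<bullet> (A *v x)) \<partial>gauss)"
    unfolding eq(1) by (subst integral_distr) auto
  also have "\<dots> = (\<integral>x. iexp ((transpose A *v t) \<bullet> x) \<partial>gauss)"
    by (simp add: dot_lmul_matrix[symmetric] transpose_matrix_vector)
  also have "\<dots> = exp (- (norm (transpose A *v t))\<^sup>2 / 2)"
    by (rule gauss_charfun)
  also have "(norm (transpose A *v t))\<^sup>2 = t \<bullet> (S *v t)"
    unfolding power2_norm_eq_inner eq(2)[symmetric]
    by (metis dot_lmul_matrix matrix_vector_mul_assoc transpose_matrix_vector)
  finally show "(\<integral>x. iexp (t \<bullet> x) \<partial>multi_normal 0 S) = exp (- (t \<bullet> (S *v t)) / 2)" .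
qed

section \<open>Central limit theorem for moving blocks of samples\<close>

lemma (in prob_space) indep_vars_reindex_inj:
  assumes inj: "inj_on h J" and ind: "indep_vars M' X (h ` J)"
  shows "indep_vars (\<lambda>j. M' (h j)) (\<lambda>j. X (h j)) J"
  unfolding indep_vars_def indep_sets_def
proof (intro conjI ballI allI impI)
  let ?F = "\<lambda>i. sigma_sets (space M) {X i -` A \<inter> space M |A. A \<in> sets (M' i)}"
  fix K A assume K: "K \<subseteq> J" "K \<noteq> {}" "finite K" and A: "A \<in> (\<Pi> j\<in>K. ?F (h j))"
  define A' where "A' = (\<lambda>i. A (inv_into K h i))"
  have injK: "inj_on h K" using inj K(1) by (rule inj_on_subset)
  then have A': "A' (h j) = A j" if "j \<in> K" for j using that by (simp add: A'_def)
  have "A' \<in> (\<Pi> i\<in>h ` K. ?F i)" using A A' by auto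
  moreover have "indep_sets ?F (h ` J)" using ind by (simp add: indep_vars_def)
  ultimately have "prob (\<Inter>i\<in>h ` K. A' i) = (\<Prod>i\<in>h ` K. prob (A' i))"
    using K by (intro indep_setsD) (auto simp: Pi_iff)
  then show "prob (\<Inter>j\<in>K. A j) = (\<Prod>j\<in>K. prob (A j))"
    by (simp add: prod.reindex[OF injK] A')
qed (use ind[unfolded indep_vars_def indep_sets_def] in auto)

text \<open>The offset \<open>c k\<close> varies arbitrarily with \<open>k\<close>. Since the
  variables are i.i.d., the characteristic function of a block is a power that depends on its length
  alone; its limit is read off from the blocks with offset 0, to which the usual theorem
  applies.\<close>

lemma (in prob_space) clt_blocks_charfun:
  fixes Y :: "nat \<Rightarrow> 'a \<Rightarrow> real" and T c :: "nat \<Rightarrow> nat"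
  assumes indep: "indep_vars (\<lambda>_. borel) Y {1..}"
    and distr: "\<And>i. i \<ge> 1 \<Longrightarrow> distr M borel (Y i) = \<mu>"
    and mean: "\<And>i. i \<ge> 1 \<Longrightarrow> expectation (Y i) = 0"
    and sq: "\<And>i. i \<ge> 1 \<Longrightarrow> integrable M (\<lambda>x. (Y i x)\<^sup>2)"
    and var: "\<And>i. i \<ge> 1 \<Longrightarrow> expectation (\<lambda>x. (Y i x)\<^sup>2) = s" and s: "s > 0"
    and T: "filterlim T at_top sequentially"
  shows "(\<lambda>k. expectation (\<lambda>x. iexp ((\<Sum>t = 1..T k. Y (c k + t) x) / sqrt (real (T k)))))
    \<longlonglongrightarrow> exp (- s / 2)"
proof -
  have meas[measurable]: "i \<ge> 1 \<Longrightarrow> random_variable borel (Y i)" for i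
    using indep unfolding indep_vars_def2 by auto
  have block: "expectation (\<lambda>x. iexp (r * (\<Sum>t = 1..n. Y (c + t) x))) = char \<mu> r ^ n" for c n r
  proof -
    have ind: "indep_vars (\<lambda>_. borel) (\<lambda>t. Y (c + t)) {1..n}"
      using indep_vars_reindex_inj[of "\<lambda>t. c + t" "{1..n}" "\<lambda>_. borel" Y]
        indep_vars_subset[OF indep, of "(\<lambda>t. c + t) ` {1..n}"] by (auto simp: o_def image_subset_iff)
    have "expectation (\<lambda>x. iexp (r * (\<Sum>t = 1..n. Y (c + t) x)))
      = char (distr M borel (\<lambda>x. \<Sum>t = 1..n. Y (c + t) x)) r"
      unfolding char_def by (subst integral_distr) (auto intro!: borel_measurable_sum)
    also have "\<dots> = (\<Prod>t = 1..n. char (distr M borel (Y (c + t))) r)"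
      by (rule char_distr_sum[OF ind])
    also have "\<dots> = char \<mu> r ^ n"
      using distr by simp
    finally show ?thesis .
  qed
  define X where "X = (\<lambda>i. Y (Suc i))"
  have ind: "indep_vars (\<lambda>i. borel) X UNIV"
    unfolding X_def
    using indep_vars_reindex_inj[of Suc UNIV "\<lambda>_. borel" Y] indep_vars_subset[OF indep, of "range Suc"]
    by (auto simp: o_def image_subset_iff)
  have "weak_conv_m (\<lambda>n. distr M borel (\<lambda>x. (\<Sum>i<n. X i x) / sqrt (n * (sqrt s)\<^sup>2))) std_normal_distribution"
    by (rule central_limit_theorem_zero_mean[OF ind, where \<mu>=\<mu>])
       (use mean sq var s distr in \<open>auto simp: X_def\<close>)
  \<comment> \<open>Here the sums are normalised to variance 1; evaluation at the frequency
    \<open>sqrt s\<close> undoes this.\<close>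
  then have "(\<lambda>n. char (distr M borel (\<lambda>x. (\<Sum>i<n. X i x) / sqrt (n * (sqrt s)\<^sup>2))) (sqrt s))
    \<longlonglongrightarrow> char std_normal_distribution (sqrt s)"
    by (intro levy_continuity1 real_distribution_distr real_dist_normal_dist)
       (auto simp: X_def intro!: borel_measurable_sum borel_measurable_divide)
  moreover have "char (distr M borel (\<lambda>x. (\<Sum>i<n. X i x) / sqrt (n * (sqrt s)\<^sup>2))) (sqrt s)
      = char \<mu> (1 / sqrt n) ^ n" for n
  proof -
    have "char (distr M borel (\<lambda>x. (\<Sum>i<n. X i x) / sqrt (n * (sqrt s)\<^sup>2))) (sqrt s)
      = expectation (\<lambda>x. iexp (sqrt s * ((\<Sum>i<n. X i x) / sqrt (n * (sqrt s)\<^sup>2))))"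
      unfolding char_def
      by (subst integral_distr) (auto simp: X_def intro!: borel_measurable_sum borel_measurable_divide)
    also have "\<dots> = expectation (\<lambda>x. iexp (1 / sqrt n * (\<Sum>t = 1..n. Y (0 + t) x)))"
    proof -
      have "(\<Sum>i<n. X i x) = (\<Sum>t = 1..n. Y (0 + t) x)" for x
        unfolding X_def by (simp add: sum.atLeast1_atMost_eq)
      moreover have "sqrt s * (z / sqrt (n * (sqrt s)\<^sup>2)) = 1 / sqrt n * z" for z
        using s by (simp add: real_sqrt_mult)
      ultimately show ?thesis by simp
    qed
    also have "\<dots> = char \<mu> (1 / sqrt n) ^ n" by (rule block)
    finally show ?thesis .
  qed
  ultimately have "(\<lambda>n. char \<mu> (1 / sqrt (real n)) ^ n) \<longlonglongrightarrow> exp (- s / 2)"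
    using s by (simp add: char_std_normal_distribution)
  from filterlim_compose[OF this T]
  have "(\<lambda>k. char \<mu> (1 / sqrt (real (T k))) ^ T k) \<longlonglongrightarrow> exp (- s / 2)" .
  moreover have "expectation (\<lambda>x. iexp ((\<Sum>t = 1..T k. Y (c k + t) x) / sqrt (real (T k))))
      = char \<mu> (1 / sqrt (real (T k))) ^ T k" for k
    using block[of "1 / sqrt (real (T k))" "c k" "T k"] by simp
  ultimately show ?thesis by simp
qed

section \<open>Gradients and Hessians\<close>

text \<open>\<open>gradient\<close> is a definite description, so besides a representing vector,
  read off from the derivative on the basis, its uniqueness is required.\<close>

lemma gradient_works:
  fixes h :: "'a::euclidean_space \<Rightarrow> real"
  assumes "h differentiable (at x)"
  shows "GDERIV h x :> gradient h x"
proof -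
  obtain h' where h': "(h has_derivative h') (at x)" using assms by (auto simp: differentiable_def)
  interpret h': linear h' using h' by (rule has_derivative_linear)
  define D where "D = (\<Sum>b\<in>Basis. h' b *\<^sub>R b)"
  have "h' v = v \<bullet> D" for v
  proof -
    have "h' v = h' (\<Sum>b\<in>Basis. (v \<bullet> b) *\<^sub>R b)" by (simp add: euclidean_representation)
    also have "\<dots> = v \<bullet> D" by (simp add: h'.sum h'.scaleR D_def inner_sum_right mult.commute)
    finally show ?thesis .
  qed
  then have "h' = (\<lambda>v. v \<bullet> D)" by auto
  then have D: "GDERIV h x :> D" using h' by (simp add: gderiv_def)
  have "D' = D" if "GDERIV h x :> D'" for D'
  proof -
    have "(\<lambda>v. v \<bullet> D') = (\<lambda>v. v \<bullet> D)"
      using that D unfolding gderiv_def by (rule has_derivative_unique)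
    then have "(D' - D) \<bullet> D' = (D' - D) \<bullet> D" by (rule fun_cong)
    then show ?thesis using inner_eq_zero_iff[of "D' - D"] by (simp add: inner_diff_right)
  qed
  with D show ?thesis unfolding gradient_def by (metis the_equality)
qed

lemma gradient_at_minimum:
  fixes h :: "'a::euclidean_space \<Rightarrow> real"
  assumes "h differentiable (at x)" and "\<And>y. h x \<le> h y"
  shows "gradient h x = 0"
proof -
  have "(\<lambda>v. v \<bullet> gradient h x) = (\<lambda>v. 0)"
    by (rule has_derivative_local_min[of h _ x]) (use gradient_works[OF assms(1)] assms(2) in \<open>auto simp: gderiv_def\<close>)
  then have "gradient h x \<bullet> gradient h x = 0" by (rule fun_cong)
  then show ?thesis by simp
qed

section \<open>Symmetry and definiteness of the Hessian\<close>

definition second_difference :: "('a::real_vector \<Rightarrow> real) \<Rightarrow> 'a \<Rightarrow> 'a \<Rightarrow> 'a \<Rightarrow> real" where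
  "second_difference F x u v = F (x + u + v) - F (x + u) - F (x + v) + F x"

text \<open>The mean value theorem along \<open>u\<close>, applied to the first difference along
  \<open>v\<close>, leaves a difference of gradients near \<open>x\<close>; the derivative of
  \<open>G\<close> at \<open>x\<close> evaluates it up to an error small relative to
  \<open>t\<close>.\<close>

lemma second_difference_quotient:
  fixes F :: "'a::euclidean_space \<Rightarrow> real" and G :: "'a \<Rightarrow> 'a"
  assumes F: "\<And>y. GDERIV F y :> G y" and G: "(G has_derivative H) (at x)" and e: "e > 0"
  shows "\<exists>d>0. \<forall>t. 0 < t \<and> t < d \<longrightarrow>
    \<bar>second_difference F x (t *\<^sub>R u) (t *\<^sub>R v) - t\<^sup>2 * (u \<bullet> H v)\<bar>
      \<le> e * t\<^sup>2 * (norm u * (2 * norm u + norm v))"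
proof -
  interpret H: linear H using G by (rule has_derivative_linear)
  obtain d where d: "d > 0" "\<And>y. norm (y - x) < d \<Longrightarrow> norm (G y - G x - H (y - x)) \<le> e * norm (y - x)"
    using has_derivative_at_alt[THEN iffD1, OF G] e by blast
  define r where "r = (\<lambda>w. G (x + w) - G x - H w)"
  have r: "norm (r w) \<le> e * norm w" if "norm w < d" for w
    using d(2)[of "x + w"] that by (simp add: r_def)
  let ?d = "d / (norm u + norm v + 1)"
  have pos: "norm u + norm v + 1 > 0" by (smt (verit) norm_ge_zero)
  show ?thesis
  proof (intro exI[of _ ?d] conjI allI impI)
    show "?d > 0" using d(1) pos by simp
    fix t assume t: "0 < t \<and> t < ?d"
    then have td: "t * (norm u + norm v + 1) < d" using pos by (simp add: field_simps)
    \<comment> \<open>\<open>?p 1 - ?p 0\<close> is the second difference.\<close>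
    let ?p = "\<lambda>s. F (x + (s * t) *\<^sub>R u + t *\<^sub>R v) - F (x + (s * t) *\<^sub>R u)"
    let ?p' = "\<lambda>s. t * (u \<bullet> (G (x + (s * t) *\<^sub>R u + t *\<^sub>R v) - G (x + (s * t) *\<^sub>R u)))"
    have p': "(?p has_real_derivative ?p' s) (at s)" for s
    proof -
      have F': "(F has_derivative (\<lambda>h. h \<bullet> G y)) (at y)" for y using F by (simp add: gderiv_def)
      have 1: "((\<lambda>s. F (x + (s * t) *\<^sub>R u + w)) has_derivative (\<lambda>h. ((h * t) *\<^sub>R u) \<bullet> G (x + (s * t) *\<^sub>R u + w))) (at s)" for w
        by (rule has_derivative_compose[where f="\<lambda>s. x + (s * t) *\<^sub>R u + w", OF _ F'])
           (auto intro!: derivative_eq_intros)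
      show ?thesis
        unfolding has_field_derivative_def
        by (rule has_derivative_eq_rhs[OF has_derivative_diff[OF 1 1[of 0, simplified]]])
           (auto simp: fun_eq_iff inner_diff_right algebra_simps)
    qed
    obtain s where s: "0 < s" "s < 1" "?p 1 - ?p 0 = (1 - 0) * ?p' s"
      using MVT2[of 0 1 ?p ?p'] p' by auto
    have st: "norm ((s * t) *\<^sub>R u) \<le> t * norm u"
      using s t by (simp add: mult_le_cancel_right1 mult_le_cancel_left1 abs_mult mult_mono)
    have n2: "norm ((s * t) *\<^sub>R u + t *\<^sub>R v) \<le> t * (norm u + norm v)"
      using norm_triangle_ineq[of "(s * t) *\<^sub>R u" "t *\<^sub>R v"] st t by (simp add: distrib_left)
    have small: "norm ((s * t) *\<^sub>R u) < d" "norm ((s * t) *\<^sub>R u + t *\<^sub>R v) < d"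
      using st n2 td t by (auto simp: distrib_left) (smt (verit) mult_nonneg_nonneg norm_ge_zero)+
    have diff: "G (x + (s * t) *\<^sub>R u + t *\<^sub>R v) - G (x + (s * t) *\<^sub>R u) - t *\<^sub>R H v
      = r ((s * t) *\<^sub>R u + t *\<^sub>R v) - r ((s * t) *\<^sub>R u)"
      by (simp add: r_def H.add H.scaleR add.assoc)
    have "norm (r ((s * t) *\<^sub>R u + t *\<^sub>R v) - r ((s * t) *\<^sub>R u)) \<le> e * (t * (norm u + norm v)) + e * (t * norm u)"
      using norm_triangle_ineq4[of "r ((s * t) *\<^sub>R u + t *\<^sub>R v)" "r ((s * t) *\<^sub>R u)"] r[OF small(1)] r[OF small(2)]
        mult_left_mono[OF st, of e] mult_left_mono[OF n2, of e] e by linarith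
    then have nd: "norm (G (x + (s * t) *\<^sub>R u + t *\<^sub>R v) - G (x + (s * t) *\<^sub>R u) - t *\<^sub>R H v) \<le> e * t * (2 * norm u + norm v)"
      unfolding diff by (simp add: algebra_simps)
    have "second_difference F x (t *\<^sub>R u) (t *\<^sub>R v) - t\<^sup>2 * (u \<bullet> H v)
      = t * (u \<bullet> (G (x + (s * t) *\<^sub>R u + t *\<^sub>R v) - G (x + (s * t) *\<^sub>R u) - t *\<^sub>R H v))"
      using s(3) by (simp add: second_difference_def inner_diff_right algebra_simps power2_eq_square)
    also have "\<bar>\<dots>\<bar> \<le> t * (norm u * (e * t * (2 * norm u + norm v)))"
      using t nd by (auto simp: abs_mult intro!: mult_left_mono order_trans[OF Cauchy_Schwarz_ineq2])
    finally show "\<bar>second_difference F x (t *\<^sub>R u) (t *\<^sub>R v) - t\<^sup>2 * (u \<bullet> H v)\<bar>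
      \<le> e * t\<^sup>2 * (norm u * (2 * norm u + norm v))" by (simp add: power2_eq_square ac_simps)
  qed
qed

text \<open>Swapping \<open>u\<close> and \<open>v\<close> does not change
  \<open>second_difference\<close>, while its quotient by \<open>t\<^sup>2\<close> approximates
  either side. The symmetry is needed for the Hessian, whose inverse stands on both sides of the
  limiting covariance without a transpose.\<close>

lemma second_derivative_symmetric:
  fixes F :: "'a::euclidean_space \<Rightarrow> real" and G :: "'a \<Rightarrow> 'a"
  assumes F: "\<And>y. GDERIV F y :> G y" and G: "(G has_derivative H) (at x)"
  shows "u \<bullet> H v = v \<bullet> H u"
proof -
  define C where "C = norm u * (2 * norm u + norm v) + norm v * (2 * norm v + norm u)"
  have C: "C \<ge> 0" by (simp add: C_def)
  have "\<bar>u \<bullet> H v - v \<bullet> H u\<bar> \<le> e" if e: "e > 0" for e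
  proof -
    define e' where "e' = e / (C + 1)"
    have e': "e' > 0" using e C by (simp add: e'_def)
    obtain d1 where d1: "d1 > 0" "\<And>t. 0 < t \<Longrightarrow> t < d1 \<Longrightarrow>
      \<bar>second_difference F x (t *\<^sub>R u) (t *\<^sub>R v) - t\<^sup>2 * (u \<bullet> H v)\<bar>
      \<le> e' * t\<^sup>2 * (norm u * (2 * norm u + norm v))"
      using second_difference_quotient[OF F G e', of u v] by blast
    obtain d2 where d2: "d2 > 0" "\<And>t. 0 < t \<Longrightarrow> t < d2 \<Longrightarrow>
      \<bar>second_difference F x (t *\<^sub>R v) (t *\<^sub>R u) - t\<^sup>2 * (v \<bullet> H u)\<bar>
      \<le> e' * t\<^sup>2 * (norm v * (2 * norm v + norm u))"
      using second_difference_quotient[OF F G e', of v u] by blast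
    define t where "t = min d1 d2 / 2"
    have t: "t > 0" "t < d1" "t < d2" using d1 d2 by (auto simp: t_def)
    have "second_difference F x (t *\<^sub>R v) (t *\<^sub>R u) = second_difference F x (t *\<^sub>R u) (t *\<^sub>R v)"
      by (simp add: second_difference_def add.commute add.left_commute)
    with d1(2)[OF t(1,2)] d2(2)[OF t(1,3)]
    have "\<bar>t\<^sup>2 * (u \<bullet> H v) - t\<^sup>2 * (v \<bullet> H u)\<bar> \<le> e' * t\<^sup>2 * (norm u * (2 * norm u + norm v)) + e' * t\<^sup>2 * (norm v * (2 * norm v + norm u))"
      by (simp only:)
    then have "t\<^sup>2 * \<bar>u \<bullet> H v - v \<bullet> H u\<bar> \<le> t\<^sup>2 * (e' * C)"
    proof -
      have "t\<^sup>2 * \<bar>u \<bullet> H v - v \<bullet> H u\<bar> = \<bar>t\<^sup>2 * (u \<bullet> H v) - t\<^sup>2 * (v \<bullet> H u)\<bar>"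
        by (simp add: abs_mult right_diff_distrib[symmetric])
      moreover assume "\<bar>t\<^sup>2 * (u \<bullet> H v) - t\<^sup>2 * (v \<bullet> H u)\<bar> \<le> e' * t\<^sup>2 * (norm u * (2 * norm u + norm v)) + e' * t\<^sup>2 * (norm v * (2 * norm v + norm u))"
      ultimately show ?thesis by (simp add: C_def algebra_simps)
    qed
    then have "\<bar>u \<bullet> H v - v \<bullet> H u\<bar> \<le> e' * C" using t(1) by simp
    also have "\<dots> \<le> e" using e C by (simp add: e'_def field_simps)
    finally show ?thesis .
  qed
  then have "\<bar>u \<bullet> H v - v \<bullet> H u\<bar> \<le> 0" by (rule field_le_epsilon[where y=0, simplified])
  then show ?thesis by simp
qed

lemma hessian_has_derivative:
  assumes "twice_cont_differentiable F"
  shows "(gradient F has_derivative (\<lambda>v. hessian F x *v v)) (at x)"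
  using assms jacobian_works unfolding twice_cont_differentiable_def hessian_def by blast

lemma hessian_symmetric:
  assumes "twice_cont_differentiable F"
  shows "transpose (hessian F x) = hessian F x"
proof -
  have "u \<bullet> (hessian F x *v v) = v \<bullet> (hessian F x *v u)" for u v
    by (rule second_derivative_symmetric[OF gradient_works hessian_has_derivative[OF assms]])
       (use assms in \<open>auto simp: twice_cont_differentiable_def\<close>)
  from this[of "axis _ 1" "axis _ 1"] show ?thesis
    by (simp add: vec_eq_iff transpose_def inner_axis' matrix_vector_mul_component inner_axis)
qed

text \<open>Strong monotonicity is applied to \<open>x\<close> and \<open>x + t *\<^sub>R v\<close>
  for a small \<open>t\<close> and divided by \<open>t\<^sup>2\<close>. For the Hessian this yields
  positive definiteness.\<close>

lemma strongly_monotone_derivative: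
  fixes G :: "'a::euclidean_space \<Rightarrow> 'a"
  assumes G: "(G has_derivative H) (at x)"
    and mono: "\<And>y z. (G y - G z) \<bullet> (y - z) \<ge> \<mu> * (norm (y - z))\<^sup>2"
  shows "v \<bullet> H v \<ge> \<mu> * (norm v)\<^sup>2"
proof (rule field_le_epsilon)
  interpret H: linear H using G by (rule has_derivative_linear)
  fix e :: real assume e: "e > 0"
  define e' where "e' = e / ((norm v)\<^sup>2 + 1)"
  have e': "e' > 0" using e by (simp add: e'_def add_nonneg_pos)
  obtain d where d: "d > 0" "\<And>y. norm (y - x) < d \<Longrightarrow> norm (G y - G x - H (y - x)) \<le> e' * norm (y - x)"
    using has_derivative_at_alt[THEN iffD1, OF G] e' by blast
  define t where "t = d / (2 * (norm v + 1))"
  have pos: "norm v + 1 > 0" by (smt (verit) norm_ge_zero)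
  have t: "t > 0" using d(1) pos by (simp add: t_def)
  have "t * (2 * (norm v + 1)) = d" using pos by (simp add: t_def)
  then have tv: "t * norm v < d" using t d(1) by (simp add: algebra_simps)
  have 1: "norm (G (x + t *\<^sub>R v) - G x - t *\<^sub>R H v) \<le> e' * (t * norm v)"
    using d(2)[of "x + t *\<^sub>R v"] tv t by (simp add: H.scaleR)
  have "\<mu> * (t\<^sup>2 * (norm v)\<^sup>2) \<le> t * ((G (x + t *\<^sub>R v) - G x) \<bullet> v)"
    using mono[of "x + t *\<^sub>R v" x] by (simp add: power_mult_distrib)
  also have "(G (x + t *\<^sub>R v) - G x) \<bullet> v = t * (v \<bullet> H v) + (G (x + t *\<^sub>R v) - G x - t *\<^sub>R H v) \<bullet> v"
    by (simp add: inner_diff_left inner_commute[of v "H v"])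
  also have "\<dots> \<le> t * (v \<bullet> H v) + e' * (t * norm v) * norm v"
    by (intro add_left_mono order_trans[OF norm_cauchy_schwarz] mult_right_mono 1) simp
  finally have "t * (t * (\<mu> * (norm v)\<^sup>2)) \<le> t * (t * (v \<bullet> H v + e' * (norm v)\<^sup>2))"
    using t by (simp add: algebra_simps power2_eq_square)
  then have "\<mu> * (norm v)\<^sup>2 \<le> v \<bullet> H v + e' * (norm v)\<^sup>2" using t by simp
  also have "e' * (norm v)\<^sup>2 \<le> e" using e mult_left_mono[of "(norm v)\<^sup>2" "(norm v)\<^sup>2 + 1" e]
    by (simp add: e'_def divide_le_eq add_nonneg_pos)
  finally show "\<mu> * (norm v)\<^sup>2 \<le> v \<bullet> H v + e" by simp
qed

section \<open>Joint measurability of the stochastic gradient\<close>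

lemma caratheodory_measurable:
  fixes f :: "real^'d \<Rightarrow> 'x \<Rightarrow> real"
  assumes meas: "\<And>\<theta>. f \<theta> \<in> borel_measurable P"
    and cont: "\<And>x. x \<in> space P \<Longrightarrow> continuous_on UNIV (\<lambda>\<theta>. f \<theta> x)"
  shows "(\<lambda>(\<theta>, x). f \<theta> x) \<in> borel_measurable (borel \<Otimes>\<^sub>M P)"
proof -
  \<comment> \<open>\<open>r n \<theta>\<close> names the grid cell of mesh
    \<open>1 / (n + 1)\<close> that contains \<theta>, and \<open>q\<close> gives its corner. On
    each of the countably many cells, \<open>f\<close> at the corner depends on \<open>x\<close>
    alone, so the approximants are jointly measurable; continuity in \<theta> gives the
    limit.\<close>
  define q where "q = (\<lambda>n (k :: 'd \<Rightarrow> int). (\<chi> i. of_int (k i) / real (Suc n)) :: real^'d)"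
  define r where "r = (\<lambda>n (\<theta> :: real^'d) i. \<lfloor>real (Suc n) * \<theta> $ i\<rfloor>)"
  show ?thesis
  proof (rule borel_measurable_LIMSEQ_real)
    fix z :: "(real^'d) \<times> 'x" assume "z \<in> space (borel \<Otimes>\<^sub>M P)"
    then obtain \<theta> x where z: "z = (\<theta>, x)" "x \<in> space P" by (auto simp: space_pair_measure)
    have "(\<lambda>n. q n (r n \<theta>)) \<longlonglongrightarrow> \<theta>"
    proof (rule vec_tendstoI)
      fix i
      have "(\<lambda>n. of_int \<lfloor>real (Suc n) * \<theta> $ i\<rfloor> / real (Suc n)) \<longlonglongrightarrow> \<theta> $ i"
      proof (rule real_tendsto_sandwich)
        show "\<forall>\<^sub>F n in sequentially. \<theta> $ i - 1 / real (Suc n) \<le> of_int \<lfloor>real (Suc n) * \<theta> $ i\<rfloor> / real (Suc n)"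
        proof (intro always_eventually allI)
          fix n
          have "real (Suc n) * \<theta> $ i - 1 \<le> of_int \<lfloor>real (Suc n) * \<theta> $ i\<rfloor>" by linarith
          then have "(real (Suc n) * \<theta> $ i - 1) / real (Suc n) \<le> of_int \<lfloor>real (Suc n) * \<theta> $ i\<rfloor> / real (Suc n)"
            by (rule divide_right_mono) simp
          then show "\<theta> $ i - 1 / real (Suc n) \<le> of_int \<lfloor>real (Suc n) * \<theta> $ i\<rfloor> / real (Suc n)"
            by (simp add: diff_divide_distrib)
        qed
        show "\<forall>\<^sub>F n in sequentially. of_int \<lfloor>real (Suc n) * \<theta> $ i\<rfloor> / real (Suc n) \<le> \<theta> $ i"
          by (intro always_eventually allI) (simp add: field_simps)
        have "(\<lambda>n. \<theta> $ i - 1 / real (Suc n)) \<longlonglongrightarrow> \<theta> $ i - 0"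
          using LIMSEQ_inverse_real_of_nat by (intro tendsto_intros) (simp add: inverse_eq_divide)
        then show "(\<lambda>n. \<theta> $ i - 1 / real (Suc n)) \<longlonglongrightarrow> \<theta> $ i" by simp
      qed simp
      then show "(\<lambda>n. q n (r n \<theta>) $ i) \<longlonglongrightarrow> \<theta> $ i" by (simp add: q_def r_def)
    qed
    then have "(\<lambda>n. f (q n (r n \<theta>)) x) \<longlonglongrightarrow> f \<theta> x"
      using continuous_on_tendsto_compose[OF cont[OF z(2)]] by simp
    then show "(\<lambda>n. (\<lambda>(\<theta>, x). f (q n (r n \<theta>)) x) z) \<longlonglongrightarrow> (\<lambda>(\<theta>, x). f \<theta> x) z" by (simp add: z(1))
  next
    fix n
    have [measurable]: "(\<lambda>\<theta> :: real^'d. \<theta> $ i) \<in> borel_measurable borel" for i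
      by (intro borel_measurable_continuous_onI continuous_intros)
    have "(\<lambda>z. r n (fst z)) \<in> measurable (borel \<Otimes>\<^sub>M P) (count_space UNIV)"
    proof (subst measurable_count_space_eq_countable, simp, intro conjI ballI)
      fix k :: "'d \<Rightarrow> int"
      have "(\<lambda>z. r n (fst z)) -` {k} \<inter> space (borel \<Otimes>\<^sub>M P)
        = {z \<in> space (borel \<Otimes>\<^sub>M P). \<forall>i. \<lfloor>real (Suc n) * fst z $ i\<rfloor> = k i}"
        by (auto simp: r_def fun_eq_iff)
      also have "\<dots> \<in> sets (borel \<Otimes>\<^sub>M P)" by measurable
      finally show "(\<lambda>z. r n (fst z)) -` {k} \<inter> space (borel \<Otimes>\<^sub>M P) \<in> sets (borel \<Otimes>\<^sub>M P)" .
    qed simp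
    moreover have "(\<lambda>z. f (q n k) (snd z)) \<in> borel_measurable (borel \<Otimes>\<^sub>M P)" for k :: "'d \<Rightarrow> int"
      by (rule measurable_compose[OF measurable_snd meas])
    ultimately have "(\<lambda>z. f (q n (r n (fst z))) (snd z)) \<in> borel_measurable (borel \<Otimes>\<^sub>M P)"
      by (rule measurable_compose_countable[rotated])
    then show "(\<lambda>(\<theta>, x). f (q n (r n \<theta>)) x) \<in> borel_measurable (borel \<Otimes>\<^sub>M P)"
      by (simp add: split_beta')
  qed
qed

text \<open>The coordinates of the gradient are limits of difference quotients with increments
  \<open>1 / (n + 1)\<close>, which are jointly measurable because \<open>f\<close> is.\<close>

lemma stoch_grad_measurable:
  fixes f :: "real^'d \<Rightarrow> 'x \<Rightarrow> real"
  assumes meas: "\<And>\<theta>. f \<theta> \<in> borel_measurable P"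
    and diff: "\<And>x \<theta>. x \<in> space P \<Longrightarrow> (\<lambda>\<theta>'. f \<theta>' x) differentiable (at \<theta>)"
  shows "(\<lambda>(\<theta>, x). stoch_grad f \<theta> x) \<in> borel_measurable (borel \<Otimes>\<^sub>M P)"
proof (rule borel_measurable_euclidean_space[THEN iffD2], rule ballI)
  fix b :: "real^'d" assume "b \<in> Basis"
  have [measurable]: "(\<lambda>(\<theta>, x). f \<theta> x) \<in> borel_measurable (borel \<Otimes>\<^sub>M P)"
    using diff by (intro caratheodory_measurable meas)
      (auto intro!: differentiable_imp_continuous_on simp: differentiable_on_def intro: differentiable_at_withinI)
  let ?D = "\<lambda>n z. real (Suc n) * (f (fst z + (1 / real (Suc n)) *\<^sub>R b) (snd z) - f (fst z) (snd z))"
  have "(\<lambda>z. stoch_grad f (fst z) (snd z) \<bullet> b) \<in> borel_measurable (borel \<Otimes>\<^sub>M P)"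
  proof (rule borel_measurable_LIMSEQ_real)
    fix z :: "(real^'d) \<times> 'x" assume "z \<in> space (borel \<Otimes>\<^sub>M P)"
    then have "snd z \<in> space P" by (auto simp: space_pair_measure)
    then have D: "((\<lambda>\<theta>'. f \<theta>' (snd z)) has_derivative (\<lambda>h. h \<bullet> stoch_grad f (fst z) (snd z))) (at (fst z))"
      using gradient_works[OF diff] by (simp add: stoch_grad_def gderiv_def)
    have "((\<lambda>t. f (fst z + t *\<^sub>R b) (snd z)) has_derivative (\<lambda>h. (h *\<^sub>R b) \<bullet> stoch_grad f (fst z) (snd z))) (at 0)"
      by (rule has_derivative_compose[where f="\<lambda>t. fst z + t *\<^sub>R b" and g="\<lambda>\<theta>. f \<theta> (snd z)" and g'="\<lambda>h. h \<bullet> stoch_grad f (fst z) (snd z)"])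
         (use D in \<open>auto intro!: derivative_eq_intros\<close>)
    then have "((\<lambda>t. f (fst z + t *\<^sub>R b) (snd z)) has_real_derivative b \<bullet> stoch_grad f (fst z) (snd z)) (at 0)"
      by (simp add: has_field_derivative_def mult_commute_abs)
    then have "((\<lambda>h. (f (fst z + h *\<^sub>R b) (snd z) - f (fst z) (snd z)) / h) \<longlongrightarrow> b \<bullet> stoch_grad f (fst z) (snd z)) (at 0)"
      by (simp add: DERIV_def)
    moreover have "filterlim (\<lambda>n. 1 / real (Suc n)) (at 0) sequentially"
      using LIMSEQ_inverse_real_of_nat by (auto simp: filterlim_at inverse_eq_divide)
    ultimately have "(\<lambda>n. (f (fst z + (1 / real (Suc n)) *\<^sub>R b) (snd z) - f (fst z) (snd z)) / (1 / real (Suc n))) \<longlonglongrightarrow> b \<bullet> stoch_grad f (fst z) (snd z)"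
      by (rule filterlim_compose)
    then show "(\<lambda>n. ?D n z) \<longlonglongrightarrow> stoch_grad f (fst z) (snd z) \<bullet> b"
      by (simp add: inner_commute mult.commute)
  next
    fix n show "?D n \<in> borel_measurable (borel \<Otimes>\<^sub>M P)" by measurable
  qed
  then show "(\<lambda>z. (case z of (\<theta>, x) \<Rightarrow> stoch_grad f \<theta> x) \<bullet> b) \<in> borel_measurable (borel \<Otimes>\<^sub>M P)"
    by (simp add: split_beta')
qed

section \<open>Samples and square-integrable martingale differences\<close>

lemma norm_add_sq_le: "(norm (a + b))\<^sup>2 \<le> 2 * (norm a)\<^sup>2 + 2 * (norm (b::'a::real_inner))\<^sup>2"
proof -
  have "0 \<le> (norm (a - b))\<^sup>2" by simp
  then show ?thesis by (simp add: power2_norm_eq_inner algebra_simps inner_commute)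
qed

text \<open>The weight keeps the factor of the first square close to 1; with the factor 2 of
  \<open>norm_add_sq_le\<close> the contraction of a gradient step would be lost.\<close>

lemma norm_add_sq_le_weighted:
  fixes a b :: "'a::real_inner"
  assumes "c > 0"
  shows "(norm (a + b))\<^sup>2 \<le> (1 + c) * (norm a)\<^sup>2 + (1 + 1 / c) * (norm b)\<^sup>2"
proof -
  have "0 \<le> (norm (sqrt c *\<^sub>R a - (1 / sqrt c) *\<^sub>R b))\<^sup>2" by simp
  also have "\<dots> = c * (norm a)\<^sup>2 + (1 / c) * (norm b)\<^sup>2 - 2 * (a \<bullet> b)"
    using assms by (simp add: power2_norm_eq_inner inner_diff_left inner_diff_right inner_commute field_simps)
  finally show ?thesis by (simp add: power2_norm_eq_inner algebra_simps inner_commute)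
qed

definition (in prob_space) sq_integrable :: "('a \<Rightarrow> 'b::euclidean_space) \<Rightarrow> bool" where
  "sq_integrable X \<longleftrightarrow> random_variable borel X \<and> integrable M (\<lambda>\<omega>. (norm (X \<omega>))\<^sup>2)"

context prob_space
begin

abbreviation sq_mean :: "('a \<Rightarrow> 'b::euclidean_space) \<Rightarrow> real" where
  "sq_mean X \<equiv> expectation (\<lambda>\<omega>. (norm (X \<omega>))\<^sup>2)"

lemma sq_integrable_const: "sq_integrable (\<lambda>_. c)"
  by (simp add: sq_integrable_def)

lemma sq_integrable_bound:
  assumes [measurable]: "random_variable borel X" and "integrable M f" and "\<And>\<omega>. \<omega> \<in> space M \<Longrightarrow> (norm (X \<omega>))\<^sup>2 \<le> f \<omega>"
  shows "sq_integrable X"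
  unfolding sq_integrable_def
proof
  show "integrable M (\<lambda>\<omega>. (norm (X \<omega>))\<^sup>2)"
  proof (rule Bochner_Integration.integrable_bound[OF assms(2)])
    show "AE \<omega> in M. norm ((norm (X \<omega>))\<^sup>2) \<le> norm (f \<omega>)"
      using assms(3) by (intro AE_I2) (auto intro: order_trans[OF _ abs_ge_self])
  qed simp
qed (rule assms(1))

lemma sq_integrable_add:
  assumes X: "sq_integrable X" and Y: "sq_integrable Y"
  shows "sq_integrable (\<lambda>\<omega>. X \<omega> + Y \<omega>)"
  by (rule sq_integrable_bound[where f="\<lambda>\<omega>. 2 * (norm (X \<omega>))\<^sup>2 + 2 * (norm (Y \<omega>))\<^sup>2"])
     (use X Y in \<open>auto simp: sq_integrable_def norm_add_sq_le\<close>)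

lemma sq_integrable_scaleR:
  assumes X: "sq_integrable X" shows "sq_integrable (\<lambda>\<omega>. c *\<^sub>R X \<omega>)"
  using X by (auto simp: sq_integrable_def power_mult_distrib)

lemma sq_integrable_diff:
  assumes X: "sq_integrable X" and Y: "sq_integrable Y"
  shows "sq_integrable (\<lambda>\<omega>. X \<omega> - Y \<omega>)"
  using sq_integrable_add[OF X sq_integrable_scaleR[OF Y, of "-1"]] by simp

lemma sq_integrable_inner:
  assumes X: "sq_integrable X" and Y: "sq_integrable Y"
  shows "integrable M (\<lambda>\<omega>. X \<omega> \<bullet> Y \<omega>)"
proof (rule Bochner_Integration.integrable_bound[where f="\<lambda>\<omega>. (norm (X \<omega>))\<^sup>2 + (norm (Y \<omega>))\<^sup>2"])
  show "AE \<omega> in M. norm (X \<omega> \<bullet> Y \<omega>) \<le> norm ((norm (X \<omega>))\<^sup>2 + (norm (Y \<omega>))\<^sup>2)"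
  proof (rule AE_I2)
    fix \<omega>
    have "\<bar>X \<omega> \<bullet> Y \<omega>\<bar> \<le> norm (X \<omega>) * norm (Y \<omega>)" by (rule Cauchy_Schwarz_ineq2)
    also have "\<dots> \<le> (norm (X \<omega>))\<^sup>2 + (norm (Y \<omega>))\<^sup>2"
      using sum_squares_bound[of "norm (X \<omega>)" "norm (Y \<omega>)"] mult_nonneg_nonneg[of "norm (X \<omega>)" "norm (Y \<omega>)"]
      by (simp del: mult_nonneg_nonneg)
    finally show "norm (X \<omega> \<bullet> Y \<omega>) \<le> norm ((norm (X \<omega>))\<^sup>2 + (norm (Y \<omega>))\<^sup>2)" by simp
  qed
qed (use X Y in \<open>auto simp: sq_integrable_def intro: borel_measurable_inner\<close>)

lemma sq_mean_add_le:
  assumes X: "sq_integrable X" and Y: "sq_integrable Y"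
  shows "sq_mean (\<lambda>\<omega>. X \<omega> + Y \<omega>)
    \<le> 2 * sq_mean X + 2 * sq_mean Y"
proof -
  have "sq_mean (\<lambda>\<omega>. X \<omega> + Y \<omega>) \<le> expectation (\<lambda>\<omega>. 2 * (norm (X \<omega>))\<^sup>2 + 2 * (norm (Y \<omega>))\<^sup>2)"
    by (rule integral_mono)
       (use X Y sq_integrable_add[OF X Y] in \<open>auto simp: sq_integrable_def intro: norm_add_sq_le\<close>)
  then show ?thesis using X Y by (simp add: sq_integrable_def)
qed

lemma sq_mean_diff_le:
  assumes X: "sq_integrable X" and Y: "sq_integrable Y"
  shows "sq_mean (\<lambda>\<omega>. X \<omega> - Y \<omega>)
    \<le> 2 * sq_mean X + 2 * sq_mean Y"
  using sq_mean_add_le[OF X sq_integrable_scaleR[OF Y, of "-1"]] by simp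

end

section \<open>The filtration of the samples and fresh samples\<close>

locale sampling = prob_space M for M :: "'w measure" +
  fixes P :: "'x measure" and \<xi> :: "nat \<Rightarrow> 'w \<Rightarrow> 'x"
  assumes P: "prob_space P"
    and indep: "indep_vars (\<lambda>_. P) \<xi> {1..}"
    and ident: "\<And>t. t \<ge> 1 \<Longrightarrow> distr M P (\<xi> t) = P"
begin

sublocale P: prob_space P by (rule P)

lemma \<xi>_rv: "t \<ge> 1 \<Longrightarrow> random_variable P (\<xi> t)"
  using indep unfolding indep_vars_def2 by auto

text \<open>Encoded by preimages under the vector of samples, so that every event of the past is
  literally an event about this vector and independence of the next sample can be applied to
  it.\<close>

definition past :: "nat \<Rightarrow> 'w measure" where
  "past t = vimage_algebra (space M) (\<lambda>\<omega>. \<lambda>i\<in>{1..t}. \<xi> i \<omega>) (\<Pi>\<^sub>M i\<in>{1..t}. P)"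

lemma space_past[simp]: "space (past t) = space M"
  by (simp add: past_def)

lemma history_rv: "random_variable (\<Pi>\<^sub>M i\<in>{1..t}. P) (\<lambda>\<omega>. \<lambda>i\<in>{1..t}. \<xi> i \<omega>)"
  by (intro measurable_restrict \<xi>_rv) simp

lemma sets_past: "sets (past t) = {(\<lambda>\<omega>. \<lambda>i\<in>{1..t}. \<xi> i \<omega>) -` A \<inter> space M | A. A \<in> sets (\<Pi>\<^sub>M i\<in>{1..t}. P)}"
  unfolding past_def by (rule sets_vimage_algebra2) (rule measurable_space[OF history_rv, THEN funcsetI])

lemma past_history: "(\<lambda>\<omega>. \<lambda>i\<in>{1..t}. \<xi> i \<omega>) \<in> measurable (past t) (\<Pi>\<^sub>M i\<in>{1..t}. P)"
  unfolding past_def by (rule measurable_vimage_algebra1) (rule measurable_space[OF history_rv, THEN funcsetI])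

lemma past_sample:
  assumes "1 \<le> i" "i \<le> t"
  shows "\<xi> i \<in> measurable (past t) P"
proof -
  have "(\<lambda>\<omega>. (\<lambda>i\<in>{1..t}. \<xi> i \<omega>) i) \<in> measurable (past t) P"
    by (rule measurable_compose[OF past_history measurable_component_singleton]) (use assms in auto)
  then show ?thesis using assms by simp
qed

lemma sets_past_mono: "s \<le> t \<Longrightarrow> sets (past s) \<subseteq> sets (past t)"
proof
  fix B assume st: "s \<le> t" and "B \<in> sets (past s)"
  then obtain A where A: "A \<in> sets (\<Pi>\<^sub>M i\<in>{1..s}. P)" "B = (\<lambda>\<omega>. \<lambda>i\<in>{1..s}. \<xi> i \<omega>) -` A \<inter> space M"
    by (auto simp: sets_past)
  have "(\<lambda>\<omega>. \<lambda>i\<in>{1..s}. \<xi> i \<omega>) \<in> measurable (past t) (\<Pi>\<^sub>M i\<in>{1..s}. P)"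
    using st by (intro measurable_restrict past_sample) auto
  from measurable_sets[OF this A(1)] show "B \<in> sets (past t)" by (simp add: A(2))
qed

lemma past_mono: "X \<in> measurable (past s) N \<Longrightarrow> s \<le> t \<Longrightarrow> X \<in> measurable (past t) N"
  using sets_past_mono[of s t] by (auto simp: measurable_def)

lemma past_random_variable: "X \<in> measurable (past t) N \<Longrightarrow> random_variable N X"
proof -
  have "sets (past t) \<subseteq> sets M"
    using measurable_sets[OF history_rv] by (auto simp: sets_past)
  then show "random_variable N X" if "X \<in> measurable (past t) N"
    using that by (auto simp: measurable_def)
qed

text \<open>An event about \<open>X\<close> is one about the first \<open>t\<close> samples, and
  these are independent of the next one; comparing rectangles suffices. Conditioning on the past
  thereby becomes Fubini's theorem for a product law, which takes the place of conditional
  expectations throughout.\<close>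

lemma past_joint_distr:
  assumes X: "X \<in> measurable (past t) N"
  shows "distr M (N \<Otimes>\<^sub>M P) (\<lambda>\<omega>. (X \<omega>, \<xi> (Suc t) \<omega>)) = distr M N X \<Otimes>\<^sub>M P"
proof -
  note [measurable] = past_random_variable[OF X] \<xi>_rv[of "Suc t", simplified]
  interpret X: prob_space "distr M N X" by (rule prob_space_distr) simp
  let ?h = "\<lambda>\<omega>. \<lambda>i\<in>{1..t}. \<xi> i \<omega>" and ?f = "\<lambda>\<omega>. \<lambda>i\<in>{Suc t}. \<xi> i \<omega>"
  have ind: "indep_var (\<Pi>\<^sub>M i\<in>{1..t}. P) ?h (\<Pi>\<^sub>M i\<in>{Suc t}. P) ?f"
    by (rule indep_var_restrict[OF indep]) auto
  have "distr M N X \<Otimes>\<^sub>M P = distr M (N \<Otimes>\<^sub>M P) (\<lambda>\<omega>. (X \<omega>, \<xi> (Suc t) \<omega>))"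
  proof (rule pair_measure_eqI[OF X.sigma_finite_measure_axioms P.sigma_finite_measure_axioms])
    show "sets (distr M N X \<Otimes>\<^sub>M P) = sets (distr M (N \<Otimes>\<^sub>M P) (\<lambda>\<omega>. (X \<omega>, \<xi> (Suc t) \<omega>)))"
      using sets_pair_measure_cong[of "distr M N X" N P P] by simp
  next
    fix A B assume A: "A \<in> sets (distr M N X)" and B: "B \<in> sets P"
    obtain A' where A': "A' \<in> sets (\<Pi>\<^sub>M i\<in>{1..t}. P)" "X -` A \<inter> space M = ?h -` A' \<inter> space M"
      using measurable_sets[OF X, of A] A by (auto simp: sets_past)
    define B' where "B' = (\<lambda>h. h (Suc t)) -` B \<inter> space (\<Pi>\<^sub>M i\<in>{Suc t}. P)"
    have B': "B' \<in> sets (\<Pi>\<^sub>M i\<in>{Suc t}. P)"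
      unfolding B'_def using B by (intro measurable_sets[OF measurable_component_singleton]) auto
    have eqB: "?f -` B' \<inter> space M = \<xi> (Suc t) -` B \<inter> space M"
      using measurable_space[OF \<xi>_rv[of "Suc t"]] by (auto simp: B'_def space_PiM PiE_def extensional_def)
    have "emeasure P B = emeasure (distr M P (\<xi> (Suc t))) B" using ident[of "Suc t"] by simp
    also have "\<dots> = prob (\<xi> (Suc t) -` B \<inter> space M)"
      using B by (subst emeasure_distr) (auto simp: emeasure_eq_measure)
    finally have PB: "emeasure P B = prob (\<xi> (Suc t) -` B \<inter> space M)" .
    have "emeasure (distr M (N \<Otimes>\<^sub>M P) (\<lambda>\<omega>. (X \<omega>, \<xi> (Suc t) \<omega>))) (A \<times> B)
      = prob ((X -` A \<inter> space M) \<inter> (\<xi> (Suc t) -` B \<inter> space M))"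
      using A B by (subst emeasure_distr) (auto simp: emeasure_eq_measure intro!: arg_cong[where f=prob])
    also have "\<dots> = prob ((\<lambda>\<omega>. (?h \<omega>, ?f \<omega>)) -` (A' \<times> B') \<inter> space M)"
      unfolding A'(2) eqB[symmetric] by (intro arg_cong[where f="\<lambda>S. ennreal (prob S)"]) auto
    also have "\<dots> = prob (?h -` A' \<inter> space M) * prob (?f -` B' \<inter> space M)"
      unfolding indep_varD[OF ind A'(1) B'] by simp
    also have "\<dots> = emeasure (distr M N X) A * emeasure P B"
      unfolding PB eqB A'(2)[symmetric] using A by (subst emeasure_distr) (auto simp: emeasure_eq_measure ennreal_mult)
    finally show "emeasure (distr M N X) A * emeasure P B
      = emeasure (distr M (N \<Otimes>\<^sub>M P) (\<lambda>\<omega>. (X \<omega>, \<xi> (Suc t) \<omega>))) (A \<times> B)" by simp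
  qed
  then show ?thesis by simp
qed

text \<open>The fresh sample is averaged first, at a frozen past. Working with nonnegative integrals
  lets integrability come out of the bound itself.\<close>

lemma fresh_sq_mean:
  fixes \<nu> :: "'n \<times> 'x \<Rightarrow> 'a::euclidean_space"
  assumes Y: "Y \<in> measurable (past t) N"
    and \<nu>[measurable]: "\<nu> \<in> borel_measurable (N \<Otimes>\<^sub>M P)"
    and int: "\<And>y. y \<in> space N \<Longrightarrow> integrable P (\<lambda>x. (norm (\<nu> (y, x)))\<^sup>2)"
    and le: "\<And>y. y \<in> space N \<Longrightarrow> (\<integral>x. (norm (\<nu> (y, x)))\<^sup>2 \<partial>P) \<le> \<psi> y"
    and \<psi>: "integrable M (\<lambda>\<omega>. \<psi> (Y \<omega>))"
  shows "sq_integrable (\<lambda>\<omega>. \<nu> (Y \<omega>, \<xi> (Suc t) \<omega>))"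
    and "sq_mean (\<lambda>\<omega>. \<nu> (Y \<omega>, \<xi> (Suc t) \<omega>)) \<le> expectation (\<lambda>\<omega>. \<psi> (Y \<omega>))"
proof -
  note [measurable] = past_random_variable[OF Y] \<xi>_rv[of "Suc t", simplified]
  interpret Y: prob_space "distr M N Y" by (rule prob_space_distr) simp
  have \<psi>_nonneg: "\<psi> (Y \<omega>) \<ge> 0" if "\<omega> \<in> space M" for \<omega>
    by (rule order_trans[OF _ le]) (use that measurable_space[OF past_random_variable[OF Y]] in auto)
  have "(\<integral>\<^sup>+\<omega>. ennreal ((norm (\<nu> (Y \<omega>, \<xi> (Suc t) \<omega>)))\<^sup>2) \<partial>M)
    = (\<integral>\<^sup>+z. ennreal ((norm (\<nu> z))\<^sup>2) \<partial>distr M (N \<Otimes>\<^sub>M P) (\<lambda>\<omega>. (Y \<omega>, \<xi> (Suc t) \<omega>)))"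
    by (subst nn_integral_distr) auto
  also have "\<dots> = (\<integral>\<^sup>+y. (\<integral>\<^sup>+x. ennreal ((norm (\<nu> (y, x)))\<^sup>2) \<partial>P) \<partial>distr M N Y)"
    unfolding past_joint_distr[OF Y] by (subst P.nn_integral_fst[symmetric]) auto
  also have "\<dots> = (\<integral>\<^sup>+\<omega>. (\<integral>\<^sup>+x. ennreal ((norm (\<nu> (Y \<omega>, x)))\<^sup>2) \<partial>P) \<partial>M)"
    by (subst nn_integral_distr) auto
  also have "\<dots> \<le> (\<integral>\<^sup>+\<omega>. ennreal (\<psi> (Y \<omega>)) \<partial>M)"
  proof (rule nn_integral_mono)
    fix \<omega> assume "\<omega> \<in> space M"
    then have "Y \<omega> \<in> space N" using measurable_space[OF past_random_variable[OF Y]] by auto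
    then show "(\<integral>\<^sup>+x. ennreal ((norm (\<nu> (Y \<omega>, x)))\<^sup>2) \<partial>P) \<le> ennreal (\<psi> (Y \<omega>))"
      by (subst nn_integral_eq_integral[OF int]) (auto intro!: ennreal_leI le)
  qed
  also have "\<dots> = ennreal (expectation (\<lambda>\<omega>. \<psi> (Y \<omega>)))"
    by (rule nn_integral_eq_integral[OF \<psi>]) (use \<psi>_nonneg in auto)
  finally have fin: "(\<integral>\<^sup>+\<omega>. ennreal ((norm (\<nu> (Y \<omega>, \<xi> (Suc t) \<omega>)))\<^sup>2) \<partial>M) \<le> ennreal (expectation (\<lambda>\<omega>. \<psi> (Y \<omega>)))" .
  have I: "integrable M (\<lambda>\<omega>. (norm (\<nu> (Y \<omega>, \<xi> (Suc t) \<omega>)))\<^sup>2)"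
    by (rule integrableI_nonneg) (use fin in \<open>auto simp: less_top[symmetric] top_unique\<close>)
  then show "sq_integrable (\<lambda>\<omega>. \<nu> (Y \<omega>, \<xi> (Suc t) \<omega>))" by (auto simp: sq_integrable_def)
  have "expectation (\<lambda>\<omega>. \<psi> (Y \<omega>)) \<ge> 0" using \<psi>_nonneg by (intro integral_nonneg_AE) auto
  then show "sq_mean (\<lambda>\<omega>. \<nu> (Y \<omega>, \<xi> (Suc t) \<omega>)) \<le> expectation (\<lambda>\<omega>. \<psi> (Y \<omega>))"
    using fin by (simp add: nn_integral_eq_integral[OF I] ennreal_le_iff)
qed

text \<open>For every frozen past the second summand has mean zero, so the cross term vanishes;
  \<open>X\<close> is paired with \<open>Y\<close> so that both are frozen together.\<close>

lemma fresh_orthogonal: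
  fixes \<nu> :: "'n \<times> 'x \<Rightarrow> 'a::euclidean_space"
  assumes Y: "Y \<in> measurable (past t) N" and X: "X \<in> borel_measurable (past t)"
    and \<nu>[measurable]: "\<nu> \<in> borel_measurable (N \<Otimes>\<^sub>M P)"
    and int: "\<And>y. y \<in> space N \<Longrightarrow> integrable P (\<lambda>x. \<nu> (y, x))"
    and zero: "\<And>y. y \<in> space N \<Longrightarrow> (\<integral>x. \<nu> (y, x) \<partial>P) = 0"
    and sqX: "sq_integrable X" and sq: "sq_integrable (\<lambda>\<omega>. \<nu> (Y \<omega>, \<xi> (Suc t) \<omega>))"
  shows "sq_mean (\<lambda>\<omega>. X \<omega> + \<nu> (Y \<omega>, \<xi> (Suc t) \<omega>))
    = sq_mean X + sq_mean (\<lambda>\<omega>. \<nu> (Y \<omega>, \<xi> (Suc t) \<omega>))"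
proof -
  let ?Z = "\<lambda>\<omega>. (X \<omega>, Y \<omega>)" and ?N = "borel \<Otimes>\<^sub>M N"
  let ?\<phi> = "\<lambda>z x. fst z \<bullet> \<nu> (snd z, x)"
  have Z: "?Z \<in> measurable (past t) ?N" using X Y by (rule measurable_Pair)
  note [measurable] = past_random_variable[OF Z] \<xi>_rv[of "Suc t", simplified]
  interpret Z: prob_space "distr M ?N ?Z" by (rule prob_space_distr) simp
  interpret ZP: pair_sigma_finite "distr M ?N ?Z" P ..
  have I: "integrable M (\<lambda>\<omega>. X \<omega> \<bullet> \<nu> (Y \<omega>, \<xi> (Suc t) \<omega>))"
    by (rule sq_integrable_inner[OF sqX sq])
  have I': "integrable (distr M ?N ?Z \<Otimes>\<^sub>M P) (\<lambda>(z, x). ?\<phi> z x)"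
    unfolding past_joint_distr[OF Z, symmetric] by (subst integrable_distr_eq) (use I in auto)
  have "expectation (\<lambda>\<omega>. X \<omega> \<bullet> \<nu> (Y \<omega>, \<xi> (Suc t) \<omega>))
    = (\<integral>(z, x). ?\<phi> z x \<partial>distr M (?N \<Otimes>\<^sub>M P) (\<lambda>\<omega>. (?Z \<omega>, \<xi> (Suc t) \<omega>)))"
    by (subst integral_distr) auto
  also have "\<dots> = (\<integral>z. (\<integral>x. ?\<phi> z x \<partial>P) \<partial>distr M ?N ?Z)"
    unfolding past_joint_distr[OF Z] by (rule ZP.integral_fst[OF I', symmetric])
  also have "\<dots> = (\<integral>z. 0 \<partial>distr M ?N ?Z)"
  proof (rule Bochner_Integration.integral_cong[OF refl])
    fix z assume "z \<in> space (distr M ?N ?Z)"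
    then have "snd z \<in> space N" by (auto simp: space_pair_measure)
    then show "(\<integral>x. ?\<phi> z x \<partial>P) = 0" using int zero by (subst integral_inner_right) auto
  qed
  finally have 0: "expectation (\<lambda>\<omega>. X \<omega> \<bullet> \<nu> (Y \<omega>, \<xi> (Suc t) \<omega>)) = 0" by simp
  have "sq_mean (\<lambda>\<omega>. X \<omega> + \<nu> (Y \<omega>, \<xi> (Suc t) \<omega>))
    = expectation (\<lambda>\<omega>. (norm (X \<omega>))\<^sup>2 + 2 * (X \<omega> \<bullet> \<nu> (Y \<omega>, \<xi> (Suc t) \<omega>)) + (norm (\<nu> (Y \<omega>, \<xi> (Suc t) \<omega>)))\<^sup>2)"
    by (simp add: power2_norm_eq_inner inner_add_left inner_add_right inner_commute algebra_simps)
  also have "\<dots> = sq_mean X + 2 * expectation (\<lambda>\<omega>. X \<omega> \<bullet> \<nu> (Y \<omega>, \<xi> (Suc t) \<omega>))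
     + sq_mean (\<lambda>\<omega>. \<nu> (Y \<omega>, \<xi> (Suc t) \<omega>))"
    using I sqX sq by (simp add: sq_integrable_def)
  finally show ?thesis by (simp add: 0)
qed

end

section \<open>One epoch of ROOT-SGD\<close>

locale noisy_gradient = sampling M P \<xi>
  for M :: "'w measure" and P :: "'x measure" and \<xi> :: "nat \<Rightarrow> 'w \<Rightarrow> 'x" +
  fixes g :: "'a::euclidean_space \<Rightarrow> 'x \<Rightarrow> 'a" and G :: "'a \<Rightarrow> 'a" and \<theta>s :: 'a
    and \<mu> L l S :: real
  assumes g_meas: "(\<lambda>(\<theta>, x). g \<theta> x) \<in> borel_measurable (borel \<Otimes>\<^sub>M P)"
    and g_int: "\<And>\<theta>. integrable P (g \<theta>)"
    and g_mean: "\<And>\<theta>. (\<integral>x. g \<theta> x \<partial>P) = G \<theta>"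
    and \<mu>_pos: "0 < \<mu>" and \<mu>_le: "\<mu> \<le> L"
    and G_lip: "\<And>\<theta> \<theta>'. norm (G \<theta> - G \<theta>') \<le> L * norm (\<theta> - \<theta>')"
    and G_mono: "\<And>\<theta> \<theta>'. (G \<theta> - G \<theta>') \<bullet> (\<theta> - \<theta>') \<ge> \<mu> * (norm (\<theta> - \<theta>'))\<^sup>2"
    and G_root: "G \<theta>s = 0"
    and noise_int: "\<And>\<theta> \<theta>'. integrable P (\<lambda>x. (norm ((g \<theta> x - G \<theta>) - (g \<theta>' x - G \<theta>')))\<^sup>2)"
    and noise_lip: "\<And>\<theta> \<theta>'. (\<integral>x. (norm ((g \<theta> x - G \<theta>) - (g \<theta>' x - G \<theta>')))\<^sup>2 \<partial>P) \<le> l\<^sup>2 * (norm (\<theta> - \<theta>'))\<^sup>2"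
    and star_int: "integrable P (\<lambda>x. (norm (g \<theta>s x))\<^sup>2)"
    and star_le: "(\<integral>x. (norm (g \<theta>s x))\<^sup>2 \<partial>P) \<le> S"
begin

definition eps :: "'a \<Rightarrow> 'x \<Rightarrow> 'a" where
  "eps \<theta> x = g \<theta> x - G \<theta>"

lemma eps_star: "eps \<theta>s x = g \<theta>s x"
  by (simp add: eps_def G_root)

lemma L_pos: "L > 0" using \<mu>_pos \<mu>_le by simp

lemma S_nonneg: "S \<ge> 0"
  by (rule order_trans[OF _ star_le]) simp

lemma G_measurable[measurable]: "G \<in> borel_measurable borel"
proof (rule borel_measurable_continuous_onI)
  have "L-lipschitz_on UNIV G"
    using G_lip L_pos by (intro lipschitz_onI) (auto simp: dist_norm)
  then show "continuous_on UNIV G" by (rule lipschitz_on_continuous_on)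
qed

lemma g_measurable[measurable (raw)]:
  assumes "f \<in> borel_measurable N" "h \<in> measurable N P"
  shows "(\<lambda>z. g (f z) (h z)) \<in> borel_measurable N"
  using measurable_compose[OF measurable_Pair[OF assms] g_meas] by simp

lemma eps_measurable[measurable (raw)]:
  assumes [measurable]: "f \<in> borel_measurable N" "h \<in> measurable N P"
  shows "(\<lambda>z. eps (f z) (h z)) \<in> borel_measurable N"
  unfolding eps_def by measurable

lemma eps_integrable: "integrable P (eps \<theta>)"
  unfolding eps_def using g_int by simp

lemma eps_mean: "(\<integral>x. eps \<theta> x \<partial>P) = 0"
  unfolding eps_def using g_int by (simp add: g_mean P.prob_space)

text \<open>Cauchy-Schwarz applied to strong monotonicity. Through \<open>dist_root_le\<close> the
  gradient then controls the distance to the root, so that the recursions can be run in gradients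
  alone.\<close>

lemma G_lower: "\<mu> * norm (\<theta> - \<theta>') \<le> norm (G \<theta> - G \<theta>')"
proof (cases "\<theta> = \<theta>'")
  case False
  then have pos: "norm (\<theta> - \<theta>') > 0" by simp
  have "\<mu> * (norm (\<theta> - \<theta>'))\<^sup>2 \<le> norm (G \<theta> - G \<theta>') * norm (\<theta> - \<theta>')"
    by (rule order_trans[OF G_mono norm_cauchy_schwarz])
  then show ?thesis using pos by (simp add: power2_eq_square mult.assoc[symmetric])
qed simp

lemma dist_root_le: "norm (\<theta> - \<theta>s) \<le> norm (G \<theta>) / \<mu>"
  using G_lower[of \<theta> \<theta>s] \<mu>_pos by (simp add: G_root field_simps)

lemma dist_root_sq_le: "(norm (\<theta> - \<theta>s))\<^sup>2 \<le> (norm (G \<theta>))\<^sup>2 / \<mu>\<^sup>2"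
  using power_mono[OF dist_root_le[of \<theta>], of 2] by (simp add: power_divide)

text \<open>The scale \<open>r\<close> is there because the step is applied to \<open>u = t v\<^sub>t\<close>.\<close>

lemma gradient_step_contracts:
  assumes r: "r > 0" and \<eta>: "\<eta> > 0" "\<eta> * L\<^sup>2 \<le> \<mu>"
  shows "(norm (u + r *\<^sub>R (G (\<theta> - (\<eta> / r) *\<^sub>R u) - G \<theta>)))\<^sup>2 \<le> (1 - \<eta> * \<mu>) * (norm u)\<^sup>2"
proof -
  define X where "X = G (\<theta> - (\<eta> / r) *\<^sub>R u) - G \<theta>"
  define D where "D = r *\<^sub>R X"
  have "norm X \<le> L * ((\<eta> / r) * norm u)"
    using G_lip[of "\<theta> - (\<eta> / r) *\<^sub>R u" \<theta>] r \<eta> by (simp add: X_def)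
  then have "r * norm X \<le> r * (L * ((\<eta> / r) * norm u))"
    using r by (intro mult_left_mono) auto
  then have "norm D \<le> L * \<eta> * norm u" using r by (simp add: D_def)
  then have "(norm D)\<^sup>2 \<le> (L * \<eta> * norm u)\<^sup>2" by (rule power_mono) simp
  also have "\<dots> = \<eta> * (\<eta> * L\<^sup>2) * (norm u)\<^sup>2" by (simp add: power2_eq_square)
  also have "\<dots> \<le> \<eta> * \<mu> * (norm u)\<^sup>2" using \<eta> by (intro mult_right_mono mult_left_mono) auto
  finally have D2: "(norm D)\<^sup>2 \<le> \<eta> * \<mu> * (norm u)\<^sup>2" .
  have "\<mu> * (norm ((\<eta> / r) *\<^sub>R u))\<^sup>2 \<le> X \<bullet> (- (\<eta> / r) *\<^sub>R u)"
    using G_mono[of "\<theta> - (\<eta> / r) *\<^sub>R u" \<theta>] by (simp add: X_def)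
  then have "(r * r / \<eta>) * (\<mu> * (norm ((\<eta> / r) *\<^sub>R u))\<^sup>2) \<le> (r * r / \<eta>) * (X \<bullet> (- (\<eta> / r) *\<^sub>R u))"
    using r \<eta> by (intro mult_left_mono) auto
  then have "\<eta> * \<mu> * (norm u)\<^sup>2 \<le> - (D \<bullet> u)"
    using r \<eta> by (simp add: D_def power2_eq_square field_simps)
  then have "u \<bullet> D \<le> - \<eta> * \<mu> * (norm u)\<^sup>2" by (simp add: inner_commute)
  moreover have "(norm (u + D))\<^sup>2 = (norm u)\<^sup>2 + 2 * (u \<bullet> D) + (norm D)\<^sup>2"
    by (simp add: power2_norm_eq_inner inner_add_left inner_add_right inner_commute)
  ultimately show ?thesis using D2 by (simp add: D_def[symmetric] X_def[symmetric] algebra_simps)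
qed

text \<open>With \<open>y\<close> the current and the previous iterate and \<open>k = t + 1\<close>,
  this is the martingale increment. Relative to the noise at the root it equals
  \<open>eps b x - eps \<theta>s x\<close> plus \<open>k\<close> times
  \<open>eps a x - eps b x\<close>. The Lipschitz bound on both pieces gives \<rho>: a distance to
  the root and a move weighted by \<open>k\<^sup>2\<close>.\<close>

lemma noise_increment:
  fixes k :: real
  defines "\<nu> \<equiv> \<lambda>z. k *\<^sub>R eps (fst (fst z)) (snd z) - (k - 1) *\<^sub>R eps (snd (fst z)) (snd z)"
  defines "\<rho> \<equiv> \<lambda>y. (norm (snd y - \<theta>s))\<^sup>2 + k\<^sup>2 * (norm (fst y - snd y))\<^sup>2"
  shows "\<nu> \<in> borel_measurable ((borel \<Otimes>\<^sub>M borel) \<Otimes>\<^sub>M P)"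
    and "integrable P (\<lambda>x. \<nu> (y, x))" and "(\<integral>x. \<nu> (y, x) \<partial>P) = 0"
    and "integrable P (\<lambda>x. (norm (\<nu> (y, x)))\<^sup>2)"
    and "(\<integral>x. (norm (\<nu> (y, x)))\<^sup>2 \<partial>P) \<le> 2 * S + 4 * l\<^sup>2 * \<rho> y"
    and "integrable P (\<lambda>x. (norm (\<nu> (y, x) - eps \<theta>s x))\<^sup>2)"
    and "(\<integral>x. (norm (\<nu> (y, x) - eps \<theta>s x))\<^sup>2 \<partial>P) \<le> 2 * l\<^sup>2 * \<rho> y"
proof -
  show [measurable]: "\<nu> \<in> borel_measurable ((borel \<Otimes>\<^sub>M borel) \<Otimes>\<^sub>M P)"
    unfolding \<nu>_def by measurable
  obtain a b where y: "y = (a, b)" by force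
  show "integrable P (\<lambda>x. \<nu> (y, x))" using eps_integrable by (simp add: \<nu>_def y)
  show "(\<integral>x. \<nu> (y, x) \<partial>P) = 0"
    using eps_integrable by (simp add: \<nu>_def y eps_mean)
  have sq: "integrable P (\<lambda>x. (norm (eps \<theta> x - eps \<theta>' x))\<^sup>2)"
    "(\<integral>x. (norm (eps \<theta> x - eps \<theta>' x))\<^sup>2 \<partial>P) \<le> l\<^sup>2 * (norm (\<theta> - \<theta>'))\<^sup>2" for \<theta> \<theta>'
    using noise_int noise_lip by (auto simp: eps_def)
  have bound1: "(norm (\<nu> (y, x) - eps \<theta>s x))\<^sup>2
      \<le> 2 * (norm (eps b x - eps \<theta>s x))\<^sup>2 + 2 * k\<^sup>2 * (norm (eps a x - eps b x))\<^sup>2" for x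
  proof -
    have "\<nu> (y, x) - eps \<theta>s x = (eps b x - eps \<theta>s x) + k *\<^sub>R (eps a x - eps b x)"
      by (simp add: \<nu>_def y algebra_simps)
    then show ?thesis using norm_add_sq_le[of "eps b x - eps \<theta>s x" "k *\<^sub>R (eps a x - eps b x)"]
      by (simp only: power_mult_distrib norm_scaleR power2_abs mult.assoc)
  qed
  have [measurable]: "(\<lambda>x. \<nu> (y, x)) \<in> borel_measurable P" "eps \<theta>s \<in> borel_measurable P"
    using \<open>integrable P (\<lambda>x. \<nu> (y, x))\<close> eps_integrable by auto
  show int1: "integrable P (\<lambda>x. (norm (\<nu> (y, x) - eps \<theta>s x))\<^sup>2)"
    by (rule Bochner_Integration.integrable_bound[where f="\<lambda>x. 2 * (norm (eps b x - eps \<theta>s x))\<^sup>2 + 2 * k\<^sup>2 * (norm (eps a x - eps b x))\<^sup>2"])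
       (use sq(1) bound1 in auto)
  have "(\<integral>x. (norm (\<nu> (y, x) - eps \<theta>s x))\<^sup>2 \<partial>P)
      \<le> (\<integral>x. 2 * (norm (eps b x - eps \<theta>s x))\<^sup>2 + 2 * k\<^sup>2 * (norm (eps a x - eps b x))\<^sup>2 \<partial>P)"
    by (rule integral_mono[OF int1 _ bound1]) (use sq(1) in auto)
  also have "\<dots> = 2 * (\<integral>x. (norm (eps b x - eps \<theta>s x))\<^sup>2 \<partial>P) + 2 * k\<^sup>2 * (\<integral>x. (norm (eps a x - eps b x))\<^sup>2 \<partial>P)"
    using sq(1) by simp
  also have "\<dots> \<le> 2 * (l\<^sup>2 * (norm (b - \<theta>s))\<^sup>2) + 2 * k\<^sup>2 * (l\<^sup>2 * (norm (a - b))\<^sup>2)"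
    by (intro add_mono mult_left_mono sq(2)) auto
  finally show le1: "(\<integral>x. (norm (\<nu> (y, x) - eps \<theta>s x))\<^sup>2 \<partial>P) \<le> 2 * l\<^sup>2 * \<rho> y"
    by (simp add: \<rho>_def y algebra_simps)
  have bound2: "(norm (\<nu> (y, x)))\<^sup>2 \<le> 2 * (norm (eps \<theta>s x))\<^sup>2 + 2 * (norm (\<nu> (y, x) - eps \<theta>s x))\<^sup>2" for x
    using norm_add_sq_le[of "eps \<theta>s x" "\<nu> (y, x) - eps \<theta>s x"] by simp
  have star: "integrable P (\<lambda>x. (norm (eps \<theta>s x))\<^sup>2)" using star_int by (simp add: eps_star)
  show int2: "integrable P (\<lambda>x. (norm (\<nu> (y, x)))\<^sup>2)"
    by (rule Bochner_Integration.integrable_bound[where f="\<lambda>x. 2 * (norm (eps \<theta>s x))\<^sup>2 + 2 * (norm (\<nu> (y, x) - eps \<theta>s x))\<^sup>2"])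
       (use star int1 bound2 in auto)
  have "(\<integral>x. (norm (\<nu> (y, x)))\<^sup>2 \<partial>P) \<le> (\<integral>x. 2 * (norm (eps \<theta>s x))\<^sup>2 + 2 * (norm (\<nu> (y, x) - eps \<theta>s x))\<^sup>2 \<partial>P)"
    by (rule integral_mono[OF int2 _ bound2]) (use star int1 in auto)
  also have "\<dots> = 2 * (\<integral>x. (norm (g \<theta>s x))\<^sup>2 \<partial>P) + 2 * (\<integral>x. (norm (\<nu> (y, x) - eps \<theta>s x))\<^sup>2 \<partial>P)"
    using star int1 by (simp add: eps_star)
  also have "\<dots> \<le> 2 * S + 2 * (2 * l\<^sup>2 * \<rho> y)"
    by (intro add_mono mult_left_mono star_le le1) auto
  finally show "(\<integral>x. (norm (\<nu> (y, x)))\<^sup>2 \<partial>P) \<le> 2 * S + 4 * l\<^sup>2 * \<rho> y" by simp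
qed

lemma sq_integrable_G:
  assumes "sq_integrable X" shows "sq_integrable (\<lambda>\<omega>. G (X \<omega>))"
proof (rule sq_integrable_bound)
  show "random_variable borel (\<lambda>\<omega>. G (X \<omega>))" using assms by (auto simp: sq_integrable_def)
  have "sq_integrable (\<lambda>\<omega>. X \<omega> - \<theta>s)" using assms sq_integrable_const by (rule sq_integrable_diff)
  then show "integrable M (\<lambda>\<omega>. L\<^sup>2 * (norm (X \<omega> - \<theta>s))\<^sup>2)" by (auto simp: sq_integrable_def)
  show "(norm (G (X \<omega>)))\<^sup>2 \<le> L\<^sup>2 * (norm (X \<omega> - \<theta>s))\<^sup>2" for \<omega>
    using power_mono[OF G_lip[of "X \<omega>" \<theta>s], of 2] by (simp add: G_root power_mult_distrib)
qed

end

text \<open>One epoch started at \<open>x0\<close>, on the samples after the first \<open>c\<close>. The martingale is \<open>m t = t z\<^sub>t\<close>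
  with \<open>z\<^sub>t = v\<^sub>t - G (\<theta>\<^sub>t\<^sub>-\<^sub>1)\<close>, and \<open>u t = t v\<^sub>t\<close>.\<close>

locale sgd_epoch = noisy_gradient M P \<xi> g G \<theta>s \<mu> L l S
  for M :: "'w measure" and P :: "'x measure" and \<xi> :: "nat \<Rightarrow> 'w \<Rightarrow> 'x"
    and g :: "'a::euclidean_space \<Rightarrow> 'x \<Rightarrow> 'a" and G :: "'a \<Rightarrow> 'a" and \<theta>s :: 'a
    and \<mu> L l S :: real +
  fixes c :: nat and x0 :: "'w \<Rightarrow> 'a" and \<eta> :: real and T0 :: nat
  assumes x0_past: "x0 \<in> borel_measurable (past c)" and x0_sq: "sq_integrable x0"
    and \<eta>_pos: "\<eta> > 0" and T0_pos: "T0 \<ge> 1"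
begin

definition th :: "nat \<Rightarrow> 'w \<Rightarrow> 'a" where
  "th t \<omega> = root_sgd g \<eta> T0 (x0 \<omega>) (\<lambda>t. \<xi> (c + t) \<omega>) t"

definition u :: "nat \<Rightarrow> 'w \<Rightarrow> 'a" where
  "u t \<omega> = real t *\<^sub>R root_sgd_v g \<eta> T0 (x0 \<omega>) (\<lambda>t. \<xi> (c + t) \<omega>) t"

definition m :: "nat \<Rightarrow> 'w \<Rightarrow> 'a" where
  "m t \<omega> = u t \<omega> - real t *\<^sub>R G (th (t - 1) \<omega>)"

text \<open>\<open>inc t\<close> leads from \<open>m t\<close> to \<open>m (Suc t)\<close>; for \<open>t = 0\<close> the truncated index \<open>t - 1\<close> is harmless because
  its coefficient vanishes.\<close>

definition inc :: "nat \<Rightarrow> 'w \<Rightarrow> 'a" where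
  "inc t \<omega> = real (Suc t) *\<^sub>R eps (th t \<omega>) (\<xi> (Suc (c + t)) \<omega>)
     - (real (Suc t) - 1) *\<^sub>R eps (th (t - 1) \<omega>) (\<xi> (Suc (c + t)) \<omega>)"

text \<open>The part of the increment that disappears when both iterates sit at the root; if it were
  zero throughout, \<open>m t\<close> would be a sum of i.i.d. gradients.\<close>

definition rem :: "nat \<Rightarrow> 'w \<Rightarrow> 'a" where
  "rem t \<omega> = inc t \<omega> - g \<theta>s (\<xi> (Suc (c + t)) \<omega>)"

lemma th_init: "t < T0 \<Longrightarrow> th t \<omega> = x0 \<omega>"
  by (simp add: th_def root_sgd.simps)

lemma th_step: "T0 \<le> t \<Longrightarrow> th t \<omega> = th (t - 1) \<omega> - (\<eta> / real t) *\<^sub>R u t \<omega>"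
  using T0_pos unfolding th_def u_def by (subst root_sgd.simps) simp

lemma u_burn_in: "t \<le> T0 \<Longrightarrow> u t \<omega> = (\<Sum>s = 1..t. g (x0 \<omega>) (\<xi> (c + s) \<omega>))"
  unfolding u_def by (subst root_sgd_v.simps) auto

lemma m_0: "m 0 \<omega> = 0"
  by (simp add: m_def u_def)

text \<open>Multiplying the recursion of the estimator by \<open>Suc t\<close> removes the fraction,
  and the old estimator enters as \<open>u t\<close>. During the burn-in both iterates are
  \<open>x0\<close>, and the two noise terms of \<open>inc\<close> merge into a single one.\<close>

lemma m_Suc: "m (Suc t) \<omega> = m t \<omega> + inc t \<omega>"
proof (cases "Suc t \<le> T0")
  case True
  then have "th t \<omega> = x0 \<omega>" "th (t - 1) \<omega> = x0 \<omega>" by (auto intro: th_init)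
  then show ?thesis
    using True by (simp add: m_def u_burn_in inc_def eps_def algebra_simps)
next
  case False
  let ?v = "root_sgd_v g \<eta> T0 (x0 \<omega>) (\<lambda>t. \<xi> (c + t) \<omega>)"
  have "?v (Suc t) = g (th t \<omega>) (\<xi> (c + Suc t) \<omega>) + (real t / real (Suc t)) *\<^sub>R (?v t - g (th (t - 1) \<omega>) (\<xi> (c + Suc t) \<omega>))"
    using False by (subst root_sgd_v.simps) (simp add: th_def)
  then have "u (Suc t) \<omega> = real (Suc t) *\<^sub>R g (th t \<omega>) (\<xi> (c + Suc t) \<omega>)
     + real t *\<^sub>R (?v t - g (th (t - 1) \<omega>) (\<xi> (c + Suc t) \<omega>))"
    unfolding u_def by (simp add: scaleR_add_right)
  then show ?thesis
    by (simp add: m_def inc_def eps_def u_def algebra_simps)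
qed

lemma u_eq: "u t \<omega> = m t \<omega> + real t *\<^sub>R G (th (t - 1) \<omega>)"
  by (simp add: m_def)

text \<open>Mean of the bound in \<open>noise_increment\<close>. The weight on the last move is
  tamed by the step length, see \<open>\<rho>_le\<close>.\<close>

definition \<rho> :: "nat \<Rightarrow> real" where
  "\<rho> t = expectation (\<lambda>\<omega>. (norm (th (t - 1) \<omega> - \<theta>s))\<^sup>2 + (real (Suc t))\<^sup>2 * (norm (th t \<omega> - th (t - 1) \<omega>))\<^sup>2)"

text \<open>Adaptedness and integrability are hypotheses here because their inductive proof in
  \<open>adapted\<close> already uses the first conclusion; afterwards they are discharged.\<close>

lemma
  assumes past: "th t \<in> borel_measurable (past (c + t))" "th (t - 1) \<in> borel_measurable (past (c + t))"
    and sq: "sq_integrable (th t)" "sq_integrable (th (t - 1))"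
  shows inc_sq': "sq_integrable (inc t)"
    and inc_le': "sq_mean (inc t) \<le> 2 * S + 4 * l\<^sup>2 * \<rho> t"
    and rem_sq': "sq_integrable (rem t)"
    and rem_le': "sq_mean (rem t) \<le> 2 * l\<^sup>2 * \<rho> t"
    and inc_orth': "\<And>X. X \<in> borel_measurable (past (c + t)) \<Longrightarrow> sq_integrable X \<Longrightarrow>
      sq_mean (\<lambda>\<omega>. X \<omega> + inc t \<omega>)
        = sq_mean X + sq_mean (inc t)"
    and rem_orth': "\<And>X. X \<in> borel_measurable (past (c + t)) \<Longrightarrow> sq_integrable X \<Longrightarrow>
      sq_mean (\<lambda>\<omega>. X \<omega> + rem t \<omega>)
        = sq_mean X
          + sq_mean (rem t)"
proof -
  let ?k = "real (Suc t)"
  let ?\<nu> = "\<lambda>z. ?k *\<^sub>R eps (fst (fst z)) (snd z) - (?k - 1) *\<^sub>R eps (snd (fst z)) (snd z)"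
  let ?\<nu>' = "\<lambda>z. ?\<nu> z - eps \<theta>s (snd z)"
  let ?\<rho> = "\<lambda>y. (norm (snd y - \<theta>s))\<^sup>2 + ?k\<^sup>2 * (norm (fst y - snd y))\<^sup>2"
  let ?Y = "\<lambda>\<omega>. (th t \<omega>, th (t - 1) \<omega>)"
  have Y: "?Y \<in> measurable (past (c + t)) (borel \<Otimes>\<^sub>M borel)" using past by (rule measurable_Pair)
  have inc: "inc t = (\<lambda>\<omega>. ?\<nu> (?Y \<omega>, \<xi> (Suc (c + t)) \<omega>))" by (simp add: inc_def fun_eq_iff)
  have rem: "rem t = (\<lambda>\<omega>. ?\<nu>' (?Y \<omega>, \<xi> (Suc (c + t)) \<omega>))"
    by (simp add: rem_def inc eps_star fun_eq_iff)
  note N = noise_increment[of ?k]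
  have [measurable]: "?\<nu>' \<in> borel_measurable ((borel \<Otimes>\<^sub>M borel) \<Otimes>\<^sub>M P)"
    using N(1) by measurable
  have I\<rho>: "integrable M (\<lambda>\<omega>. ?\<rho> (?Y \<omega>))"
    using sq_integrable_diff[OF sq(2) sq_integrable_const[of \<theta>s]] sq_integrable_diff[OF sq]
    by (simp add: sq_integrable_def)
  have E\<rho>: "expectation (\<lambda>\<omega>. ?\<rho> (?Y \<omega>)) = \<rho> t" by (simp add: \<rho>_def)
  show 1: "sq_integrable (inc t)"
    unfolding inc by (rule fresh_sq_mean(1)[OF Y N(1) N(4) N(5)]) (use I\<rho> in simp)
  have "sq_mean (inc t) \<le> expectation (\<lambda>\<omega>. 2 * S + 4 * l\<^sup>2 * ?\<rho> (?Y \<omega>))"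
    unfolding inc by (rule fresh_sq_mean(2)[OF Y N(1) N(4) N(5)]) (use I\<rho> in simp)
  also have "\<dots> = 2 * S + 4 * l\<^sup>2 * \<rho> t" unfolding E\<rho>[symmetric] using I\<rho> by (simp add: prob_space)
  finally show "sq_mean (inc t) \<le> 2 * S + 4 * l\<^sup>2 * \<rho> t" .
  have le': "(\<integral>x. (norm (?\<nu>' (y, x)))\<^sup>2 \<partial>P) \<le> 2 * l\<^sup>2 * ?\<rho> y" for y using N(7)[of y] by simp
  have int': "integrable P (\<lambda>x. (norm (?\<nu>' (y, x)))\<^sup>2)" for y using N(6)[of y] by simp
  show 2: "sq_integrable (rem t)"
    unfolding rem by (rule fresh_sq_mean(1)[OF Y _ int' le']) (use I\<rho> in simp_all)
  have "sq_mean (rem t) \<le> expectation (\<lambda>\<omega>. 2 * l\<^sup>2 * ?\<rho> (?Y \<omega>))"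
    unfolding rem by (rule fresh_sq_mean(2)[OF Y _ int' le']) (use I\<rho> in simp_all)
  also have "\<dots> = 2 * l\<^sup>2 * \<rho> t" unfolding E\<rho>[symmetric] by simp
  finally show "sq_mean (rem t) \<le> 2 * l\<^sup>2 * \<rho> t" .
  fix X :: "'w \<Rightarrow> 'a" assume X: "X \<in> borel_measurable (past (c + t))" "sq_integrable X"
  show "sq_mean (\<lambda>\<omega>. X \<omega> + inc t \<omega>)
        = sq_mean X + sq_mean (inc t)"
    unfolding inc by (rule fresh_orthogonal[OF Y X(1) N(1) N(2) N(3) X(2)]) (use 1 inc in simp)
  have intz: "integrable P (\<lambda>x. ?\<nu>' (y, x))" for y
    using N(2)[of y] eps_integrable by simp
  have zero: "(\<integral>x. ?\<nu>' (y, x) \<partial>P) = 0" for y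
    using N(2)[of y] N(3)[of y] eps_integrable by (simp add: eps_mean)
  show "sq_mean (\<lambda>\<omega>. X \<omega> + rem t \<omega>)
        = sq_mean X
          + sq_mean (rem t)"
    unfolding rem by (rule fresh_orthogonal[OF Y X(1) _ intz zero X(2)]) (use 2 rem in simp_all)
qed

text \<open>The properties must go through the induction together: \<open>inc t\<close> involves the
  last two iterates, and the next iterate is formed from \<open>u\<close>, which is recovered from
  \<open>m\<close>.\<close>

lemma adapted:
  "th t \<in> borel_measurable (past (c + t)) \<and> th (t - 1) \<in> borel_measurable (past (c + t)) \<and>
   m t \<in> borel_measurable (past (c + t)) \<and>
   sq_integrable (th t) \<and> sq_integrable (th (t - 1)) \<and> sq_integrable (m t)"
proof (induction t)
  case 0
  have "th 0 = x0" using T0_pos th_init[of 0] by (auto simp: fun_eq_iff)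
  moreover have "m 0 = (\<lambda>_. 0)" by (auto simp: m_0)
  ultimately show ?case using x0_past x0_sq sq_integrable_const[of "0::'a"] by simp
next
  case (Suc t)
  then have th: "th t \<in> borel_measurable (past (c + t))" "th (t - 1) \<in> borel_measurable (past (c + t))"
    and mt: "m t \<in> borel_measurable (past (c + t))"
    and sq: "sq_integrable (th t)" "sq_integrable (th (t - 1))" "sq_integrable (m t)" by auto
  have [measurable]: "th t \<in> borel_measurable (past (Suc (c + t)))" "th (t - 1) \<in> borel_measurable (past (Suc (c + t)))"
    "m t \<in> borel_measurable (past (Suc (c + t)))" "\<xi> (Suc (c + t)) \<in> measurable (past (Suc (c + t))) P"
    by (rule past_mono[OF th(1)] past_mono[OF th(2)] past_mono[OF mt] past_sample; simp)+
  have m_eq: "m (Suc t) = (\<lambda>\<omega>. m t \<omega> + inc t \<omega>)" by (auto simp: m_Suc)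
  have [measurable]: "inc t \<in> borel_measurable (past (Suc (c + t)))" unfolding inc_def by measurable
  have [measurable]: "m (Suc t) \<in> borel_measurable (past (Suc (c + t)))" unfolding m_eq by measurable
  have m_sq: "sq_integrable (m (Suc t))" unfolding m_eq
    by (rule sq_integrable_add[OF sq(3) inc_sq'[OF th sq(1,2)]])
  have u_eq': "u (Suc t) = (\<lambda>\<omega>. m (Suc t) \<omega> + real (Suc t) *\<^sub>R G (th t \<omega>))" by (auto simp: u_eq)
  have [measurable]: "u (Suc t) \<in> borel_measurable (past (Suc (c + t)))" unfolding u_eq' by measurable
  have u_sq: "sq_integrable (u (Suc t))" unfolding u_eq'
    by (intro sq_integrable_add m_sq sq_integrable_scaleR sq_integrable_G sq)
  have "th (Suc t) \<in> borel_measurable (past (Suc (c + t))) \<and> sq_integrable (th (Suc t))"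
  proof (cases "T0 \<le> Suc t")
    case True
    then have eq: "th (Suc t) = (\<lambda>\<omega>. th t \<omega> - (\<eta> / real (Suc t)) *\<^sub>R u (Suc t) \<omega>)"
      using th_step[OF True] by (auto simp: fun_eq_iff)
    have "sq_integrable (th (Suc t))" unfolding eq
      by (intro sq_integrable_diff sq_integrable_scaleR u_sq sq)
    moreover have "th (Suc t) \<in> borel_measurable (past (Suc (c + t)))" unfolding eq by measurable
    ultimately show ?thesis by simp
  next
    case False
    then have "th (Suc t) = th t" by (auto simp: th_init)
    then show ?thesis using sq by simp
  qed
  then show ?case using m_sq sq by simp
qed

lemma th_past: "th t \<in> borel_measurable (past (c + t))" and th_prev_past: "th (t - 1) \<in> borel_measurable (past (c + t))"
  and m_past: "m t \<in> borel_measurable (past (c + t))" and th_sq: "sq_integrable (th t)" and m_sq: "sq_integrable (m t)"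
  using adapted[of t] by auto

lemma u_sq: "sq_integrable (u t)"
proof -
  have "u t = (\<lambda>\<omega>. m t \<omega> + real t *\<^sub>R G (th (t - 1) \<omega>))" by (auto simp: u_eq)
  then show ?thesis by (simp add: sq_integrable_add m_sq sq_integrable_scaleR sq_integrable_G th_sq)
qed

lemmas inc_sq = inc_sq'[OF th_past th_prev_past th_sq th_sq]
lemmas inc_le = inc_le'[OF th_past th_prev_past th_sq th_sq]
lemmas inc_orth = inc_orth'[OF th_past th_prev_past th_sq th_sq]
lemmas rem_sq = rem_sq'[OF th_past th_prev_past th_sq th_sq]
lemmas rem_le = rem_le'[OF th_past th_prev_past th_sq th_sq]
lemmas rem_orth = rem_orth'[OF th_past th_prev_past th_sq th_sq]

section \<open>Recursions for the second moments\<close>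

definition s :: "nat \<Rightarrow> real" where "s t = sq_mean (m t)"
definition w :: "nat \<Rightarrow> real" where "w t = sq_mean (u t)"
definition I :: "nat \<Rightarrow> real" where "I t = sq_mean (inc t)"
definition D :: real where "D = sq_mean (\<lambda>\<omega>. G (x0 \<omega>))"

lemma w_nonneg: "w t \<ge> 0" and D_nonneg: "D \<ge> 0"
  by (auto simp: w_def D_def)

lemma s_0: "s 0 = 0" by (simp add: s_def m_0)

lemma s_Suc: "s (Suc t) = s t + I t"
  using inc_orth[OF m_past m_sq] by (simp add: s_def I_def m_Suc)

lemma I_le: "I t \<le> 2 * S + 4 * l\<^sup>2 * \<rho> t"
  unfolding I_def by (rule inc_le)

text \<open>\<open>u t - m t\<close> is \<open>t\<close> times the gradient at
  \<open>th (t - 1)\<close>, so bounds on the two processes yield decay of the gradient.\<close>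

lemma grad_sq_mean_le:
  assumes "t \<ge> 1"
  shows "sq_mean (\<lambda>\<omega>. G (th (t - 1) \<omega>)) \<le> 2 * (w t + s t) / (real t)\<^sup>2"
proof -
  have "sq_mean (\<lambda>\<omega>. G (th (t - 1) \<omega>)) = expectation (\<lambda>\<omega>. (norm (u t \<omega> - m t \<omega>))\<^sup>2 / (real t)\<^sup>2)"
    using assms by (intro Bochner_Integration.integral_cong refl) (simp add: u_eq power_mult_distrib)
  also have "\<dots> = sq_mean (\<lambda>\<omega>. u t \<omega> - m t \<omega>) / (real t)\<^sup>2" by simp
  also have "\<dots> \<le> (2 * w t + 2 * s t) / (real t)\<^sup>2"
    unfolding w_def s_def by (intro divide_right_mono sq_mean_diff_le u_sq m_sq) simp
  finally show ?thesis by simp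
qed

lemma dist_sq_mean_le:
  assumes "sq_integrable X"
  shows "sq_mean (\<lambda>\<omega>. X \<omega> - \<theta>s) \<le> sq_mean (\<lambda>\<omega>. G (X \<omega>)) / \<mu>\<^sup>2"
proof -
  have "sq_mean (\<lambda>\<omega>. X \<omega> - \<theta>s) \<le> expectation (\<lambda>\<omega>. (norm (G (X \<omega>)))\<^sup>2 / \<mu>\<^sup>2)"
    using sq_integrable_diff[OF assms sq_integrable_const[of \<theta>s]] sq_integrable_G[OF assms]
    by (intro integral_mono dist_root_sq_le) (auto simp: sq_integrable_def)
  then show ?thesis by simp
qed

lemma \<rho>_burn_in: "t < T0 \<Longrightarrow> \<rho> t \<le> D / \<mu>\<^sup>2"
  using dist_sq_mean_le[OF x0_sq] by (simp add: \<rho>_def th_init D_def)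

text \<open>A step moves by \<open>\<eta> / t\<close> times \<open>u t\<close>, so the weight
  \<open>(t + 1)\<^sup>2\<close> is reduced to at most 4; the distance to the root comes from
  \<open>grad_sq_mean_le\<close>.\<close>

lemma \<rho>_le:
  assumes "T0 \<le> t"
  shows "\<rho> t \<le> 4 * \<eta>\<^sup>2 * w t + 2 * (w t + s t) / (\<mu>\<^sup>2 * (real t)\<^sup>2)"
proof -
  have t: "t \<ge> 1" using assms T0_pos by simp
  have i1: "integrable M (\<lambda>\<omega>. (norm (th (t - 1) \<omega> - \<theta>s))\<^sup>2)"
    using sq_integrable_diff[OF th_sq sq_integrable_const[of \<theta>s]] by (simp add: sq_integrable_def)
  have i2: "integrable M (\<lambda>\<omega>. (norm (u t \<omega>))\<^sup>2)" using u_sq by (simp add: sq_integrable_def)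
  have eq: "(real (Suc t))\<^sup>2 * (norm (th t \<omega> - th (t - 1) \<omega>))\<^sup>2 = (real (Suc t) / real t)\<^sup>2 * \<eta>\<^sup>2 * (norm (u t \<omega>))\<^sup>2" for \<omega>
    using th_step[OF assms, of \<omega>] \<eta>_pos by (simp add: power_mult_distrib power_divide)
  have "(real (Suc t) / real t)\<^sup>2 \<le> 2\<^sup>2" using t by (intro power_mono) (auto simp: field_simps)
  then have le4: "(real (Suc t) / real t)\<^sup>2 * \<eta>\<^sup>2 * w t \<le> 4 * \<eta>\<^sup>2 * w t"
    using w_nonneg by (intro mult_right_mono) auto
  have "\<rho> t = sq_mean (\<lambda>\<omega>. th (t - 1) \<omega> - \<theta>s) + (real (Suc t) / real t)\<^sup>2 * \<eta>\<^sup>2 * w t"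
    unfolding \<rho>_def eq w_def using i1 i2 by simp
  also have "sq_mean (\<lambda>\<omega>. th (t - 1) \<omega> - \<theta>s) \<le> (2 * (w t + s t) / (real t)\<^sup>2) / \<mu>\<^sup>2"
    by (rule order_trans[OF dist_sq_mean_le[OF th_sq] divide_right_mono[OF grad_sq_mean_le[OF t]]]) simp
  finally show ?thesis using le4 by (simp add: mult.commute)
qed

text \<open>\<open>u (Suc t)\<close> is a past part \<open>X\<close> plus the orthogonal increment
  \<open>inc t\<close>. \<open>X\<close> is \<open>1 + 1 / t\<close> times the contracted vector of
  \<open>gradient_step_contracts\<close> minus \<open>m t / t\<close>; the weighted inequality with
  weight \<open>\<eta> * \<mu> / 4\<close> separates the two.\<close>

lemma w_Suc_le:
  assumes T: "T0 \<le> t" and small: "\<eta> * L\<^sup>2 \<le> \<mu>" "\<eta> * \<mu> \<le> 1" and T0: "24 / (\<eta> * \<mu>) \<le> real T0"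
  shows "w (Suc t) \<le> (1 - \<eta> * \<mu> / 2) * w t + 8 / (\<eta> * \<mu>) * s t / (real t)\<^sup>2 + I t"
proof -
  let ?y = "\<eta> * \<mu>"
  have y: "0 < ?y" "?y \<le> 1" using \<eta>_pos \<mu>_pos small by auto
  have t: "real t > 0" using T T0_pos by simp
  have yt: "1 / real t \<le> ?y / 24"
  proof -
    have "24 / ?y \<le> real t" using T T0 by linarith
    then show ?thesis using y t by (simp add: field_simps)
  qed
  define X where "X = (\<lambda>\<omega>. real (Suc t) *\<^sub>R G (th t \<omega>) + m t \<omega>)"
  have X_sq: "sq_integrable X"
    unfolding X_def by (intro sq_integrable_add sq_integrable_scaleR sq_integrable_G th_sq m_sq)
  have X_past: "X \<in> borel_measurable (past (c + t))"
    unfolding X_def using th_past m_past by measurable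
  have "u (Suc t) \<omega> = X \<omega> + inc t \<omega>" for \<omega>
    using u_eq[of "Suc t" \<omega>] by (simp add: X_def m_Suc)
  then have w_eq: "w (Suc t) = sq_mean X + I t"
    using inc_orth[OF X_past X_sq] by (simp add: w_def I_def)
  \<comment> \<open>The weight \<open>1 + ?y / 4\<close> and the growth
    \<open>(1 + 1 / t)\<^sup>2\<close>, at most \<open>1 + ?y / 8\<close> by the choice of 24 in the
    burn-in length, together cost at most \<open>1 + ?y / 2\<close>; half of the gain
    \<open>?y\<close> survives.\<close>
  have poly: "(1 + ?y / 4) * ((1 + 1 / real t)\<^sup>2 * (1 - ?y)) \<le> 1 - ?y / 2"
  proof -
    have "(1 + 1 / real t)\<^sup>2 \<le> (1 + ?y / 24)\<^sup>2" using yt t by (intro power_mono) auto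
    also have "\<dots> \<le> 1 + ?y / 8"
      using y mult_mono[of ?y 1 ?y ?y] by (simp add: power2_eq_square algebra_simps)
    finally have 1: "(1 + 1 / real t)\<^sup>2 \<le> 1 + ?y / 8" .
    have "(1 + ?y / 4) * ((1 + 1 / real t)\<^sup>2 * (1 - ?y)) \<le> (1 + ?y / 4) * ((1 + ?y / 8) * (1 - ?y))"
      using 1 y by (intro mult_left_mono mult_right_mono) auto
    also have "\<dots> = ((1 + ?y / 4) * (1 + ?y / 8)) * (1 - ?y)" by simp
    also have "\<dots> \<le> (1 + ?y / 2) * (1 - ?y)"
      using y mult_mono[of ?y 1 ?y ?y] by (intro mult_right_mono) (auto simp: algebra_simps)
    also have "\<dots> \<le> 1 - ?y / 2" using y mult_nonneg_nonneg[of ?y ?y] by (simp add: algebra_simps)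
    finally show ?thesis .
  qed
  have bound: "(norm (X \<omega>))\<^sup>2 \<le> (1 - ?y / 2) * (norm (u t \<omega>))\<^sup>2 + 8 / ?y / (real t)\<^sup>2 * (norm (m t \<omega>))\<^sup>2" for \<omega>
  proof -
    let ?D = "real t *\<^sub>R (G (th (t - 1) \<omega> - (\<eta> / real t) *\<^sub>R u t \<omega>) - G (th (t - 1) \<omega>))"
    have th: "th t \<omega> = th (t - 1) \<omega> - (\<eta> / real t) *\<^sub>R u t \<omega>" by (rule th_step[OF T])
    have uD: "u t \<omega> + ?D = m t \<omega> + real t *\<^sub>R G (th t \<omega>)"
      unfolding th[symmetric] by (simp add: u_eq[of t \<omega>] algebra_simps)
    have c: "(1 + 1 / real t) * real t = real (Suc t)" using t by (simp add: field_simps)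
    \<comment> \<open>Scaling by \<open>1 + 1 / t\<close> produces the right multiple
      \<open>t + 1\<close> of the gradient and a surplus \<open>m t / t\<close>.\<close>
    have "X \<omega> = (1 + 1 / real t) *\<^sub>R (u t \<omega> + ?D) + (- (1 / real t)) *\<^sub>R m t \<omega>"
      unfolding uD X_def by (simp only: scaleR_add_right scaleR_scaleR c) (simp add: algebra_simps)
    then have "(norm (X \<omega>))\<^sup>2 \<le> (1 + ?y / 4) * (norm ((1 + 1 / real t) *\<^sub>R (u t \<omega> + ?D)))\<^sup>2
        + (1 + 1 / (?y / 4)) * (norm ((- (1 / real t)) *\<^sub>R m t \<omega>))\<^sup>2"
      by (simp only:) (rule norm_add_sq_le_weighted, use y in simp)
    also have "(norm ((1 + 1 / real t) *\<^sub>R (u t \<omega> + ?D)))\<^sup>2 = (1 + 1 / real t)\<^sup>2 * (norm (u t \<omega> + ?D))\<^sup>2"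
      by (simp add: power_mult_distrib)
    also have "(norm ((- (1 / real t)) *\<^sub>R m t \<omega>))\<^sup>2 = (norm (m t \<omega>))\<^sup>2 / (real t)\<^sup>2"
      by (simp add: power_divide)
    also have "(1 + ?y / 4) * ((1 + 1 / real t)\<^sup>2 * (norm (u t \<omega> + ?D))\<^sup>2)
      \<le> (1 + ?y / 4) * ((1 + 1 / real t)\<^sup>2 * ((1 - ?y) * (norm (u t \<omega>))\<^sup>2))"
      using y gradient_step_contracts[OF t \<eta>_pos small(1)] by (intro mult_left_mono) auto
    also have "\<dots> = ((1 + ?y / 4) * ((1 + 1 / real t)\<^sup>2 * (1 - ?y))) * (norm (u t \<omega>))\<^sup>2" by simp
    also have "\<dots> \<le> (1 - ?y / 2) * (norm (u t \<omega>))\<^sup>2" by (rule mult_right_mono[OF poly]) simp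
    also have "(1 + 1 / (?y / 4)) * ((norm (m t \<omega>))\<^sup>2 / (real t)\<^sup>2) \<le> (8 / ?y) * ((norm (m t \<omega>))\<^sup>2 / (real t)\<^sup>2)"
      using y by (intro mult_right_mono) (auto simp: field_simps)
    finally show ?thesis by simp
  qed
  have iu: "integrable M (\<lambda>\<omega>. (norm (u t \<omega>))\<^sup>2)" and im: "integrable M (\<lambda>\<omega>. (norm (m t \<omega>))\<^sup>2)"
    and iX: "integrable M (\<lambda>\<omega>. (norm (X \<omega>))\<^sup>2)"
    using u_sq[of t] m_sq[of t] X_sq by (auto simp: sq_integrable_def)
  have "sq_mean X
    \<le> expectation (\<lambda>\<omega>. (1 - ?y / 2) * (norm (u t \<omega>))\<^sup>2 + 8 / ?y / (real t)\<^sup>2 * (norm (m t \<omega>))\<^sup>2)"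
    by (rule integral_mono[OF iX _ bound]) (use iu im in auto)
  also have "\<dots> = (1 - ?y / 2) * w t + 8 / ?y / (real t)\<^sup>2 * s t"
    using iu im by (simp add: w_def s_def)
  finally show ?thesis unfolding w_eq by simp
qed

lemma w_T0_le: "w T0 \<le> 2 * (real T0)\<^sup>2 * D + 2 * s T0"
proof -
  have "w T0 = sq_mean (\<lambda>\<omega>. m T0 \<omega> + real T0 *\<^sub>R G (x0 \<omega>))"
    using T0_pos by (simp add: w_def u_eq th_init)
  also have "\<dots> \<le> 2 * sq_mean (m T0) + 2 * sq_mean (\<lambda>\<omega>. real T0 *\<^sub>R G (x0 \<omega>))"
    by (intro sq_mean_add_le m_sq sq_integrable_scaleR sq_integrable_G x0_sq)
  finally show ?thesis by (simp add: s_def D_def power_mult_distrib)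
qed

lemma s_T0_le: "t \<le> T0 \<Longrightarrow> s t \<le> real t * (2 * S + 4 * l\<^sup>2 * (D / \<mu>\<^sup>2))"
proof (induction t)
  case (Suc t)
  have "I t \<le> 2 * S + 4 * l\<^sup>2 * (D / \<mu>\<^sup>2)"
    using Suc.prems by (intro order_trans[OF I_le] add_left_mono mult_left_mono \<rho>_burn_in) auto
  then show ?case using Suc by (simp add: s_Suc algebra_simps add_divide_distrib)
qed (simp add: s_0)

text \<open>The gap between \<open>m\<close> and the sum of gradients at the root is again a
  martingale, with increments \<open>rem\<close>, so their second moments add up.\<close>

lemma remainder_sq_mean:
  "sq_integrable (\<lambda>\<omega>. m t \<omega> - (\<Sum>i = 1..t. g \<theta>s (\<xi> (c + i) \<omega>))) \<and>
   sq_mean (\<lambda>\<omega>. m t \<omega> - (\<Sum>i = 1..t. g \<theta>s (\<xi> (c + i) \<omega>))) \<le> (\<Sum>i<t. 2 * l\<^sup>2 * \<rho> i)"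
proof (induction t)
  case 0
  show ?case using sq_integrable_const[of "0::'a"] by (simp add: m_0)
next
  case (Suc t)
  let ?R = "\<lambda>\<omega>. m t \<omega> - (\<Sum>i = 1..t. g \<theta>s (\<xi> (c + i) \<omega>))"
  have [measurable]: "m t \<in> borel_measurable (past (c + t))" by (rule m_past)
  have [measurable]: "\<xi> (c + i) \<in> measurable (past (c + t)) P" if "i \<in> {1..t}" for i
    using that by (intro past_sample) auto
  have R: "?R \<in> borel_measurable (past (c + t))" by measurable
  have eq: "m (Suc t) \<omega> - (\<Sum>i = 1..Suc t. g \<theta>s (\<xi> (c + i) \<omega>)) = ?R \<omega> + rem t \<omega>" for \<omega>
    by (simp add: m_Suc rem_def)
  show ?case
    unfolding eq using Suc.IH rem_le[of t] rem_sq[of t]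
    by (subst rem_orth[OF R]) (auto intro: sq_integrable_add)
qed

end

section \<open>Moment bounds over the epochs\<close>

context noisy_gradient
begin

text \<open>The induction bounds \<open>E|t v\<^sub>t|\<^sup>2\<close> by \<open>W \<Delta> / \<eta>\<^sup>2\<close> and \<open>E|t z\<^sub>t|\<^sup>2\<close> by \<open>t A \<Delta>\<close>, where \<open>\<Delta>\<close> is the mean squared
  gradient at the initial point plus \<open>\<eta>\<close>. The summand \<open>4 S\<close> of \<open>A\<close> has no factor \<open>\<Delta>\<close>: this is what lets an
  epoch of length of order \<open>1 / \<eta>\<close> contract up to \<open>O(\<eta>)\<close>. Under \<open>small_step\<close> the induction closes.\<close>

definition W :: real where "W = 1251 / \<mu>\<^sup>2 + 100 * S / \<mu>"

definition A :: "real \<Rightarrow> real" where "A \<Delta> = 4 * S + 40 * l\<^sup>2 * W * \<Delta>"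

text \<open>The first two bounds on \<eta> serve the contraction in \<open>w_Suc_le\<close>. The
  constant 320 is 4 times the 80 in \<open>2 * A \<Delta>\<close> and closes the induction in
  \<open>bounds\<close>; 4000 limits to 1 / 100 the feedback of the initial gradient in
  \<open>epoch_contraction\<close>; the last bound makes the \<Delta>-part of \<open>A\<close> a
  constant when \<Delta> is of order \<eta>.\<close>

definition small_step :: "real \<Rightarrow> bool" where
  "small_step \<eta> \<longleftrightarrow> 0 < \<eta> \<and> \<eta> * L\<^sup>2 \<le> \<mu> \<and> \<eta> * \<mu> \<le> 1 \<and> 320 * l\<^sup>2 * \<eta> \<le> \<mu> \<and>
     4000 * l\<^sup>2 * W * \<mu> * \<eta> \<le> 1 \<and> 40 * l\<^sup>2 * W * \<eta> \<le> 1"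

lemma W_pos: "W > 0"
  unfolding W_def using \<mu>_pos S_nonneg by (intro add_pos_nonneg) auto

lemma A_nonneg: "\<Delta> \<ge> 0 \<Longrightarrow> A \<Delta> \<ge> 0"
  unfolding A_def using W_pos S_nonneg by (intro add_nonneg_nonneg mult_nonneg_nonneg) auto

lemma eventually_small_step:
  assumes "\<And>k. \<eta> k > 0" and lim: "\<eta> \<longlonglongrightarrow> (0::real)"
  shows "\<forall>\<^sub>F k in sequentially. small_step (\<eta> k)"
proof -
  have ev: "\<forall>\<^sub>F k in sequentially. \<eta> k * a \<le> b" if "b > 0" for a b
  proof -
    have "(\<lambda>k. \<eta> k * a) \<longlonglongrightarrow> 0 * a" by (intro tendsto_intros lim)
    then show ?thesis using that by (auto dest!: order_tendstoD(2)[where a=b] elim: eventually_mono)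
  qed
  have "\<forall>\<^sub>F k in sequentially. \<eta> k * L\<^sup>2 \<le> \<mu> \<and> \<eta> k * \<mu> \<le> 1 \<and> \<eta> k * (320 * l\<^sup>2) \<le> \<mu> \<and>
     \<eta> k * (4000 * l\<^sup>2 * W * \<mu>) \<le> 1 \<and> \<eta> k * (40 * l\<^sup>2 * W) \<le> 1"
    using \<mu>_pos by (intro eventually_conj ev) auto
  then show ?thesis
    by eventually_elim (use assms(1) in \<open>auto simp: small_step_def mult.commute\<close>)
qed

end

context sgd_epoch
begin

context
  assumes small: "small_step \<eta>" and T0_ge: "24 / (\<eta> * \<mu>) \<le> real T0" and T0_le: "real T0 \<le> 25 / (\<eta> * \<mu>)"
begin

abbreviation "y \<equiv> \<eta> * \<mu>"
abbreviation "\<Delta> \<equiv> D + \<eta>"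

lemma y_pos: "y > 0" and y_le: "y \<le> 1"
  using small \<mu>_pos by (auto simp: small_step_def)

lemma \<Delta>_bounds: "\<eta> \<le> \<Delta>" "D \<le> \<Delta>" "0 < \<Delta>"
  using D_nonneg \<eta>_pos by auto

lemma inverse_t_le:
  assumes "T0 \<le> t"
  shows "1 / real t \<le> y / 24"
proof -
  have "24 / y \<le> real t" using assms T0_ge by linarith
  then show ?thesis using y_pos assms T0_pos by (simp add: field_simps)
qed

lemma inverse_t_sq_le:
  assumes "T0 \<le> t"
  shows "1 / (real t)\<^sup>2 \<le> y\<^sup>2 / 576"
  using power_mono[OF inverse_t_le[OF assms], of 2] by (simp add: power_divide)

lemma s_T0_bound: "s T0 \<le> real T0 * A \<Delta>"
proof -
  have W1: "1 / \<mu>\<^sup>2 \<le> W" unfolding W_def using \<mu>_pos S_nonneg by (simp add: field_simps add_increasing2)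
  have "D * (1 / \<mu>\<^sup>2) \<le> \<Delta> * W"
    using \<Delta>_bounds W1 D_nonneg \<mu>_pos by (intro mult_mono) auto
  then have "4 * l\<^sup>2 * (D / \<mu>\<^sup>2) \<le> 4 * l\<^sup>2 * (\<Delta> * W)" by (intro mult_left_mono) auto
  also have "\<dots> \<le> 40 * l\<^sup>2 * W * \<Delta>" using W_pos \<Delta>_bounds by (simp add: mult_mono)
  finally have "2 * S + 4 * l\<^sup>2 * (D / \<mu>\<^sup>2) \<le> A \<Delta>" unfolding A_def using S_nonneg by simp
  then show ?thesis using order_trans[OF s_T0_le[of T0] mult_left_mono] by simp
qed

text \<open>Source of the constants in \<open>W\<close>: with \<open>T0 \<le> 25 / y\<close> one
  gets \<open>2 * 25\<^sup>2 = 1250\<close> and \<open>2 * 25 * 2 = 100\<close>; the noise caused by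
  the initial gradient costs one more unit.\<close>

lemma w_T0_bound: "w T0 \<le> 1251 * D / y\<^sup>2 + 100 * S / y"
proof -
  have T: "real T0 \<ge> 0" "25 / y > 0" using y_pos by auto
  have q: "200 * l\<^sup>2 / (y * \<mu>\<^sup>2) \<le> 1 / y\<^sup>2"
  proof -
    have "200 * l\<^sup>2 * \<eta> \<le> \<mu>" using small \<eta>_pos by (auto simp: small_step_def intro: order_trans[rotated])
    then show ?thesis using \<mu>_pos \<eta>_pos by (simp add: field_simps power2_eq_square)
  qed
  have "w T0 \<le> 2 * (real T0)\<^sup>2 * D + 2 * (real T0 * (2 * S + 4 * l\<^sup>2 * (D / \<mu>\<^sup>2)))"
    using w_T0_le s_T0_le[of T0] by simp
  also have "\<dots> \<le> 2 * (25 / y)\<^sup>2 * D + 2 * ((25 / y) * (2 * S + 4 * l\<^sup>2 * (D / \<mu>\<^sup>2)))"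
    using T0_le D_nonneg S_nonneg T
    by (intro add_mono mult_right_mono mult_left_mono power_mono add_nonneg_nonneg) auto
  also have "\<dots> = 1250 * D / y\<^sup>2 + D * (200 * l\<^sup>2 / (y * \<mu>\<^sup>2)) + 100 * S / y"
    using \<eta>_pos \<mu>_pos by (simp add: power2_eq_square field_simps)
  also have "\<dots> \<le> 1250 * D / y\<^sup>2 + D * (1 / y\<^sup>2) + 100 * S / y"
    by (intro add_mono mult_left_mono q D_nonneg) auto
  finally show ?thesis by simp
qed

lemma s_div_sq_le:
  assumes T: "T0 \<le> t" and s_le: "s t \<le> real t * a" and A0: "a \<ge> 0"
  shows "s t / (real t)\<^sup>2 \<le> a * (y / 24)"
proof -
  have "s t / (real t)\<^sup>2 \<le> real t * a / (real t)\<^sup>2" using s_le by (intro divide_right_mono) auto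
  also have "\<dots> = a * (1 / real t)" using T T0_pos by (simp add: power2_eq_square)
  also have "\<dots> \<le> a * (y / 24)" by (rule mult_left_mono[OF inverse_t_le[OF T] A0])
  finally show ?thesis .
qed

lemma \<rho>_le_of_s_le:
  assumes T: "T0 \<le> t" and s_le: "s t \<le> real t * a" and A0: "a \<ge> 0"
  shows "\<rho> t \<le> 5 * \<eta>\<^sup>2 * w t + \<eta> / \<mu> * a / 12"
proof -
  have t: "real t > 0" using T T0_pos by simp
  note st = s_div_sq_le[OF T s_le A0]
  have wt: "w t / (real t)\<^sup>2 \<le> w t * (y\<^sup>2 / 576)"
    using mult_left_mono[OF inverse_t_sq_le[OF T] w_nonneg[of t]] by simp
  have "2 * (w t + s t) / (\<mu>\<^sup>2 * (real t)\<^sup>2) = (2 / \<mu>\<^sup>2) * (w t / (real t)\<^sup>2 + s t / (real t)\<^sup>2)"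
    using \<mu>_pos t by (simp add: field_simps)
  also have "\<dots> \<le> (2 / \<mu>\<^sup>2) * (w t * (y\<^sup>2 / 576) + a * (y / 24))"
    using \<mu>_pos by (intro mult_left_mono add_mono wt st) auto
  also have "\<dots> = \<eta>\<^sup>2 * w t / 288 + \<eta> / \<mu> * a / 12"
    using \<mu>_pos by (simp add: power_mult_distrib field_simps power2_eq_square)
  also have "\<dots> \<le> \<eta>\<^sup>2 * w t + \<eta> / \<mu> * a / 12" using w_nonneg by simp
  finally show ?thesis using \<rho>_le[OF T] by simp
qed

text \<open>\<open>inc t\<close> is bounded through \<open>\<rho> t\<close>, hence through
  \<open>w t\<close> and \<open>s t\<close> themselves; the crude bound on \<open>w t\<close> closes
  this circle. In it the coefficient of \<open>D\<close> contains \<open>S\<close>, which would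
  spoil a fixed contraction factor, so the third bound is carried along for
  \<open>epoch_contraction\<close>.\<close>

lemma bounds:
  "T0 \<le> t \<Longrightarrow> s t \<le> real t * A \<Delta> \<and> w t \<le> W * \<Delta> / \<eta>\<^sup>2 \<and> w t \<le> w T0 + 4 / y * A \<Delta>"
proof (induction t rule: dec_induct)
  case base
  have "w T0 \<le> 1251 * D / y\<^sup>2 + 100 * S / y" by (rule w_T0_bound)
  also have "\<dots> = (1251 / \<mu>\<^sup>2) * D / \<eta>\<^sup>2 + (100 * S / \<mu>) * \<eta> / \<eta>\<^sup>2"
    using \<eta>_pos \<mu>_pos by (simp add: power2_eq_square field_simps)
  also have "\<dots> \<le> (1251 / \<mu>\<^sup>2) * \<Delta> / \<eta>\<^sup>2 + (100 * S / \<mu>) * \<Delta> / \<eta>\<^sup>2"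
    using \<Delta>_bounds S_nonneg \<mu>_pos by (intro add_mono divide_right_mono mult_left_mono) auto
  also have "\<dots> = W * \<Delta> / \<eta>\<^sup>2" by (simp add: W_def algebra_simps add_divide_distrib)
  finally show ?case using s_T0_bound A_nonneg[of \<Delta>] \<Delta>_bounds y_pos by simp
next
  case (step t)
  have T: "T0 \<le> t" and sIH: "s t \<le> real t * A \<Delta>" and wIH: "w t \<le> W * \<Delta> / \<eta>\<^sup>2" "w t \<le> w T0 + 4 / y * A \<Delta>"
    using step by auto
  have t: "real t > 0" using T T0_pos by simp
  have A0: "A \<Delta> \<ge> 0" using A_nonneg \<Delta>_bounds by simp
  have rho: "\<rho> t \<le> 5 * \<eta>\<^sup>2 * w t + \<eta> / \<mu> * A \<Delta> / 12" by (rule \<rho>_le_of_s_le[OF T sIH A0])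
  note st = s_div_sq_le[OF T sIH A0]
  have w1: "\<eta>\<^sup>2 * w t \<le> W * \<Delta>" using wIH(1) \<eta>_pos by (simp add: field_simps)
  have leta: "l\<^sup>2 * (\<eta> / \<mu>) \<le> 1 / 2" using small \<mu>_pos by (simp add: small_step_def field_simps)
  have "I t \<le> 2 * S + 4 * l\<^sup>2 * (5 * (W * \<Delta>) + \<eta> / \<mu> * A \<Delta> / 12)"
    using rho w1 by (intro order_trans[OF I_le] add_left_mono mult_left_mono) auto
  also have "\<dots> = 2 * S + 20 * l\<^sup>2 * W * \<Delta> + (l\<^sup>2 * (\<eta> / \<mu>)) * A \<Delta> / 3" by (simp add: algebra_simps)
  also have "\<dots> \<le> 2 * S + 20 * l\<^sup>2 * W * \<Delta> + (1 / 2) * A \<Delta> / 3"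
    by (intro add_left_mono divide_right_mono mult_right_mono leta A0) auto
  \<comment> \<open>\<open>A\<close> is twice this amount by design; the other half pays for the
    contribution of \<open>s t\<close> to its own increment.\<close>
  also have "2 * S + 20 * l\<^sup>2 * W * \<Delta> = A \<Delta> / 2" by (simp add: A_def)
  also have "A \<Delta> / 2 + (1 / 2) * A \<Delta> / 3 \<le> A \<Delta>" using A0 by simp
  finally have It: "I t \<le> A \<Delta>" .
  have s': "s (Suc t) \<le> real (Suc t) * A \<Delta>" using sIH It by (simp add: s_Suc algebra_simps)
  have "8 / y * s t / (real t)\<^sup>2 = 8 / y * (s t / (real t)\<^sup>2)" by simp
  also have "\<dots> \<le> 8 / y * (A \<Delta> * (y / 24))" using y_pos by (intro mult_left_mono st) auto
  also have "\<dots> = A \<Delta> / 3" using \<eta>_pos \<mu>_pos by simp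
  also have "\<dots> \<le> A \<Delta>" using A0 by simp
  finally have w': "w (Suc t) \<le> (1 - y / 2) * w t + 2 * A \<Delta>"
    using w_Suc_le[OF T _ _ T0_ge] small It by (simp add: small_step_def)
  have y2: "0 \<le> 1 - y / 2" using y_le by simp
  \<comment> \<open>The recursion \<open>w'\<close> has the fixed point
    \<open>4 / y * A \<Delta>\<close>, which explains the form of the third bound.\<close>
  have "w (Suc t) \<le> (1 - y / 2) * (w T0 + 4 / y * A \<Delta>) + 2 * A \<Delta>"
    using order_trans[OF w' add_right_mono[OF mult_left_mono[OF wIH(2) y2]]] .
  also have "\<dots> = w T0 + 4 / y * A \<Delta> - y / 2 * w T0"
  proof -
    have "(1 - p / 2) * (a + z) + 2 * q = a + z - p / 2 * a" if "p * z = 4 * q" for p a z q :: real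
      using that by (simp add: algebra_simps)
    moreover have "y * (4 / y * A \<Delta>) = 4 * A \<Delta>" using \<eta>_pos \<mu>_pos by simp
    ultimately show ?thesis by blast
  qed
  also have "\<dots> \<le> w T0 + 4 / y * A \<Delta>" using y_pos w_nonneg by simp
  finally have w1': "w (Suc t) \<le> w T0 + 4 / y * A \<Delta>" .
  have S': "8 * S \<le> \<mu> * W * \<Delta> / (4 * \<eta>)"
  proof -
    have "32 * S \<le> \<mu> * W" using \<mu>_pos S_nonneg by (simp add: W_def field_simps add_increasing)
    then have "32 * S * \<eta> \<le> \<mu> * W * \<Delta>"
      by (rule mult_mono) (use \<Delta>_bounds \<eta>_pos \<mu>_pos W_pos in auto)
    then show ?thesis using \<eta>_pos by (simp add: field_simps)
  qed
  have W': "80 * l\<^sup>2 * W * \<Delta> \<le> \<mu> * W * \<Delta> / (4 * \<eta>)"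
  proof -
    have "320 * l\<^sup>2 * \<eta> * (W * \<Delta>) \<le> \<mu> * (W * \<Delta>)"
      using small W_pos \<Delta>_bounds by (intro mult_right_mono) (auto simp: small_step_def)
    then show ?thesis using \<eta>_pos by (simp add: field_simps)
  qed
  \<comment> \<open>The noise input is at most what the contraction takes away at the level
    \<open>W * \<Delta> / \<eta>\<^sup>2\<close>, so this level is never exceeded.\<close>
  have "2 * A \<Delta> \<le> \<mu> * W * \<Delta> / (2 * \<eta>)" using S' W' unfolding A_def by simp
  also have "\<dots> = y / 2 * (W * \<Delta> / \<eta>\<^sup>2)" using \<eta>_pos by (simp add: power2_eq_square)
  finally have "w (Suc t) \<le> (1 - y / 2) * (W * \<Delta> / \<eta>\<^sup>2) + y / 2 * (W * \<Delta> / \<eta>\<^sup>2)"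
    using order_trans[OF w' add_mono[OF mult_left_mono[OF wIH(1) y2]]] by blast
  then have "w (Suc t) \<le> W * \<Delta> / \<eta>\<^sup>2" by (simp only: left_diff_distrib mult_1_left diff_add_cancel)
  with s' w1' show ?case by simp
qed

text \<open>The moments are divided by the square of the length, so \<open>D / y\<^sup>2\<close>
  becomes a small multiple of \<open>D\<close> and the noise has order \<open>y\<close>. The factor
  1 / 10 lies below \<open>exp (- 2)\<close>, the rate built into the number of short
  epochs.\<close>

lemma epoch_contraction:
  assumes t: "7340 / y \<le> real t"
  shows "sq_mean (\<lambda>\<omega>. G (th t \<omega>)) \<le> D / 10 + \<mu> * (S + 1) * \<eta>"
proof -
  \<comment> \<open>The gradient at \<open>th t\<close> is read off from \<open>u\<close> and
    \<open>m\<close> at the next index.\<close>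
  let ?N = "Suc t"
  have tN: "7340 / y \<le> real ?N" using t by simp
  have Nt: "1 / real ?N \<le> y / 7340" using tN y_pos by (simp add: field_simps)
  have Nt2: "1 / (real ?N)\<^sup>2 \<le> (y / 7340)\<^sup>2"
    using power_mono[OF Nt, of 2] by (simp only: power_one_over) auto
  have "25 / y \<le> 7340 / y" using y_pos by (intro divide_right_mono) auto
  then have T: "T0 \<le> ?N" using T0_le tN by linarith
  have A0: "A \<Delta> \<ge> 0" using A_nonneg \<Delta>_bounds by simp
  have b: "s ?N \<le> real ?N * A \<Delta>" "w ?N \<le> 1251 * D / y\<^sup>2 + 100 * S / y + 4 / y * A \<Delta>"
    using bounds[OF T] w_T0_bound by auto
  have "w ?N / (real ?N)\<^sup>2 \<le> (1251 * D / y\<^sup>2 + 100 * S / y + 4 / y * A \<Delta>) * (y / 7340)\<^sup>2"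
    using mult_mono[OF b(2) Nt2] w_nonneg[of ?N] b(2) by simp
  also have "\<dots> = (1251 * D + 100 * S * y + 4 * y * A \<Delta>) / 7340\<^sup>2"
    using \<eta>_pos \<mu>_pos by (simp add: field_simps power2_eq_square)
  also have "\<dots> \<le> (D + S * y + y * A \<Delta>) / 2000"
  proof -
    have "(1251 * p + 100 * q + 4 * r) / 7340\<^sup>2 \<le> (p + q + r) / 2000" if "0 \<le> p" "0 \<le> q" "0 \<le> r" for p q r :: real
      using that by simp
    moreover have "0 \<le> S * y" "0 \<le> y * A \<Delta>" using S_nonneg A0 y_pos by auto
    ultimately show ?thesis using D_nonneg by (simp only: mult.assoc)
  qed
  finally have 1: "w ?N / (real ?N)\<^sup>2 \<le> (D + S * y + y * A \<Delta>) / 2000" .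
  have "s ?N / (real ?N)\<^sup>2 \<le> (real ?N * A \<Delta>) / (real ?N)\<^sup>2" using b(1) by (rule divide_right_mono) simp
  also have "\<dots> = A \<Delta> * (1 / real ?N)" by (simp add: power2_eq_square)
  also have "\<dots> \<le> A \<Delta> * (y / 7340)" by (rule mult_left_mono[OF Nt A0])
  also have "\<dots> = y * A \<Delta> / 7340" by simp
  also have "\<dots> \<le> y * A \<Delta> / 2000"
    by (rule divide_left_mono) (use A0 y_pos in \<open>auto intro: mult_nonneg_nonneg less_imp_le\<close>)
  finally have 2: "s ?N / (real ?N)\<^sup>2 \<le> y * A \<Delta> / 2000" .
  \<comment> \<open>Of \<Delta> inside \<open>A\<close>, the summand \<open>D\<close> gets the
    coefficient \<open>y * (40 * l\<^sup>2 * W)\<close>, at most 1 / 100, and the summand \<eta>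
    contributes at most \<open>y\<close>.\<close>
  have "y * A \<Delta> \<le> y * (4 * S + 1) + D / 100"
  proof -
    have h: "y * (40 * l\<^sup>2 * W) \<le> 1 / 100" "40 * l\<^sup>2 * W * \<eta> \<le> 1"
      using small by (auto simp: small_step_def algebra_simps)
    show ?thesis
      using mult_right_mono[OF h(1) D_nonneg] mult_left_mono[OF h(2) less_imp_le[OF y_pos]]
      unfolding A_def by (simp add: algebra_simps)
  qed
  moreover have "E \<le> (d + p + 2 * (q + d / 100)) / 1000"
    if "r \<le> q + d / 100" "E \<le> 2 * (a + b)" "a \<le> (d + p + r) / 2000" "b \<le> r / 2000" for E a b d p q r :: real
    using that by (simp add: field_simps)
  moreover have "sq_mean (\<lambda>\<omega>. G (th t \<omega>)) \<le> 2 * (w ?N / (real ?N)\<^sup>2 + s ?N / (real ?N)\<^sup>2)"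
    using grad_sq_mean_le[of ?N] by (simp add: add_divide_distrib)
  ultimately have "sq_mean (\<lambda>\<omega>. G (th t \<omega>))
      \<le> (D + S * y + 2 * (y * (4 * S + 1) + D / 100)) / 1000"
    using 1 2 by blast
  also have "\<dots> \<le> D / 10 + (S + 1) * y"
    using D_nonneg S_nonneg y_pos mult_nonneg_nonneg[of S y] by (simp add: algebra_simps)
  finally show ?thesis by (simp add: algebra_simps)
qed

text \<open>When the mean squared gradient at the start is of order \<eta>, so is \<Delta>, and the
  general bounds of \<open>bounds\<close> become the orders that the limit law needs.\<close>

lemma final_bounds:
  assumes K: "D \<le> K * \<eta>" and K0: "K \<ge> 0" and T: "T0 \<le> t"
  shows "w t \<le> W * (K + 1) / \<eta>" and "s t \<le> real t * (4 * S + (K + 1))"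
    and "\<rho> t \<le> (5 * W * (K + 1) + (4 * S + (K + 1)) / \<mu>) * \<eta>"
proof -
  have \<Delta>: "\<Delta> \<le> (K + 1) * \<eta>" using K by (simp add: algebra_simps)
  have t: "real t > 0" using T T0_pos by simp
  have "w t \<le> W * \<Delta> / \<eta>\<^sup>2" using bounds[OF T] by simp
  also have "\<dots> \<le> W * ((K + 1) * \<eta>) / \<eta>\<^sup>2"
    using \<Delta> W_pos by (intro divide_right_mono mult_left_mono) auto
  also have "\<dots> = W * (K + 1) / \<eta>" using \<eta>_pos by (simp add: power2_eq_square)
  finally show w: "w t \<le> W * (K + 1) / \<eta>" .
  have "40 * l\<^sup>2 * W * \<Delta> \<le> 40 * l\<^sup>2 * W * ((K + 1) * \<eta>)"
    using \<Delta> W_pos by (intro mult_left_mono) auto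
  also have "\<dots> = (40 * l\<^sup>2 * W * \<eta>) * (K + 1)" by simp
  also have "\<dots> \<le> 1 * (K + 1)" using small K0 by (intro mult_right_mono) (auto simp: small_step_def)
  finally have "A \<Delta> \<le> 4 * S + (K + 1)" unfolding A_def by simp
  then show st: "s t \<le> real t * (4 * S + (K + 1))"
    using bounds[OF T] t by (meson order_trans mult_left_mono less_imp_le)
  let ?A = "4 * S + (K + 1)"
  have A0: "?A \<ge> 0" using S_nonneg K0 by simp
  have "\<rho> t \<le> 5 * \<eta>\<^sup>2 * w t + \<eta> / \<mu> * ?A / 12" by (rule \<rho>_le_of_s_le[OF T st A0])
  also have "\<dots> \<le> 5 * (\<eta>\<^sup>2 * w t) + \<eta> / \<mu> * ?A"
  proof -
    have "0 \<le> \<eta> / \<mu> * ?A" using A0 \<eta>_pos \<mu>_pos by (intro mult_nonneg_nonneg) auto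
    moreover have "b / 12 \<le> b" if "0 \<le> b" for b :: real using that by simp
    ultimately show ?thesis by (simp only: mult.assoc add_left_mono)
  qed
  also have "\<dots> \<le> 5 * (W * (K + 1) * \<eta>) + \<eta> / \<mu> * ?A"
  proof -
    have "\<eta>\<^sup>2 * w t \<le> \<eta>\<^sup>2 * (W * (K + 1) / \<eta>)" using w by (rule mult_left_mono) simp
    also have "\<dots> = W * (K + 1) * \<eta>" using \<eta>_pos by (simp add: power2_eq_square)
    finally show ?thesis by simp
  qed
  finally show "\<rho> t \<le> (5 * W * (K + 1) + ?A / \<mu>) * \<eta>" by (simp add: algebra_simps add_divide_distrib)
qed

text \<open>The burn-in has at most \<open>25 / y\<close> terms of order \<eta> and costs a
  constant; the later terms are of order \<eta> each. After division by the length both parts vanish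
  in the limit.\<close>

lemma final_remainder:
  assumes K: "D \<le> K * \<eta>" and K0: "K \<ge> 0"
  shows "sq_mean (\<lambda>\<omega>. m t \<omega> - (\<Sum>i = 1..t. g \<theta>s (\<xi> (c + i) \<omega>)))
    \<le> 50 * l\<^sup>2 * K / \<mu> ^ 3 + 2 * l\<^sup>2 * (5 * W * (K + 1) + (4 * S + (K + 1)) / \<mu>) * \<eta> * real t"
proof -
  let ?R = "(5 * W * (K + 1) + (4 * S + (K + 1)) / \<mu>) * \<eta>"
  have R0: "?R \<ge> 0" using W_pos K0 S_nonneg \<mu>_pos \<eta>_pos by simp
  have K1: "K * \<eta> / \<mu>\<^sup>2 \<ge> 0" using K0 \<eta>_pos by simp
  have r: "\<rho> i \<le> (if i < T0 then K * \<eta> / \<mu>\<^sup>2 else 0) + ?R" for i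
  proof (cases "i < T0")
    case True
    have "D / \<mu>\<^sup>2 \<le> K * \<eta> / \<mu>\<^sup>2" by (rule divide_right_mono[OF K]) simp
    then show ?thesis using \<rho>_burn_in[OF True] True R0 by simp
  next
    case False
    then show ?thesis using final_bounds(3)[OF K K0, of i] by simp
  qed
  have "(\<Sum>i<t. \<rho> i) \<le> (\<Sum>i<t. (if i < T0 then K * \<eta> / \<mu>\<^sup>2 else 0) + ?R)"
    by (intro sum_mono r)
  also have "\<dots> = (\<Sum>i<t. (if i < T0 then K * \<eta> / \<mu>\<^sup>2 else 0)) + real t * ?R"
    by (simp add: sum.distrib)
  also have "(\<Sum>i<t. (if i < T0 then K * \<eta> / \<mu>\<^sup>2 else 0)) = real (card {i. i < t \<and> i < T0}) * (K * \<eta> / \<mu>\<^sup>2)"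
    by (simp add: sum.If_cases Int_def)
  also have "\<dots> \<le> real T0 * (K * \<eta> / \<mu>\<^sup>2)"
    using card_mono[of "{..<T0}" "{i. i < t \<and> i < T0}"] K1 by (intro mult_right_mono) auto
  also have "\<dots> \<le> (25 / y) * (K * \<eta> / \<mu>\<^sup>2)" by (rule mult_right_mono[OF T0_le K1])
  also have "\<dots> = 25 * K / \<mu> ^ 3" using \<eta>_pos by (simp add: power3_eq_cube power2_eq_square)
  finally have "(\<Sum>i<t. \<rho> i) \<le> 25 * K / \<mu> ^ 3 + real t * ?R" by simp
  then have "2 * l\<^sup>2 * (\<Sum>i<t. \<rho> i) \<le> 2 * l\<^sup>2 * (25 * K / \<mu> ^ 3 + real t * ?R)"
    by (rule mult_left_mono) simp
  moreover have "(\<Sum>i<t. 2 * l\<^sup>2 * \<rho> i) = 2 * l\<^sup>2 * (\<Sum>i<t. \<rho> i)" by (simp add: sum_distrib_left)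
  ultimately show ?thesis using remainder_sq_mean[of t] by (simp add: algebra_simps)
qed

end

end

text \<open>The last iterate of an epoch depends on the samples used so far only, so the next block
  is fresh and the bounds for one epoch can be chained.\<close>

lemma (in noisy_gradient) sgd_epoch_epoch_init:
  assumes \<eta>: "\<eta> > 0" and T0: "T0 \<ge> 1"
  shows "sgd_epoch M P \<xi> g G \<theta>s \<mu> L l S (b * Tb) (\<lambda>\<omega>. epoch_init g \<eta> T0 Tb \<theta>0 (\<lambda>t. \<xi> t \<omega>) b) \<eta> T0"
proof (induction b)
  case 0
  have "sgd_epoch_axioms M P \<xi> 0 (\<lambda>\<omega>. \<theta>0) \<eta> T0"
    using \<eta> T0 sq_integrable_const[of \<theta>0] by unfold_locales auto
  then show ?case using noisy_gradient_axioms by (simp add: sgd_epoch_def)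
next
  case (Suc b)
  then interpret E: sgd_epoch M P \<xi> g G \<theta>s \<mu> L l S "b * Tb" "\<lambda>\<omega>. epoch_init g \<eta> T0 Tb \<theta>0 (\<lambda>t. \<xi> t \<omega>) b" \<eta> T0 .
  have "(\<lambda>\<omega>. epoch_init g \<eta> T0 Tb \<theta>0 (\<lambda>t. \<xi> t \<omega>) (Suc b)) = E.th Tb" by (simp add: E.th_def fun_eq_iff)
  moreover have "sgd_epoch_axioms M P \<xi> (Suc b * Tb) (E.th Tb) \<eta> T0"
    using E.th_past[of Tb] E.th_sq[of Tb] \<eta> T0 by unfold_locales (auto simp: add.commute)
  ultimately show ?case using noisy_gradient_axioms by (simp add: sgd_epoch_def)
qed

text \<open>The map from \<open>a\<close> to \<open>a / 10 + q\<close> does not leave the level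
  \<open>2 * q\<close>, so the noise floor does not grow with the number of epochs.\<close>

lemma (in noisy_gradient) multi_epoch:
  fixes T0 Tb :: nat and \<theta>0 :: 'a
  assumes small: "small_step \<eta>"
    and T0: "24 / (\<eta> * \<mu>) \<le> real T0" "real T0 \<le> 25 / (\<eta> * \<mu>)" and Tb: "7340 / (\<eta> * \<mu>) \<le> real Tb"
  shows "sq_mean (\<lambda>\<omega>. G (epoch_init g \<eta> T0 Tb \<theta>0 (\<lambda>t. \<xi> t \<omega>) b))
    \<le> (1 / 10) ^ b * (norm (G \<theta>0))\<^sup>2 + 2 * (\<mu> * (S + 1)) * \<eta>"
proof (induction b)
  have \<eta>: "\<eta> > 0" using small by (simp add: small_step_def)
  define q where "q = \<mu> * (S + 1) * \<eta>"
  have q: "q \<ge> 0" unfolding q_def using \<mu>_pos S_nonneg \<eta> by simp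
  {
    case 0
    have eq: "2 * (\<mu> * (S + 1)) * \<eta> = 2 * q" by (simp add: q_def)
    show ?case unfolding eq using q by (simp add: prob_space)
  next
    case (Suc b)
    have "24 / (\<eta> * \<mu>) > 0" using \<eta> \<mu>_pos by simp
    then have T01: "T0 \<ge> 1" using T0(1) by linarith
    interpret E: sgd_epoch M P \<xi> g G \<theta>s \<mu> L l S "b * Tb" "\<lambda>\<omega>. epoch_init g \<eta> T0 Tb \<theta>0 (\<lambda>t. \<xi> t \<omega>) b" \<eta> T0
      by (rule sgd_epoch_epoch_init[OF \<eta> T01])
    have "sq_mean (\<lambda>\<omega>. G (E.th Tb \<omega>)) \<le> E.D / 10 + q"
      unfolding q_def by (rule E.epoch_contraction[OF small T0 Tb])
    moreover have "E.D \<le> (1 / 10) ^ b * (norm (G \<theta>0))\<^sup>2 + 2 * q"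
      using Suc by (simp add: E.D_def q_def)
    ultimately have "sq_mean (\<lambda>\<omega>. G (E.th Tb \<omega>)) \<le> (1 / 10) ^ b * (norm (G \<theta>0))\<^sup>2 / 10 + 2 * q"
      using q by linarith
    then show ?case by (simp add: q_def mult.assoc E.th_def)
  }
qed

section \<open>The limit law\<close>

lemma norm_iexp_diff_le: "norm (iexp a - iexp b) \<le> \<bar>a - b\<bar>"
proof -
  have "iexp a - iexp b = iexp b * (iexp (a - b) - 1)"
    by (simp add: algebra_simps exp_add[symmetric])
  also have "norm \<dots> = norm (iexp (a - b) - 1)" by (simp add: norm_mult)
  also have "\<dots> \<le> \<bar>a - b\<bar>" using iexp_approx1[of "a - b" 0] by simp
  finally show ?thesis .
qed

lemma norm_iexp_diff_le_2: "norm (iexp a - iexp b) \<le> 2"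
  by (rule order_trans[OF norm_triangle_ineq4]) simp

lemma le_one_plus_sq: "a \<le> 1 + a\<^sup>2" for a :: real
  using sum_squares_bound[of 1 a] zero_le_power2[of a] by (simp, smt (verit) power2_eq_square)

text \<open>Pointwise form of the delta method: away from the root the crude bound 2 is paid for by
  Markov's inequality, close to it the linearisation error is at most \<open>e\<close> times the distance.\<close>

lemma linearised_charfun_bound:
  fixes t \<theta> \<theta>s \<Sigma> :: "'a::euclidean_space" and n N :: real
  assumes H: "linear H" and Hi: "linear Hi" "\<And>x. norm (Hi x) \<le> K * norm x" "\<And>x. Hi (H x) = x"
    and taylor: "norm (\<theta> - \<theta>s) < d \<Longrightarrow> norm (G\<theta> - H (\<theta> - \<theta>s)) \<le> e * norm (\<theta> - \<theta>s)"
    and pos: "K \<ge> 0" "d > 0" "e > 0" "N > 0"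
  defines "V \<equiv> sqrt N *\<^sub>R G\<theta> + (1 / sqrt N) *\<^sub>R \<Sigma>"
  shows "norm (iexp (t \<bullet> (sqrt n *\<^sub>R (\<theta> - \<theta>s))) - iexp (t \<bullet> (- (1 / sqrt N) *\<^sub>R Hi \<Sigma>)))
    \<le> norm t * (\<bar>sqrt n - sqrt N\<bar> / sqrt N * (1 + N * (norm (\<theta> - \<theta>s))\<^sup>2)
        + K * (e + (norm V)\<^sup>2 / e) + K * e * (1 + N * (norm (\<theta> - \<theta>s))\<^sup>2))
      + 2 / d\<^sup>2 * (norm (\<theta> - \<theta>s))\<^sup>2"
    (is "?lhs \<le> ?b + ?f")
proof -
  let ?\<delta> = "\<theta> - \<theta>s"
  have sN: "sqrt N > 0" using pos by simp
  have b0: "?b \<ge> 0" using pos by simp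
  have f0: "?f \<ge> 0" by simp
  show ?thesis
  proof (cases "norm ?\<delta> < d")
    case False
    then have "d\<^sup>2 \<le> (norm ?\<delta>)\<^sup>2" using pos by (intro power_mono) auto
    then have "2 \<le> ?f" using pos by (simp add: field_simps)
    then show ?thesis using norm_iexp_diff_le_2[of "t \<bullet> (sqrt n *\<^sub>R ?\<delta>)" "t \<bullet> (- (1 / sqrt N) *\<^sub>R Hi \<Sigma>)"] b0 by linarith
  next
    case True
    interpret H: linear H by fact
    interpret Hi: linear Hi by fact
    let ?r = "G\<theta> - H ?\<delta>"
    \<comment> \<open>Inverting the linearisation leaves the noise sum as leading term and three
      errors: the mismatch of \<open>n\<close> and \<open>N\<close>, the vector \<open>V\<close>,
      and the Taylor remainder \<open>?r\<close>.\<close>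
    have "sqrt N *\<^sub>R ?\<delta> = Hi (H (sqrt N *\<^sub>R ?\<delta>))" by (simp add: Hi(3))
    also have "H (sqrt N *\<^sub>R ?\<delta>) = V - (1 / sqrt N) *\<^sub>R \<Sigma> - sqrt N *\<^sub>R ?r"
      unfolding H.scaleR by (simp add: V_def algebra_simps)
    also have "Hi (V - (1 / sqrt N) *\<^sub>R \<Sigma> - sqrt N *\<^sub>R ?r) = Hi V - (1 / sqrt N) *\<^sub>R Hi \<Sigma> - sqrt N *\<^sub>R Hi ?r"
      by (simp only: Hi.diff Hi.scaleR)
    finally have eq: "sqrt n *\<^sub>R ?\<delta> - (- (1 / sqrt N) *\<^sub>R Hi \<Sigma>) = (sqrt n - sqrt N) *\<^sub>R ?\<delta> + Hi V - sqrt N *\<^sub>R Hi ?r"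
      by (simp add: algebra_simps)
    have "norm (sqrt N *\<^sub>R Hi ?r) \<le> sqrt N * (K * (e * norm ?\<delta>))"
      using Hi(2)[of ?r] taylor[OF True] pos by (simp add: mult_left_mono order_trans[OF _ mult_left_mono])
    then have "norm (sqrt n *\<^sub>R ?\<delta> - (- (1 / sqrt N) *\<^sub>R Hi \<Sigma>))
       \<le> \<bar>sqrt n - sqrt N\<bar> * norm ?\<delta> + K * norm V + K * e * (sqrt N * norm ?\<delta>)"
      unfolding eq
    proof -
      assume r: "norm (sqrt N *\<^sub>R Hi ?r) \<le> sqrt N * (K * (e * norm ?\<delta>))"
      have "norm (x + y - z) \<le> norm x + norm y + norm z" for x y z :: 'a
        using norm_triangle_ineq4[of "x + y" z] norm_triangle_ineq[of x y] by linarith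
      note order_trans[OF this add_mono[OF add_mono[OF order_refl Hi(2)[of V]] r], of "(sqrt n - sqrt N) *\<^sub>R ?\<delta>"]
      then show "norm ((sqrt n - sqrt N) *\<^sub>R ?\<delta> + Hi V - sqrt N *\<^sub>R Hi ?r)
        \<le> \<bar>sqrt n - sqrt N\<bar> * norm ?\<delta> + K * norm V + K * e * (sqrt N * norm ?\<delta>)"
        by (simp add: mult.left_commute mult.assoc)
    qed
    also have "\<bar>sqrt n - sqrt N\<bar> * norm ?\<delta> = \<bar>sqrt n - sqrt N\<bar> / sqrt N * (sqrt N * norm ?\<delta>)" using sN by simp
    also have "\<bar>sqrt n - sqrt N\<bar> / sqrt N * (sqrt N * norm ?\<delta>) + K * norm V + K * e * (sqrt N * norm ?\<delta>)
      \<le> \<bar>sqrt n - sqrt N\<bar> / sqrt N * (1 + N * (norm ?\<delta>)\<^sup>2) + K * (e + (norm V)\<^sup>2 / e) + K * e * (1 + N * (norm ?\<delta>)\<^sup>2)"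
    proof -
      have 1: "sqrt N * norm ?\<delta> \<le> 1 + N * (norm ?\<delta>)\<^sup>2"
        using le_one_plus_sq[of "sqrt N * norm ?\<delta>"] pos by (simp add: power_mult_distrib)
      \<comment> \<open>Only second moments are available. The scaling by \<open>e\<close> splits
        the first power into \<open>e\<close>, small by choice, and a multiple of the square of
        \<open>norm V\<close>, small in the limit.\<close>
      have "norm V / e \<le> 1 + (norm V / e)\<^sup>2" by (rule le_one_plus_sq)
      then have "e * (norm V / e) \<le> e * (1 + (norm V / e)\<^sup>2)" using pos by (intro mult_left_mono) auto
      also have "\<dots> = e + (norm V)\<^sup>2 / e" using pos by (simp add: power_divide power2_eq_square distrib_left)
      finally have 2: "norm V \<le> e + (norm V)\<^sup>2 / e" using pos by simp
      show ?thesis using pos sN by (intro add_mono mult_left_mono 1 2) auto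
    qed
    finally have le: "norm (sqrt n *\<^sub>R ?\<delta> - (- (1 / sqrt N) *\<^sub>R Hi \<Sigma>)) \<le> \<bar>sqrt n - sqrt N\<bar> / sqrt N * (1 + N * (norm ?\<delta>)\<^sup>2) + K * (e + (norm V)\<^sup>2 / e) + K * e * (1 + N * (norm ?\<delta>)\<^sup>2)" .
    have "?lhs \<le> \<bar>t \<bullet> (sqrt n *\<^sub>R ?\<delta>) - t \<bullet> (- (1 / sqrt N) *\<^sub>R Hi \<Sigma>)\<bar>" by (rule norm_iexp_diff_le)
    also have "\<dots> = \<bar>t \<bullet> (sqrt n *\<^sub>R ?\<delta> - (- (1 / sqrt N) *\<^sub>R Hi \<Sigma>))\<bar>" by (simp only: inner_diff_right)
    also have "\<dots> \<le> norm t * norm (sqrt n *\<^sub>R ?\<delta> - (- (1 / sqrt N) *\<^sub>R Hi \<Sigma>))" by (rule Cauchy_Schwarz_ineq2)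
    also have "\<dots> \<le> ?b" by (rule mult_left_mono[OF le]) simp
    finally show ?thesis using f0 by linarith
  qed
qed

text \<open>The vector \<open>V\<close> of \<open>linearised_charfun_bound\<close> is
  \<open>(u - R) / sqrt N\<close>, with \<open>R\<close> the gap between \<open>m\<close> and the
  sum of gradients at the root. So \<open>v\<close> bounds its second moment, while \<open>q\<close>
  bounds \<open>N\<close> times the mean squared distance to the root.\<close>

lemma (in sgd_epoch) charfun_diff_bound:
  fixes t :: 'a and n :: real
  assumes H: "linear H" and Hi: "linear Hi" "\<And>x. norm (Hi x) \<le> K * norm x" "\<And>x. Hi (H x) = x"
    and taylor: "\<And>\<theta>. norm (\<theta> - \<theta>s) < d \<Longrightarrow> norm (G \<theta> - H (\<theta> - \<theta>s)) \<le> e * norm (\<theta> - \<theta>s)"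
    and pos: "K \<ge> 0" "d > 0" "e > 0"
    and q: "2 / \<mu>\<^sup>2 * (w (Suc T) + s (Suc T)) / real (Suc T) \<le> q"
    and v: "2 * (w (Suc T) + sq_mean (\<lambda>\<omega>. m (Suc T) \<omega> - (\<Sum>i = 1..Suc T. g \<theta>s (\<xi> (c + i) \<omega>)))) / real (Suc T) \<le> v"
  defines "N \<equiv> real (Suc T)"
  shows "norm (expectation (\<lambda>\<omega>. iexp (t \<bullet> (sqrt n *\<^sub>R (th T \<omega> - \<theta>s))))
      - expectation (\<lambda>\<omega>. iexp (t \<bullet> (- (1 / sqrt N) *\<^sub>R Hi (\<Sum>i = 1..Suc T. g \<theta>s (\<xi> (c + i) \<omega>))))))
    \<le> norm t * (\<bar>sqrt n - sqrt N\<bar> / sqrt N * (1 + q) + K * (e + v / e) + K * e * (1 + q)) + 2 / d\<^sup>2 * (q / N)"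
proof -
  let ?\<Sigma> = "\<lambda>\<omega>. \<Sum>i = 1..Suc T. g \<theta>s (\<xi> (c + i) \<omega>)"
  let ?R = "\<lambda>\<omega>. m (Suc T) \<omega> - ?\<Sigma> \<omega>"
  let ?V = "\<lambda>\<omega>. sqrt N *\<^sub>R G (th T \<omega>) + (1 / sqrt N) *\<^sub>R ?\<Sigma> \<omega>"
  let ?X = "\<lambda>\<omega>. t \<bullet> (sqrt n *\<^sub>R (th T \<omega> - \<theta>s))" and ?Y = "\<lambda>\<omega>. t \<bullet> (- (1 / sqrt N) *\<^sub>R Hi (?\<Sigma> \<omega>))"
  have N: "N > 0" "sqrt N > 0" by (auto simp: N_def)
  have sqN: "sqrt N * sqrt N = N" using N by simp
  have V_eq: "?V \<omega> = (1 / sqrt N) *\<^sub>R (u (Suc T) \<omega> - ?R \<omega>)" for \<omega>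
  proof -
    have "u (Suc T) \<omega> - ?R \<omega> = N *\<^sub>R G (th T \<omega>) + ?\<Sigma> \<omega>"
      using u_eq[of "Suc T" \<omega>] by (simp add: N_def)
    moreover have "(1 / sqrt N) *\<^sub>R (N *\<^sub>R G (th T \<omega>)) = sqrt N *\<^sub>R G (th T \<omega>)"
      using N sqN by (simp add: real_div_sqrt)
    ultimately show ?thesis by (simp only: scaleR_add_right)
  qed
  have R_sq: "sq_integrable ?R" using remainder_sq_mean[of "Suc T"] by simp
  have V_sq: "sq_integrable ?V" unfolding V_eq
    by (intro sq_integrable_scaleR sq_integrable_diff u_sq R_sq)
  have EV: "sq_mean ?V \<le> v"
  proof -
    have "sq_mean ?V = expectation (\<lambda>\<omega>. (norm (u (Suc T) \<omega> - ?R \<omega>))\<^sup>2 / N)"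
      unfolding V_eq using N by (simp add: power_mult_distrib power_divide)
    also have "\<dots> = sq_mean (\<lambda>\<omega>. u (Suc T) \<omega> - ?R \<omega>) / N" by simp
    also have "\<dots> \<le> (2 * w (Suc T) + 2 * sq_mean ?R) / N"
      unfolding w_def using N by (intro divide_right_mono sq_mean_diff_le u_sq R_sq) simp
    also have "\<dots> \<le> v" using v by (simp add: N_def)
    finally show ?thesis .
  qed
  have \<delta>_sq: "sq_integrable (\<lambda>\<omega>. th T \<omega> - \<theta>s)"
    by (intro sq_integrable_diff th_sq sq_integrable_const)
  have E\<delta>: "N * sq_mean (\<lambda>\<omega>. th T \<omega> - \<theta>s) \<le> q"
  proof -
    have "N * sq_mean (\<lambda>\<omega>. th T \<omega> - \<theta>s) \<le> N * (2 * (w (Suc T) + s (Suc T)) / N\<^sup>2 / \<mu>\<^sup>2)"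
      using order_trans[OF dist_sq_mean_le[OF th_sq] divide_right_mono[OF grad_sq_mean_le[of "Suc T"]]] N
      by (intro mult_left_mono) (auto simp: N_def)
    also have "\<dots> = 2 / \<mu>\<^sup>2 * (w (Suc T) + s (Suc T)) / N" using N by (simp add: power2_eq_square)
    also have "\<dots> \<le> q" using q by (simp add: N_def)
    finally show ?thesis .
  qed
  have iV: "integrable M (\<lambda>\<omega>. (norm (?V \<omega>))\<^sup>2)" and i\<delta>: "integrable M (\<lambda>\<omega>. (norm (th T \<omega> - \<theta>s))\<^sup>2)"
    using V_sq \<delta>_sq by (auto simp: sq_integrable_def)
  have [measurable]: "random_variable borel (th T)" using th_sq[of T] by (simp add: sq_integrable_def)
  have [measurable]: "random_variable P (\<xi> (c + i))" if "i \<in> {1..Suc T}" for i using that \<xi>_rv by simp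
  have [measurable]: "Hi \<in> borel_measurable borel"
    using Hi(1) by (auto intro!: borel_measurable_continuous_onI linear_continuous_on simp: linear_conv_bounded_linear)
  have \<Sigma>_rv: "random_variable borel ?\<Sigma>" by measurable
  have iX: "integrable M (\<lambda>\<omega>. iexp (?X \<omega>))" by (rule integrable_iexp) auto
  have Y_rv: "random_variable borel ?Y"
    by (intro borel_measurable_inner borel_measurable_const borel_measurable_scaleR measurable_compose[OF \<Sigma>_rv]) simp
  have iY: "integrable M (\<lambda>\<omega>. iexp (?Y \<omega>))"
    by (rule integrable_const_bound[where B=1, OF _ iexp_inner_measurable[OF Y_rv]]) simp
  let ?b = "\<lambda>\<omega>. norm t * (\<bar>sqrt n - sqrt N\<bar> / sqrt N * (1 + N * (norm (th T \<omega> - \<theta>s))\<^sup>2)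
        + K * (e + (norm (?V \<omega>))\<^sup>2 / e) + K * e * (1 + N * (norm (th T \<omega> - \<theta>s))\<^sup>2))
      + 2 / d\<^sup>2 * (norm (th T \<omega> - \<theta>s))\<^sup>2"
  have ib: "integrable M ?b" using iV i\<delta> by simp
  have "norm (expectation (\<lambda>\<omega>. iexp (?X \<omega>)) - expectation (\<lambda>\<omega>. iexp (?Y \<omega>)))
    = norm (expectation (\<lambda>\<omega>. iexp (?X \<omega>) - iexp (?Y \<omega>)))" using iX iY by simp
  also have "\<dots> \<le> expectation (\<lambda>\<omega>. norm (iexp (?X \<omega>) - iexp (?Y \<omega>)))" by (rule integral_norm_bound)
  also have "\<dots> \<le> expectation ?b"
    by (rule integral_mono[OF integrable_norm[OF Bochner_Integration.integrable_diff[OF iX iY]] ib])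
       (rule linearised_charfun_bound[OF H Hi taylor pos N(1)])
  also have "\<dots> = norm t * (\<bar>sqrt n - sqrt N\<bar> / sqrt N * (1 + N * sq_mean (\<lambda>\<omega>. th T \<omega> - \<theta>s))
        + K * (e + sq_mean ?V / e) + K * e * (1 + N * sq_mean (\<lambda>\<omega>. th T \<omega> - \<theta>s)))
      + 2 / d\<^sup>2 * sq_mean (\<lambda>\<omega>. th T \<omega> - \<theta>s)"
    using iV i\<delta> by (simp add: prob_space)
  also have "\<dots> \<le> norm t * (\<bar>sqrt n - sqrt N\<bar> / sqrt N * (1 + q) + K * (e + v / e) + K * e * (1 + q)) + 2 / d\<^sup>2 * (q / N)"
    using E\<delta> EV pos N
    by (intro add_mono mult_left_mono divide_right_mono) (auto simp: field_simps)
  finally show ?thesis .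
qed

text \<open>For fixed \<open>e\<close>, with a Taylor radius \<open>d\<close> that depends on
  \<open>e\<close> but not on \<open>k\<close>, the bound of \<open>charfun_diff_bound\<close> tends
  to a multiple of \<open>e\<close>; then \<open>e\<close> is made small. \<open>n\<close> may
  replace \<open>N\<close> because the short epochs use a vanishing share of the samples.\<close>

lemma (in noisy_gradient) multi_epoch_charfun_diff:
  fixes n T0 Tb B :: "nat \<Rightarrow> nat" and \<eta> :: "nat \<Rightarrow> real" and \<theta>0 t :: 'a
  assumes \<eta>_pos: "\<And>k. \<eta> k > 0" and \<eta>_lim: "\<eta> \<longlonglongrightarrow> 0"
    and T0_eq: "\<And>k. T0 k = nat \<lceil>24 / (\<eta> k * \<mu>)\<rceil>" and Tb_eq: "\<And>k. Tb k = nat \<lceil>7340 / (\<eta> k * \<mu>)\<rceil>"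
    and B: "\<And>k. (1 / 10) ^ B k * (norm (G \<theta>0))\<^sup>2 \<le> C0 * \<eta> k" and C0: "C0 \<ge> 0"
    and n_lim: "filterlim n at_top sequentially"
    and T_lim: "filterlim (\<lambda>k. \<eta> k * (real (n k) - real (Tb k) * real (B k))) at_top sequentially"
    and short_lim: "(\<lambda>k. real (Tb k) * real (B k) / real (n k)) \<longlonglongrightarrow> 0"
    and H: "(G has_derivative H) (at \<theta>s)" and Hi: "linear Hi" "\<And>x. Hi (H x) = x"
  defines "N \<equiv> \<lambda>k. Suc (n k - Tb k * B k)"
  shows "filterlim N at_top sequentially"
    and "(\<lambda>k. expectation (\<lambda>\<omega>. iexp (t \<bullet> (sqrt (real (n k)) *\<^sub>R
            (multi_root_sgd g (\<eta> k) (T0 k) (Tb k) (B k) \<theta>0 (\<lambda>t. \<xi> t \<omega>) (n k) - \<theta>s))))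
        - expectation (\<lambda>\<omega>. iexp (t \<bullet> (- (1 / sqrt (real (N k))) *\<^sub>R Hi (\<Sum>i = 1..N k. g \<theta>s (\<xi> (B k * Tb k + i) \<omega>))))))
      \<longlonglongrightarrow> 0"
proof -
  \<comment> \<open>The length of the last epoch as a real number. It is eventually positive, and
    only then does it agree with the truncated subtraction in \<open>N\<close>.\<close>
  define a where "a = (\<lambda>k. real (n k) - real (Tb k) * real (B k))"
  have small: "\<forall>\<^sub>F k in sequentially. small_step (\<eta> k)" by (rule eventually_small_step[OF \<eta>_pos \<eta>_lim])
  have \<eta>1: "\<forall>\<^sub>F k in sequentially. \<eta> k < 1" by (rule order_tendstoD(2)[OF \<eta>_lim]) simp
  have \<eta>a: "\<forall>\<^sub>F k in sequentially. \<eta> k * a k \<ge> z" for z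
    using T_lim unfolding a_def filterlim_at_top by auto
  have a_pos: "\<forall>\<^sub>F k in sequentially. a k > 0"
    using \<eta>a[of 1]
  proof eventually_elim
    case (elim k)
    then show ?case using \<eta>_pos[of k] by (smt (verit) mult_nonneg_nonpos)
  qed
  have N_eq: "\<forall>\<^sub>F k in sequentially. real (N k) = a k + 1"
    using a_pos
  proof eventually_elim
    case (elim k)
    then have "real (Tb k * B k) \<le> real (n k)" by (simp add: a_def)
    then show ?case by (simp add: N_def a_def of_nat_diff del: of_nat_mult)
       (simp add: of_nat_diff)
  qed
  have a_lim: "filterlim a at_top sequentially"
  proof (rule filterlim_at_top_mono[OF T_lim])
    show "\<forall>\<^sub>F k in sequentially. \<eta> k * (real (n k) - real (Tb k) * real (B k)) \<le> a k"
      using a_pos \<eta>1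
    proof eventually_elim
      case (elim k)
      have "\<eta> k * a k \<le> 1 * a k" using elim by (intro mult_right_mono) auto
      then show ?case by (simp add: a_def)
    qed
  qed
  have N_lim': "filterlim (\<lambda>k. real (N k)) at_top sequentially"
  proof (rule filterlim_at_top_mono[OF a_lim])
    show "\<forall>\<^sub>F k in sequentially. a k \<le> real (N k)" using N_eq by eventually_elim simp
  qed
  then show "filterlim N at_top sequentially"
    using filterlim_real_sequentially unfolding filterlim_at_top
    by (metis (mono_tags, lifting) eventually_mono of_nat_le_iff)
  have \<eta>N_lim: "filterlim (\<lambda>k. \<eta> k * real (N k)) at_top sequentially"
  proof (rule filterlim_at_top_mono[OF T_lim])
    show "\<forall>\<^sub>F k in sequentially. \<eta> k * (real (n k) - real (Tb k) * real (B k)) \<le> \<eta> k * real (N k)"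
      using N_eq by eventually_elim (use \<eta>_pos in \<open>auto simp: a_def intro!: mult_left_mono less_imp_le\<close>)
  qed
  have n_lim': "filterlim (\<lambda>k. real (n k)) at_top sequentially"
    using filterlim_compose[OF filterlim_real_sequentially n_lim] .
  have n_pos: "\<forall>\<^sub>F k in sequentially. real (n k) > 0"
    using n_lim' unfolding filterlim_at_top_dense by (rule spec)
  have ratio: "(\<lambda>k. \<bar>sqrt (real (n k)) - sqrt (real (N k))\<bar> / sqrt (real (N k))) \<longlonglongrightarrow> 0"
  proof -
    have "(\<lambda>k. 1 - real (Tb k) * real (B k) / real (n k) + 1 / real (n k)) \<longlonglongrightarrow> 1 - 0 + 0"
      by (intro tendsto_intros short_lim tendsto_divide_0[OF tendsto_const] filterlim_at_top_imp_at_infinity n_lim')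
    moreover have "\<forall>\<^sub>F k in sequentially. 1 - real (Tb k) * real (B k) / real (n k) + 1 / real (n k) = real (N k) / real (n k)"
      using N_eq n_pos by eventually_elim (simp add: a_def field_simps)
    ultimately have "(\<lambda>k. real (N k) / real (n k)) \<longlonglongrightarrow> 1"
      by (auto intro: Lim_transform_eventually)
    then have "(\<lambda>k. \<bar>sqrt (inverse (real (N k) / real (n k))) - 1\<bar>) \<longlonglongrightarrow> \<bar>sqrt (inverse 1) - 1\<bar>"
      by (intro tendsto_intros) auto
    moreover have "\<bar>sqrt (inverse (real (N k) / real (n k))) - 1\<bar> = \<bar>sqrt (real (n k)) - sqrt (real (N k))\<bar> / sqrt (real (N k))" for k
    proof -
      have "sqrt (inverse (real (N k) / real (n k))) - 1 = (sqrt (real (n k)) - sqrt (real (N k))) / sqrt (real (N k))"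
        by (simp add: real_sqrt_divide N_def diff_divide_distrib)
      then show ?thesis by (simp add: N_def abs_divide)
    qed
    ultimately show ?thesis by simp
  qed
  \<comment> \<open>Two sources of the initial gradient of the last epoch: what the short epochs
    leave of the gradient at \<open>\<theta>0\<close>, and their noise floor.\<close>
  define C where "C = C0 + 2 * (\<mu> * (S + 1))"
  have C: "C \<ge> 0" using C0 \<mu>_pos S_nonneg by (simp add: C_def)
  define A' where "A' = 4 * S + (C + 1)"
  have A': "A' \<ge> 0" using C S_nonneg by (simp add: A'_def)
  define q where "q = 2 / \<mu>\<^sup>2 * (W * (C + 1) + A')"
  have q0: "q \<ge> 0" unfolding q_def using C A' W_pos by simp
  define R1 where "R1 = 50 * l\<^sup>2 * C / \<mu> ^ 3"
  define R2 where "R2 = 2 * l\<^sup>2 * (5 * W * (C + 1) + A' / \<mu>)"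
  \<comment> \<open>The three terms come from \<open>u\<close>, from the burn-in part of the
    remainder and from its later part, each divided by \<open>N k\<close>.\<close>
  define v where "v = (\<lambda>k. 2 * (W * (C + 1) * (1 / (\<eta> k * real (N k))) + R1 * (1 / real (N k)) + R2 * \<eta> k))"
  have inv_N: "(\<lambda>k. 1 / real (N k)) \<longlonglongrightarrow> 0" "(\<lambda>k. 1 / (\<eta> k * real (N k))) \<longlonglongrightarrow> 0"
    by (intro tendsto_divide_0[OF tendsto_const] filterlim_at_top_imp_at_infinity N_lim' \<eta>N_lim)+
  have v_lim: "v \<longlonglongrightarrow> 0"
  proof -
    have "v \<longlonglongrightarrow> 2 * (W * (C + 1) * 0 + R1 * 0 + R2 * 0)"
      unfolding v_def by (intro tendsto_intros inv_N \<eta>_lim)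
    then show ?thesis by simp
  qed
  have linH: "linear H" using H by (rule has_derivative_linear)
  obtain K where K: "K > 0" "\<And>x. norm (Hi x) \<le> K * norm x"
    using linear_bounded_pos[OF Hi(1)] by (auto simp: mult.commute)
  let ?X = "\<lambda>k. expectation (\<lambda>\<omega>. iexp (t \<bullet> (sqrt (real (n k)) *\<^sub>R
            (multi_root_sgd g (\<eta> k) (T0 k) (Tb k) (B k) \<theta>0 (\<lambda>t. \<xi> t \<omega>) (n k) - \<theta>s))))"
  let ?Y = "\<lambda>k. expectation (\<lambda>\<omega>. iexp (t \<bullet> (- (1 / sqrt (real (N k))) *\<^sub>R Hi (\<Sum>i = 1..N k. g \<theta>s (\<xi> (B k * Tb k + i) \<omega>)))))"
  let ?\<beta> = "\<lambda>d e k. norm t * (\<bar>sqrt (real (n k)) - sqrt (real (N k))\<bar> / sqrt (real (N k)) * (1 + q)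
      + K * (e + v k / e) + K * e * (1 + q)) + 2 / d\<^sup>2 * (q * (1 / real (N k)))"
  have step: "\<forall>\<^sub>F k in sequentially. norm (?X k - ?Y k) \<le> ?\<beta> d e k"
    if d: "d > 0" and e: "e > 0" and taylor: "\<And>\<theta>. norm (\<theta> - \<theta>s) < d \<Longrightarrow> norm (G \<theta> - H (\<theta> - \<theta>s)) \<le> e * norm (\<theta> - \<theta>s)" for d e
    using small N_eq \<eta>a[of "25 / \<mu> + 1"] a_pos
  proof eventually_elim
    case (elim k)
    have \<eta>\<mu>: "\<eta> k * \<mu> \<le> 1" "\<eta> k * \<mu> > 0" using elim(1) \<mu>_pos by (auto simp: small_step_def)
    have T0: "24 / (\<eta> k * \<mu>) \<le> real (T0 k)" "real (T0 k) \<le> 25 / (\<eta> k * \<mu>)"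
    proof -
      show "24 / (\<eta> k * \<mu>) \<le> real (T0 k)" unfolding T0_eq by (rule of_nat_ceiling)
      have "24 / (\<eta> k * \<mu>) \<ge> 0" using \<eta>\<mu> by simp
      then have "real (T0 k) \<le> 24 / (\<eta> k * \<mu>) + 1" unfolding T0_eq by linarith
      also have "1 \<le> 1 / (\<eta> k * \<mu>)" using \<eta>\<mu> by simp
      finally show "real (T0 k) \<le> 25 / (\<eta> k * \<mu>)" by (simp add: add_divide_distrib[symmetric])
    qed
    have "24 / (\<eta> k * \<mu>) > 0" using \<eta>\<mu> by simp
    then have T01: "T0 k \<ge> 1" using T0(1) by linarith
    have Tb: "7340 / (\<eta> k * \<mu>) \<le> real (Tb k)" unfolding Tb_eq by (rule of_nat_ceiling)
    note ME = multi_epoch[OF elim(1) T0 Tb, of \<theta>0 "B k"]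
    let ?e = "\<lambda>\<omega>. epoch_init g (\<eta> k) (T0 k) (Tb k) \<theta>0 (\<lambda>t. \<xi> t \<omega>) (B k)"
    interpret E: sgd_epoch M P \<xi> g G \<theta>s \<mu> L l S "B k * Tb k" ?e "\<eta> k" "T0 k"
      using sgd_epoch_epoch_init[OF \<eta>_pos T01] by simp
    have "E.D \<le> (1 / 10) ^ B k * (norm (G \<theta>0))\<^sup>2 + 2 * (\<mu> * (S + 1)) * \<eta> k"
      unfolding E.D_def using ME by simp
    also have "\<dots> \<le> C * \<eta> k" using B[of k] by (simp add: C_def algebra_simps)
    finally have D: "E.D \<le> C * \<eta> k" .
    define T where "T = n k - Tb k * B k"
    have NT: "N k = Suc T" by (simp add: N_def T_def)
    have "25 / (\<eta> k * \<mu>) \<le> a k" 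
    proof -
      have "25 / \<mu> \<le> \<eta> k * a k" using elim(3) by simp
      then show ?thesis using \<eta>_pos[of k] \<mu>_pos by (simp add: field_simps)
    qed
    then have "real (T0 k) \<le> real (N k)" using T0(2) elim(2) by simp
    then have T: "T0 k \<le> Suc T" by (simp add: NT)
    note FB = E.final_bounds(1,2)[OF elim(1) T0 D C T]
    note FR = E.final_remainder[OF elim(1) T0 D C, of "Suc T"]
    have Npos: "real (Suc T) > 0" by simp
    have \<eta>N1: "\<eta> k * real (Suc T) \<ge> 1"
    proof -
      have "25 / \<mu> \<ge> 0" using \<mu>_pos by simp
      then have "1 \<le> \<eta> k * a k" using elim(3) by linarith
      also have "\<dots> \<le> \<eta> k * real (Suc T)" using elim(2) \<eta>_pos[of k] by (simp add: NT)
      finally show ?thesis .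
    qed
    have qb: "2 / \<mu>\<^sup>2 * (E.w (Suc T) + E.s (Suc T)) / real (Suc T) \<le> q"
    proof -
      have "(E.w (Suc T) + E.s (Suc T)) / real (Suc T) \<le> (W * (C + 1) / \<eta> k + real (Suc T) * A') / real (Suc T)"
        using FB by (intro divide_right_mono add_mono) (auto simp: A'_def)
      also have "\<dots> = W * (C + 1) * (1 / (\<eta> k * real (Suc T))) + A'" using Npos by (simp add: add_divide_distrib del: of_nat_Suc)
      also have "\<dots> \<le> W * (C + 1) * 1 + A'"
        using \<eta>N1 W_pos C by (intro add_right_mono mult_left_mono) (auto simp del: of_nat_Suc)
      finally have "2 / \<mu>\<^sup>2 * ((E.w (Suc T) + E.s (Suc T)) / real (Suc T)) \<le> q"
        unfolding q_def by (intro mult_left_mono) auto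
      then show ?thesis by simp
    qed
    have vb: "2 * (E.w (Suc T) + sq_mean (\<lambda>\<omega>. E.m (Suc T) \<omega> - (\<Sum>i = 1..Suc T. g \<theta>s (\<xi> (B k * Tb k + i) \<omega>)))) / real (Suc T) \<le> v k"
    proof -
      have "2 * (E.w (Suc T) + sq_mean (\<lambda>\<omega>. E.m (Suc T) \<omega> - (\<Sum>i = 1..Suc T. g \<theta>s (\<xi> (B k * Tb k + i) \<omega>)))) / real (Suc T)
        \<le> 2 * (W * (C + 1) / \<eta> k + (R1 + R2 * \<eta> k * real (Suc T))) / real (Suc T)"
        using FB(1) FR unfolding R1_def R2_def A'_def by (intro divide_right_mono mult_left_mono add_mono) auto
      also have "\<dots> = v k"
        unfolding v_def NT using Npos by (simp add: add_divide_distrib del: of_nat_Suc)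
      finally show ?thesis .
    qed
    have "multi_root_sgd g (\<eta> k) (T0 k) (Tb k) (B k) \<theta>0 (\<lambda>t. \<xi> t \<omega>) (n k) = E.th T \<omega>" for \<omega>
      by (simp add: multi_root_sgd_def E.th_def T_def)
    then show ?case
      using E.charfun_diff_bound[OF linH Hi(1) K(2) Hi(2) taylor less_imp_le[OF K(1)] d e qb vb, of t "real (n k)"]
      by (simp add: NT)
  qed
  show "(\<lambda>k. ?X k - ?Y k) \<longlonglongrightarrow> 0"
  proof (rule LIMSEQ_I)
    fix r :: real assume r: "r > 0"
    \<comment> \<open>The limit of the bound is \<open>norm t * K * (2 + q) * e\<close>; the added 1
      guards against \<open>t = 0\<close>.\<close>
    define e where "e = r / (2 * (norm t * K * (2 + q) + 1))"
    have den: "norm t * K * (2 + q) \<ge> 0" using K q0 by simp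
    have e: "e > 0" using r den by (simp add: e_def)
    obtain d where d: "d > 0" "\<And>y. norm (y - \<theta>s) < d \<Longrightarrow> norm (G y - G \<theta>s - H (y - \<theta>s)) \<le> e * norm (y - \<theta>s)"
      using has_derivative_at_alt[THEN iffD1, OF H] e by blast
    have "?\<beta> d e \<longlonglongrightarrow> norm t * (0 * (1 + q) + K * (e + 0 / e) + K * e * (1 + q)) + 2 / d\<^sup>2 * (q * 0)"
      using e by (intro tendsto_intros ratio v_lim inv_N) auto
    moreover have "norm t * (0 * (1 + q) + K * (e + 0 / e) + K * e * (1 + q)) + 2 / d\<^sup>2 * (q * 0) < r"
    proof -
      have "norm t * K * (2 + q) * e < r"
      proof -
        have "(x + 1) * (r / (2 * (x + 1))) = r / 2" if "x \<ge> 0" for x :: real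
          using that by (simp add: field_simps)
        from this[OF den] have "(norm t * K * (2 + q) + 1) * e = r / 2" by (simp only: e_def)
        then show ?thesis using r e by (simp add: distrib_right)
      qed
      then show ?thesis by (simp add: algebra_simps)
    qed
    ultimately have "\<forall>\<^sub>F k in sequentially. ?\<beta> d e k < r" by (rule order_tendstoD(2))
    moreover have "\<forall>\<^sub>F k in sequentially. norm (?X k - ?Y k) \<le> ?\<beta> d e k"
      using step[OF d(1) e] d(2) by (simp add: G_root)
    ultimately have "\<forall>\<^sub>F k in sequentially. norm (?X k - ?Y k - 0) < r"
      by eventually_elim simp
    then show "\<exists>k0. \<forall>k\<ge>k0. norm (?X k - ?Y k - 0) < r" by (simp only: eventually_sequentially)
  qed
qed

theorem theorem4:
  fixes P :: "'x measure" and M :: "'w measure" and \<xi> :: "nat \<Rightarrow> 'w \<Rightarrow> 'x"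
    and f :: "real^'d \<Rightarrow> 'x \<Rightarrow> real" and F :: "real^'d \<Rightarrow> real"
    and \<mu> L l\<^sub>\<Xi> :: real and \<theta>s \<theta>0 :: "real^'d"
    and n T0 Tb B :: "nat \<Rightarrow> nat" and \<eta> :: "nat \<Rightarrow> real"
  assumes "prob_space P" and "prob_space M"
    and iid: "prob_space.indep_vars M (\<lambda>_. P) \<xi> {1..}" "\<And>t. t \<ge> 1 \<Longrightarrow> distr M P (\<xi> t) = P"
    and f_diff: "\<And>x \<theta>. x \<in> space P \<Longrightarrow> (\<lambda>\<theta>'. f \<theta>' x) differentiable (at \<theta>)"
    and F_def: "\<And>\<theta>. integrable P (f \<theta>)" "\<And>\<theta>. F \<theta> = (\<integral>x. f \<theta> x \<partial>P)"
    and F_grad: "\<And>\<theta>. integrable P (stoch_grad f \<theta>)"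
      "\<And>\<theta>. gradient F \<theta> = (\<integral>x. stoch_grad f \<theta> x \<partial>P)"
    and F_C2: "twice_cont_differentiable F"
    and const: "0 < \<mu>" "\<mu> \<le> L"
    and F_smooth: "\<And>\<theta> \<theta>'. norm (gradient F \<theta> - gradient F \<theta>') \<le> L * norm (\<theta> - \<theta>')"
    and F_strong: "\<And>\<theta> \<theta>'. (gradient F \<theta> - gradient F \<theta>') \<bullet> (\<theta> - \<theta>') \<ge> \<mu> * (norm (\<theta> - \<theta>'))\<^sup>2"
    and minimizer: "\<And>\<theta>. F \<theta>s \<le> F \<theta>"
    and finite_trace: "integrable P (\<lambda>x. (norm (stoch_grad f \<theta>s x))\<^sup>2)"
    and Sigma_pd: "pos_definite (grad_second_moment P f \<theta>s)"
    and "l\<^sub>\<Xi> > 0"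
    and noise_integrable:
      "\<And>\<theta> \<theta>'. integrable P (\<lambda>x. (norm (grad_noise f F \<theta> x - grad_noise f F \<theta>' x))\<^sup>2)"
    and noise_lipschitz:
      "\<And>\<theta> \<theta>'. (\<integral>x. (norm (grad_noise f F \<theta> x - grad_noise f F \<theta>' x))\<^sup>2 \<partial>P)
         \<le> l\<^sub>\<Xi>\<^sup>2 * (norm (\<theta> - \<theta>'))\<^sup>2"
    and hess_cont: "((\<lambda>\<theta>. op_norm (hessian F \<theta> - hessian F \<theta>s)) \<longlongrightarrow> 0) (at \<theta>s)"
    and \<eta>_pos: "\<And>k. \<eta> k > 0"
    and T0_eq: "\<And>k. T0 k = nat \<lceil>24 / (\<eta> k * \<mu>)\<rceil>"
    and Tb_eq: "\<And>k. Tb k = nat \<lceil>7340 / (\<eta> k * \<mu>)\<rceil>"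
    and B_eq: "\<And>k. B k = (if gradient F \<theta>0 = 0 then 0 else
      nat \<lceil>1 / 2 * ln (exp 1 * (norm (gradient F \<theta>0))\<^sup>2 / (\<eta> k * \<mu> * grad_mean_square P f \<theta>s))\<rceil>)"
    and n_lim: "filterlim n at_top sequentially"
    and \<eta>_lim: "\<eta> \<longlonglongrightarrow> 0"
    and T_lim: "filterlim
      (\<lambda>k. \<eta> k * (real (n k) - real (Tb k) * real (B k))) at_top sequentially"
    and short_lim: "(\<lambda>k. real (Tb k) * real (B k) / real (n k)) \<longlonglongrightarrow> 0"
  shows "weak_convergence
    (\<lambda>k. distr M borel (\<lambda>\<omega>. sqrt (real (n k)) *\<^sub>R
       (multi_root_sgd (stoch_grad f) (\<eta> k) (T0 k) (Tb k) (B k)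
          \<theta>0 (\<lambda>t. \<xi> t \<omega>) (n k) - \<theta>s)))
    (multi_normal 0
       (matrix_inv (hessian F \<theta>s) ** grad_second_moment P f \<theta>s ** matrix_inv (hessian F \<theta>s)))"
proof -
  define G where "G = gradient F"
  define g where "g = stoch_grad f"
  define S where "S = grad_mean_square P f \<theta>s"
  define \<Sigma> where "\<Sigma> = grad_second_moment P f \<theta>s"
  define H where "H = hessian F \<theta>s"
  interpret P: prob_space P by fact
  interpret M: prob_space M by fact
  have F_diff: "F differentiable (at x)" for x
    using F_C2 by (simp add: twice_cont_differentiable_def)
  have G_root: "G \<theta>s = 0"
    unfolding G_def by (rule gradient_at_minimum[OF F_diff minimizer])
  have g_meas: "(\<lambda>(\<theta>, x). g \<theta> x) \<in> borel_measurable (borel \<Otimes>\<^sub>M P)"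
    unfolding g_def by (rule stoch_grad_measurable[OF borel_measurable_integrable[OF F_def(1)] f_diff])
  interpret noisy_gradient M P \<xi> g G \<theta>s \<mu> L l\<^sub>\<Xi> S
  proof unfold_locales
    show "(\<lambda>(\<theta>, x). g \<theta> x) \<in> borel_measurable (borel \<Otimes>\<^sub>M P)" by (rule g_meas)
  qed (use assms G_root in \<open>simp_all add: g_def G_def S_def grad_noise_def grad_mean_square_def\<close>)

  have \<Sigma>_inner: "integrable P (\<lambda>x. (b \<bullet> g \<theta>s x)\<^sup>2)" "(\<integral>x. (b \<bullet> g \<theta>s x)\<^sup>2 \<partial>P) = b \<bullet> (\<Sigma> *v b)" for b
  proof -
    have [measurable]: "g \<theta>s \<in> borel_measurable P" using g_int by auto
    have [measurable]: "(\<lambda>v :: real^'d. v $ i) \<in> borel_measurable borel" for i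
      by (intro borel_measurable_continuous_onI continuous_intros)
    have ij: "integrable P (\<lambda>x. g \<theta>s x $ i * g \<theta>s x $ j)" for i j
    proof (rule Bochner_Integration.integrable_bound[OF star_int])
      show "AE x in P. norm (g \<theta>s x $ i * g \<theta>s x $ j) \<le> norm ((norm (g \<theta>s x))\<^sup>2)"
        by (intro AE_I2) (simp add: abs_mult power2_eq_square mult_mono component_le_norm_cart)
    qed measurable
    have eq: "(b \<bullet> g \<theta>s x)\<^sup>2 = (\<Sum>i\<in>UNIV. \<Sum>j\<in>UNIV. b $ i * b $ j * (g \<theta>s x $ i * g \<theta>s x $ j))" for x
      by (simp add: inner_vec_def power2_eq_square sum_product ac_simps)
    show "integrable P (\<lambda>x. (b \<bullet> g \<theta>s x)\<^sup>2)" unfolding eq using ij by simp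
    show "(\<integral>x. (b \<bullet> g \<theta>s x)\<^sup>2 \<partial>P) = b \<bullet> (\<Sigma> *v b)"
      unfolding eq using ij
      by (simp add: \<Sigma>_def grad_second_moment_def g_def[symmetric] inner_vec_def matrix_vector_mult_def
          sum_distrib_left ac_simps)
  qed
  have \<Sigma>_pos: "b \<noteq> 0 \<Longrightarrow> b \<bullet> (\<Sigma> *v b) > 0" for b
    using Sigma_pd by (simp add: pos_definite_def \<Sigma>_def)
  \<comment> \<open>The formula for \<open>B\<close> divides by \<open>S\<close>, which is at least
    any diagonal entry of the positive definite \<Sigma>.\<close>
  have S_pos: "S > 0"
  proof -
    let ?b = "axis undefined 1 :: real^'d"
    have "0 < (\<integral>x. (?b \<bullet> g \<theta>s x)\<^sup>2 \<partial>P)" unfolding \<Sigma>_inner by (rule \<Sigma>_pos) (simp add: axis_eq_0_iff)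
    also have "\<dots> \<le> (\<integral>x. (norm (g \<theta>s x))\<^sup>2 \<partial>P)"
    proof (rule integral_mono[OF \<Sigma>_inner(1) star_int])
      fix x
      have "\<bar>?b \<bullet> g \<theta>s x\<bar> \<le> norm (g \<theta>s x)" by (simp add: inner_axis' component_le_norm_cart)
      then show "(?b \<bullet> g \<theta>s x)\<^sup>2 \<le> (norm (g \<theta>s x))\<^sup>2" by (simp add: abs_le_square_iff[symmetric])
    qed
    also have "\<dots> \<le> S" by (rule star_le)
    finally show ?thesis .
  qed

  have H_deriv: "(G has_derivative (\<lambda>v. H *v v)) (at \<theta>s)"
    unfolding G_def H_def by (rule hessian_has_derivative[OF F_C2])
  have H_sym: "transpose H = H" unfolding H_def by (rule hessian_symmetric[OF F_C2])
  have H_pd: "pos_definite H"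
    unfolding pos_definite_def
  proof (intro conjI allI impI H_sym)
    fix v :: "real^'d" assume "v \<noteq> 0"
    then have "0 < \<mu> * (norm v)\<^sup>2" using \<mu>_pos by simp
    also have "\<dots> \<le> v \<bullet> (H *v v)"
      by (rule strongly_monotone_derivative[OF H_deriv G_mono])
    finally show "v \<bullet> (H *v v) > 0" .
  qed
  define Hi where "Hi = matrix_inv H"
  note Hi_inv = matrix_inv_both[OF pos_definite_invertible[OF H_pd], folded Hi_def]
  have Hi_pd: "pos_definite Hi" unfolding Hi_def by (rule pos_definite_matrix_inv[OF H_pd])
  then have Hi_sym: "transpose Hi = Hi" by (simp add: pos_definite_def)
  define V where "V = Hi ** \<Sigma> ** Hi"
  have V_pd: "pos_definite V"
  proof -
    have "invertible Hi" using Hi_inv by (auto simp: invertible_def)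
    then show ?thesis
      using pos_definite_congruence[of \<Sigma> Hi] Sigma_pd by (simp add: V_def Hi_sym \<Sigma>_def)
  qed

  define C0 where "C0 = \<mu> * S"
  have C0: "C0 \<ge> 0" using \<mu>_pos S_pos by (simp add: C0_def)
  \<comment> \<open>The ceiling gives \<open>2 * B k \<ge> ln c\<close>, so a factor
    \<open>exp (- 2)\<close> per epoch would leave at most \<open>1 / c\<close>; the factor 1 / 10
    is smaller because \<open>exp 2 \<le> 9\<close>.\<close>
  have B_decay: "(1 / 10) ^ B k * (norm (G \<theta>0))\<^sup>2 \<le> C0 * \<eta> k" for k
  proof (cases "G \<theta>0 = 0")
    case True
    then show ?thesis using C0 \<eta>_pos[of k] by (simp add: less_imp_le)
  next
    case False
    define c where "c = exp 1 * (norm (G \<theta>0))\<^sup>2 / (\<eta> k * \<mu> * S)"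
    have c: "c > 0" using False \<eta>_pos[of k] \<mu>_pos S_pos by (simp add: c_def)
    have "B k = nat \<lceil>1 / 2 * ln c\<rceil>" using B_eq[of k] False by (simp add: G_def c_def S_def)
    then have "real (B k) \<ge> 1 / 2 * ln c" by (simp only: of_nat_ceiling)
    then have "- 2 * real (B k) \<le> - ln c" by simp
    then have "exp (- 2 * real (B k)) \<le> exp (- ln c)" by (simp only: exp_le_cancel_iff)
    also have "\<dots> = 1 / c" using c by (simp add: exp_minus inverse_eq_divide)
    finally have e2: "exp (- 2 * real (B k)) \<le> 1 / c" .
    have "exp (2::real) \<le> 3 * 3" using exp_le mult_mono[of "exp (1::real)" 3 "exp 1" 3] by (simp add: exp_add[symmetric])
    then have "(1 / 10 :: real) \<le> exp (- 2)" by (simp add: exp_minus field_simps)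
    then have "(1 / 10 :: real) ^ B k \<le> exp (- 2) ^ B k" by (intro power_mono) auto
    also have "\<dots> = exp (- 2 * real (B k))" by (simp add: exp_of_nat_mult[symmetric] mult.commute)
    also note e2
    finally have "(1 / 10) ^ B k * (norm (G \<theta>0))\<^sup>2 \<le> 1 / c * (norm (G \<theta>0))\<^sup>2" by (rule mult_right_mono) simp
    also have "\<dots> = C0 * \<eta> k / exp 1" using False by (simp add: c_def C0_def)
    also have "\<dots> \<le> C0 * \<eta> k / 1"
      using C0 \<eta>_pos[of k] by (intro divide_left_mono) auto
    finally show ?thesis by simp
  qed

  define N where "N = (\<lambda>k. Suc (n k - Tb k * B k))"
  define X where "X = (\<lambda>k \<omega>. sqrt (real (n k)) *\<^sub>R (multi_root_sgd g (\<eta> k) (T0 k) (Tb k) (B k) \<theta>0 (\<lambda>t. \<xi> t \<omega>) (n k) - \<theta>s))"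
  have linHi: "linear ((*v) Hi)" by simp
  have HiH: "Hi *v (H *v x) = x" for x by (simp add: matrix_vector_mul_assoc Hi_inv)
  note diff = multi_epoch_charfun_diff[OF \<eta>_pos \<eta>_lim T0_eq Tb_eq B_decay C0 n_lim T_lim short_lim H_deriv linHi HiH]
  have X_rv: "M.random_variable borel (X k)" for k
  proof -
    have "24 / (\<eta> k * \<mu>) > 0" using \<eta>_pos[of k] \<mu>_pos by simp
    then have "T0 k \<ge> 1" unfolding T0_eq by linarith
    then interpret E: sgd_epoch M P \<xi> g G \<theta>s \<mu> L l\<^sub>\<Xi> S "B k * Tb k"
        "\<lambda>\<omega>. epoch_init g (\<eta> k) (T0 k) (Tb k) \<theta>0 (\<lambda>t. \<xi> t \<omega>) (B k)" "\<eta> k" "T0 k"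
      using sgd_epoch_epoch_init[OF \<eta>_pos] by simp
    have [measurable]: "M.random_variable borel (E.th (n k - Tb k * B k))"
      using E.th_sq[of "n k - Tb k * B k"] by (simp add: M.sq_integrable_def)
    have "X k = (\<lambda>\<omega>. sqrt (real (n k)) *\<^sub>R (E.th (n k - Tb k * B k) \<omega> - \<theta>s))"
      by (simp add: X_def multi_root_sgd_def E.th_def fun_eq_iff)
    also have "M.random_variable borel \<dots>" by measurable
    finally show ?thesis .
  qed
  have char_lim: "(\<lambda>k. M.expectation (\<lambda>\<omega>. iexp (t \<bullet> X k \<omega>))) \<longlonglongrightarrow> exp (- (t \<bullet> (V *v t)) / 2)" for t
  proof -
    \<comment> \<open>\<open>Hi\<close> is symmetric, so projecting \<open>Hi *v z\<close> on
      \<open>t\<close> is projecting \<open>z\<close> on \<open>Hi *v t\<close>; the sign stems from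
      solving the linearised equation for the error.\<close>
    define b where "b = - (Hi *v t)"
    have tVt: "b \<bullet> (\<Sigma> *v b) = t \<bullet> (V *v t)"
    proof -
      have "(Hi *v t) \<bullet> (\<Sigma> *v (Hi *v t)) = t \<bullet> (Hi *v (\<Sigma> *v (Hi *v t)))"
        by (metis Hi_sym dot_lmul_matrix transpose_matrix_vector)
      then show ?thesis by (simp add: b_def V_def matrix_vector_mul_assoc matrix_mul_assoc linear_neg[OF matrix_vector_mul_linear])
    qed
    let ?Y = "\<lambda>k \<omega>. t \<bullet> (- (1 / sqrt (real (N k))) *\<^sub>R (Hi *v (\<Sum>i = 1..N k. g \<theta>s (\<xi> (B k * Tb k + i) \<omega>))))"
    have Y_eq: "?Y k \<omega> = (\<Sum>i = 1..N k. b \<bullet> g \<theta>s (\<xi> (B k * Tb k + i) \<omega>)) / sqrt (real (N k))" for k \<omega>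
    proof -
      have "t \<bullet> (Hi *v z) = - (b \<bullet> z)" for z
        unfolding b_def by (simp, metis Hi_sym dot_lmul_matrix transpose_matrix_vector)
      then show ?thesis by (simp add: inner_sum_right)
    qed
    have Y_lim: "(\<lambda>k. M.expectation (\<lambda>\<omega>. iexp (?Y k \<omega>))) \<longlonglongrightarrow> exp (- (t \<bullet> (V *v t)) / 2)"
    \<comment> \<open>A vanishing \<open>b\<close> means variance 0, which
      \<open>clt_blocks_charfun\<close> excludes; both sides are then the constant 1.\<close>
    proof (cases "b = 0")
      case True
      then show ?thesis unfolding Y_eq using tVt by (simp add: M.prob_space)
    next
      case False
      have bg[measurable]: "(\<lambda>x. b \<bullet> g \<theta>s x) \<in> borel_measurable P"
        using g_int[of \<theta>s] by (intro borel_measurable_inner) auto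
      have eqd: "M.expectation (\<lambda>\<omega>. h (\<xi> i \<omega>)) = (\<integral>x. h x \<partial>P)" if "i \<ge> 1" "h \<in> borel_measurable P" for i and h :: "'x \<Rightarrow> real"
        using integral_distr[OF \<xi>_rv[OF that(1)] that(2)] ident[OF that(1)] by simp
      have "(\<lambda>k. M.expectation (\<lambda>\<omega>. iexp ((\<Sum>i = 1..N k. b \<bullet> g \<theta>s (\<xi> (B k * Tb k + i) \<omega>)) / sqrt (real (N k)))))
        \<longlonglongrightarrow> exp (- (b \<bullet> (\<Sigma> *v b)) / 2)"
      proof (rule M.clt_blocks_charfun[where Y="\<lambda>i \<omega>. b \<bullet> g \<theta>s (\<xi> i \<omega>)" and \<mu>="distr P borel (\<lambda>x. b \<bullet> g \<theta>s x)" and T=N])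
        show "M.indep_vars (\<lambda>_. borel) (\<lambda>i \<omega>. b \<bullet> g \<theta>s (\<xi> i \<omega>)) {1..}"
          using M.indep_vars_compose2[OF indep, of "\<lambda>_ x. b \<bullet> g \<theta>s x" "\<lambda>_. borel"] bg by simp
        fix i :: nat assume i: "i \<ge> 1"
        note [measurable] = \<xi>_rv[OF i]
        have "distr M borel (\<lambda>\<omega>. b \<bullet> g \<theta>s (\<xi> i \<omega>)) = distr (distr M P (\<xi> i)) borel (\<lambda>x. b \<bullet> g \<theta>s x)"
          by (subst distr_distr) (auto simp: o_def)
        then show "distr M borel (\<lambda>\<omega>. b \<bullet> g \<theta>s (\<xi> i \<omega>)) = distr P borel (\<lambda>x. b \<bullet> g \<theta>s x)" by (simp add: ident[OF i])
        show "M.expectation (\<lambda>\<omega>. b \<bullet> g \<theta>s (\<xi> i \<omega>)) = 0"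
          using eqd[OF i bg] g_int[of \<theta>s] by (simp add: g_mean G_root)
        have "integrable (distr M P (\<xi> i)) (\<lambda>x. (b \<bullet> g \<theta>s x)\<^sup>2)" using \<Sigma>_inner(1) by (simp add: ident[OF i])
        then show "integrable M (\<lambda>\<omega>. (b \<bullet> g \<theta>s (\<xi> i \<omega>))\<^sup>2)" by (subst (asm) integrable_distr_eq) auto
        show "M.expectation (\<lambda>\<omega>. (b \<bullet> g \<theta>s (\<xi> i \<omega>))\<^sup>2) = b \<bullet> (\<Sigma> *v b)"
          using eqd[OF i, of "\<lambda>x. (b \<bullet> g \<theta>s x)\<^sup>2"] by (simp add: \<Sigma>_inner(2))
      next
        show "b \<bullet> (\<Sigma> *v b) > 0" by (rule \<Sigma>_pos[OF False])
        show "filterlim N at_top sequentially" unfolding N_def by (rule diff(1))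
      qed
      then show ?thesis unfolding Y_eq tVt .
    qed
    have "(\<lambda>k. M.expectation (\<lambda>\<omega>. iexp (t \<bullet> X k \<omega>)) - M.expectation (\<lambda>\<omega>. iexp (?Y k \<omega>))) \<longlonglongrightarrow> 0"
      unfolding X_def N_def by (rule diff(2))
    from tendsto_add[OF this Y_lim] show ?thesis by (simp only: diff_add_cancel add_0)
  qed
  have "weak_convergence (\<lambda>k. distr M borel (X k)) (multi_normal 0 V)"
  proof (rule levy_continuity_euclidean)
    show "prob_space (distr M borel (X k))" for k by (rule M.prob_space_distr[OF X_rv])
    show "sets (distr M borel (X k)) = sets borel" for k by simp
    show "prob_space (multi_normal 0 V)" "sets (multi_normal 0 V) = sets borel"
      by (rule multi_normal_charfun[OF V_pd])+
    fix t :: "real^'d"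
    have "(\<integral>x. iexp (t \<bullet> x) \<partial>distr M borel (X k)) = M.expectation (\<lambda>\<omega>. iexp (t \<bullet> X k \<omega>))" for k
      using X_rv by (subst integral_distr) auto
    then show "(\<lambda>k. \<integral>x. iexp (t \<bullet> x) \<partial>distr M borel (X k)) \<longlonglongrightarrow> (\<integral>x. iexp (t \<bullet> x) \<partial>multi_normal 0 V)"
      using char_lim[of t] by (simp only: multi_normal_charfun(3)[OF V_pd])
  qed
  then show ?thesis by (simp add: X_def V_def Hi_def H_def \<Sigma>_def g_def)
qed

end
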